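(* Let $(E,\|\cdot\|)$ be a $\mathcal{T}_{\varepsilon,\lambda}$-complete random normed module over $\mathbb{K}$ with base $(\Omega,\mathcal{F},P)$, let $G$ be an $L^0$-convexly compact subset of $E$ with random normal structure, and let $\mathcal{T}$ be a commutative family of nonexpansive mappings from $G$ to $G$. Then $\mathcal{T}$ has a common fixed point, i.e. there is $x\in G$ with $T(x)=x$ for all $T\in\mathcal{T}$.
   Context: $(\Omega,\mathcal{F},P)$ is a probability space and $\mathbb{K}\in\{\mathbb{R},\mathbb{C}\}$. $L^0(\mathcal{F},\mathbb{K})$ is the algebra of a.s.-equivalence classes of $\mathbb{K}$-valued $\mathcal{F}$-measurable random variables, $L^0(\mathcal{F})=L^0(\mathcal{F},\mathbb{R})$, ordered by $\xi\le\eta$ iff $\xi\leq\eta$ a.s., and $L^0_+(\mathcal{F})=\{\xi\in L^0(\mathcal{F}):\xi\ge 0\}$. $\bigvee,\bigwedge$ denote supremum and infimum in the complete lattice $\bar L^0(\mathcal{F})$ of classes of extended real-valued random variables. $\xi>\eta$ means $\xi\ge\eta$ and $\xi\ne\eta$; "$\xi>\eta$ on $A$" means $\xi(\omega)>\eta(\omega)$ for almost all $\omega\in A$; $(\xi>\eta)=\{\omega:\xi(\omega)>\eta(\omega)\}$ (up to null sets). A random normed module (RN module) over $\mathbb{K}$ with base $(\Omega,\mathcal{F},P)$ is an $L^0(\mathcal{F},\mathbb{K})$-module $E$ with a map $\|\cdot\|:E\to L^0_+(\mathcal{F})$ such that $\|\xi x\|=|\xi|\|x\|$, $\|x+y\|\le\|x\|+\|y\|$,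 and $\|x\|=0$ implies $x=\theta$ (the null element). The $(\varepsilon,\lambda)$-topology $\mathcal{T}_{\varepsilon,\lambda}$ is the metrizable linear topology with local base at $\theta$ the sets $\{x: P\{\|x\|<\varepsilon\}>1-\lambda\}$, $\varepsilon>0$, $0<\lambda<1$ ($x_n\to x$ iff $\|x_n-x\|\to0$ in probability). $G\subset E$ is a.s. bounded if $\bigvee\{\|g\|:g\in G\}\in L^0_+(\mathcal F)$, and $L^0$-convex if $\xi x+(1-\xi)y\in G$ for all $x,y\in G$ and $\xi\in L^0_+(\mathcal F)$ with $0\le\xi\le1$. A nonempty $\mathcal{T}_{\varepsilon,\lambda}$-closed $L^0$-convex $G\subset E$ is $L^0$-convexly compact if every family of $\mathcal{T}_{\varepsilon,\lambda}$-closed $L^0$-convex subsets of $G$ with the finite intersection property has nonempty intersection. For $H\subset E$ nonempty a.s. bounded, $R(H,x)=\bigvee\{\|x-y\|:y\in H\}$ and $D(H)=\bigvee\{\|x-y\|:x,y\in H\}$. A nonempty $\mathcal{T}_{\varepsilon,\lambda}$-closed $L^0$-convex $G\subset E$ has random normal structure if for each a.s. bounded $\mathcal{T}_{\varepsilon,\lambda}$-closed $L^0$-convex $H\subset G$ with $D(H)>0$ there is $z\in H$ with $R(H,z)<D(H)$ on $(D(H)>0)$. $T:G\to G$ is nonexpansive if $\|Tx-Ty\|\le\|x-y\|$ for all $x,y\in G$. A family of self-mappings is commutative if any two of its members commute under composition. *)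

theory Defs
  imports "HOL-Probability.Probability" "HOL-Algebra.Module" "HOL-Algebra.Lattice"
begin

section \<open>Classes of random variables modulo almost sure equality\<close>

definition L0_class :: "'w measure \<Rightarrow> ('w \<Rightarrow> 'v::topological_space) \<Rightarrow> ('w \<Rightarrow> 'v) set" where
  "L0_class M f = {g \<in> borel_measurable M. AE w in M. g w = f w}"

definition L0 :: "'w measure \<Rightarrow> ('w \<Rightarrow> 'v::topological_space) set set" where
  "L0 M = L0_class M ` borel_measurable M"

definition L0_rep :: "('w \<Rightarrow> 'v) set \<Rightarrow> 'w \<Rightarrow> 'v" where
  "L0_rep \<xi> = (SOME f. f \<in> \<xi>)"

text \<open>Order, and strict order on an event, do not depend on the chosen representatives
  and are used for real as well as for extended real valued classes.\<close>

definition L0_le :: "'w measure \<Rightarrow> ('w \<Rightarrow> 'v::linorder) set \<Rightarrow> ('w \<Rightarrow> 'v) set \<Rightarrow> bool" where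
  "L0_le M \<xi> \<eta> \<longleftrightarrow> (AE w in M. L0_rep \<xi> w \<le> L0_rep \<eta> w)"

definition L0_gt :: "'w measure \<Rightarrow> ('w \<Rightarrow> 'v::linorder) set \<Rightarrow> ('w \<Rightarrow> 'v) set \<Rightarrow> bool" where
  "L0_gt M \<xi> \<eta> \<longleftrightarrow> L0_le M \<eta> \<xi> \<and> \<xi> \<noteq> \<eta>"

definition L0_gt_on ::
  "'w measure \<Rightarrow> 'w set \<Rightarrow> ('w \<Rightarrow> 'v::linorder) set \<Rightarrow> ('w \<Rightarrow> 'v) set \<Rightarrow> bool" where
  "L0_gt_on M A \<xi> \<eta> \<longleftrightarrow> (AE w in M. w \<in> A \<longrightarrow> L0_rep \<xi> w > L0_rep \<eta> w)"

definition L0_gt_event ::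
  "'w measure \<Rightarrow> ('w \<Rightarrow> 'v::linorder) set \<Rightarrow> ('w \<Rightarrow> 'v) set \<Rightarrow> 'w set" where
  "L0_gt_event M \<xi> \<eta> = {w \<in> space M. L0_rep \<xi> w > L0_rep \<eta> w}"

definition L0_const :: "'w measure \<Rightarrow> 'v::topological_space \<Rightarrow> ('w \<Rightarrow> 'v) set" where
  "L0_const M c = L0_class M (\<lambda>_. c)"

text \<open>The map induced by \<open>h\<close> on classes; below \<open>h\<close> is the absolute value
  or one of the embeddings of the reals into the scalars and into the extended reals.\<close>

definition L0_map ::
  "'w measure \<Rightarrow> ('u \<Rightarrow> 'v::topological_space) \<Rightarrow> ('w \<Rightarrow> 'u) set \<Rightarrow> ('w \<Rightarrow> 'v) set" where
  "L0_map M h \<xi> = L0_class M (\<lambda>w. h (L0_rep \<xi> w))"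

definition L0_plus :: "'w measure \<Rightarrow> ('w \<Rightarrow> real) set set" where
  "L0_plus M = {\<xi> \<in> L0 M. L0_le M (L0_const M 0) \<xi>}"

text \<open>The scalar type ranges over \<open>real_normed_field\<close> (with the countability property that makes
  sums and products of Borel functions Borel).  The norm of such a field is multiplicative, so by
  the Gelfand-Mazur theorem the only instances, up to isometric isomorphism, are \<^typ>\<open>real\<close> and
  \<^typ>\<open>complex\<close>.\<close>

definition L0_ring ::
  "'w measure \<Rightarrow> ('w \<Rightarrow> 'k::{real_normed_field, second_countable_topology}) set ring" where
  "L0_ring M =
    \<lparr>carrier = L0 M,
     mult = (\<lambda>\<xi> \<eta>. L0_class M (\<lambda>w. L0_rep \<xi> w * L0_rep \<eta> w)),
     one = L0_const M 1,
     zero = L0_const M 0,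
     add = (\<lambda>\<xi> \<eta>. L0_class M (\<lambda>w. L0_rep \<xi> w + L0_rep \<eta> w))\<rparr>"

definition L0_bar :: "'w measure \<Rightarrow> ('w \<Rightarrow> ereal) set gorder" where
  "L0_bar M = \<lparr>carrier = L0 M, eq = (=), le = L0_le M\<rparr>"

lemma L0_class_cong:
  assumes "AE w in M. f w = g w"
  shows "L0_class M f = L0_class M g"
proof -
  have "(AE w in M. h w = f w) \<longleftrightarrow> (AE w in M. h w = g w)" for h
    using assms by (intro iffI) (auto elim: AE_mp)
  then show ?thesis by (simp add: L0_class_def)
qed

lemma L0_class_in_L0: "f \<in> borel_measurable M \<Longrightarrow> L0_class M f \<in> L0 M"
  by (auto simp: L0_def)

lemma L0_rep_class:
  assumes "f \<in> borel_measurable M"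
  shows "L0_rep (L0_class M f) \<in> borel_measurable M" "AE w in M. L0_rep (L0_class M f) w = f w"
proof -
  have "f \<in> L0_class M f" using assms by (simp add: L0_class_def)
  then have "L0_rep (L0_class M f) \<in> L0_class M f" unfolding L0_rep_def by (rule someI[of "\<lambda>h. h \<in> L0_class M f"])
  then show "L0_rep (L0_class M f) \<in> borel_measurable M"
    "AE w in M. L0_rep (L0_class M f) w = f w" by (auto simp: L0_class_def)
qed

lemma L0_rep_measurable [measurable]: "\<xi> \<in> L0 M \<Longrightarrow> L0_rep \<xi> \<in> borel_measurable M"
  by (auto simp: L0_def L0_rep_class)

lemma L0_class_rep: "\<xi> \<in> L0 M \<Longrightarrow> L0_class M (L0_rep \<xi>) = \<xi>"
  by (auto simp: L0_def intro!: L0_class_cong L0_rep_class)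

lemma L0_class_mult:
  fixes f g :: "'w \<Rightarrow> 'k::{real_normed_field, second_countable_topology}"
  assumes "f \<in> borel_measurable M" "g \<in> borel_measurable M"
  shows "L0_class M f \<otimes>\<^bsub>L0_ring M\<^esub> L0_class M g = L0_class M (\<lambda>w. f w * g w)"
  unfolding L0_ring_def using L0_rep_class(2)[OF assms(1)] L0_rep_class(2)[OF assms(2)]
  by (auto intro!: L0_class_cong)

lemma L0_class_add:
  fixes f g :: "'w \<Rightarrow> 'k::{real_normed_field, second_countable_topology}"
  assumes "f \<in> borel_measurable M" "g \<in> borel_measurable M"
  shows "L0_class M f \<oplus>\<^bsub>L0_ring M\<^esub> L0_class M g = L0_class M (\<lambda>w. f w + g w)"
  unfolding L0_ring_def using L0_rep_class(2)[OF assms(1)] L0_rep_class(2)[OF assms(2)]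
  by (auto intro!: L0_class_cong)

lemma L0_ring_simps:
  "carrier (L0_ring M) = L0_class M ` borel_measurable M"
  "\<one>\<^bsub>L0_ring M\<^esub> = L0_class M (\<lambda>_. 1)"
  "\<zero>\<^bsub>L0_ring M\<^esub> = L0_class M (\<lambda>_. 0)"
  by (simp_all add: L0_ring_def L0_def L0_const_def)

lemma cring_L0_ring:
  "cring (L0_ring M :: ('w \<Rightarrow> 'k::{real_normed_field, second_countable_topology}) set ring)"
proof (rule cringI)
  show "abelian_group (L0_ring M :: ('w \<Rightarrow> 'k) set ring)"
  proof (rule abelian_groupI, goal_cases)
    case (6 x)
    then obtain f where f: "f \<in> borel_measurable M" "x = L0_class M f"
      by (auto simp: L0_ring_simps)
    show ?case
      by (rule bexI[of _ "L0_class M (\<lambda>w. - f w)"])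
        (use f in \<open>auto simp: L0_ring_simps L0_class_add\<close>)
  qed (auto simp: L0_ring_simps L0_class_add algebra_simps)
  show "Group.comm_monoid (L0_ring M :: ('w \<Rightarrow> 'k) set ring)"
    by (rule comm_monoidI) (auto simp: L0_ring_simps L0_class_mult algebra_simps)
qed (auto simp: L0_ring_simps L0_class_add L0_class_mult algebra_simps)

section \<open>Random normed modules\<close>

record ('w, 'k, 'e) rn_module = "(('w \<Rightarrow> 'k) set, 'e) module" +
  rnorm :: "'e \<Rightarrow> ('w \<Rightarrow> real) set"

locale rn_module = prob_space M + E: Module.module "L0_ring M" E
  for M :: "'w measure"
    and E :: "('w, 'k::{real_normed_field, second_countable_topology}, 'e) rn_module" +
  assumes rnorm_closed: "x \<in> carrier E \<Longrightarrow> rnorm E x \<in> L0_plus M"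
    and rnorm_smult: "\<lbrakk>\<xi> \<in> L0 M; x \<in> carrier E\<rbrakk> \<Longrightarrow>
      rnorm E (\<xi> \<odot>\<^bsub>E\<^esub> x) = L0_map M norm \<xi> \<otimes>\<^bsub>L0_ring M\<^esub> rnorm E x"
    and rnorm_triangle: "\<lbrakk>x \<in> carrier E; y \<in> carrier E\<rbrakk> \<Longrightarrow>
      L0_le M (rnorm E (x \<oplus>\<^bsub>E\<^esub> y)) (rnorm E x \<oplus>\<^bsub>L0_ring M\<^esub> rnorm E y)"
    and rnorm_eq_0: "\<lbrakk>x \<in> carrier E; rnorm E x = L0_const M 0\<rbrakk> \<Longrightarrow> x = \<zero>\<^bsub>E\<^esub>"

subsection \<open>The topology of convergence in probability\<close>

definition eps_lam_nbhd ::
  "'w measure \<Rightarrow> ('w, 'k, 'e) rn_module \<Rightarrow> real \<Rightarrow> real \<Rightarrow> 'e set" where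
  "eps_lam_nbhd M E \<epsilon> \<delta> =
    {x \<in> carrier E. measure M {w \<in> space M. L0_rep (rnorm E x) w < \<epsilon>} > 1 - \<delta>}"

definition eps_lam_topology ::
  "'w measure \<Rightarrow> ('w, 'k, 'e) rn_module \<Rightarrow> 'e topology" where
  "eps_lam_topology M E = topology (\<lambda>U. U \<subseteq> carrier E \<and>
    (\<forall>x\<in>U. \<exists>\<epsilon> \<delta>. 0 < \<epsilon> \<and> 0 < \<delta> \<and> \<delta> < 1 \<and>
      (\<forall>y\<in>carrier E. y \<ominus>\<^bsub>E\<^esub> x \<in> eps_lam_nbhd M E \<epsilon> \<delta> \<longrightarrow> y \<in> U)))"

text \<open>As the topology is metrizable and linear, completeness is sequential completeness with
  respect to its uniformity.\<close>

definition eps_lam_complete :: "'w measure \<Rightarrow> ('w, 'k, 'e) rn_module \<Rightarrow> bool" where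
  "eps_lam_complete M E \<longleftrightarrow>
    (\<forall>x :: nat \<Rightarrow> 'e. range x \<subseteq> carrier E \<longrightarrow>
      (\<forall>\<epsilon> \<delta>. 0 < \<epsilon> \<and> 0 < \<delta> \<and> \<delta> < 1 \<longrightarrow>
        (\<exists>N. \<forall>m\<ge>N. \<forall>n\<ge>N. x m \<ominus>\<^bsub>E\<^esub> x n \<in> eps_lam_nbhd M E \<epsilon> \<delta>)) \<longrightarrow>
      (\<exists>l. limitin (eps_lam_topology M E) x l sequentially))"

lemma eps_lam_nbhd_mono:
  assumes "prob_space M" "\<And>x. x \<in> carrier E \<Longrightarrow> rnorm E x \<in> L0 M" "\<epsilon> \<le> \<epsilon>'" "\<delta> \<le> \<delta>'"
  shows "eps_lam_nbhd M E \<epsilon> \<delta> \<subseteq> eps_lam_nbhd M E \<epsilon>' \<delta>'"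
proof
  interpret prob_space M by fact
  fix x assume x: "x \<in> eps_lam_nbhd M E \<epsilon> \<delta>"
  then have [measurable]: "L0_rep (rnorm E x) \<in> borel_measurable M"
    using assms(2) by (auto simp: eps_lam_nbhd_def L0_rep_measurable)
  have "prob {w \<in> space M. L0_rep (rnorm E x) w < \<epsilon>}
      \<le> prob {w \<in> space M. L0_rep (rnorm E x) w < \<epsilon>'}"
    using assms(3) by (intro finite_measure_mono) auto
  then show "x \<in> eps_lam_nbhd M E \<epsilon>' \<delta>'"
    using x assms(4) by (auto simp: eps_lam_nbhd_def)
qed

lemma (in rn_module) openin_eps_lam_topology:
  "openin (eps_lam_topology M E) U \<longleftrightarrow> U \<subseteq> carrier E \<and>
    (\<forall>x\<in>U. \<exists>\<epsilon> \<delta>. 0 < \<epsilon> \<and> 0 < \<delta> \<and> \<delta> < 1 \<and>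
      (\<forall>y\<in>carrier E. y \<ominus>\<^bsub>E\<^esub> x \<in> eps_lam_nbhd M E \<epsilon> \<delta> \<longrightarrow> y \<in> U))"
proof -
  let ?P = "\<lambda>U x \<epsilon> \<delta>. 0 < \<epsilon> \<and> 0 < \<delta> \<and> \<delta> < 1 \<and>
      (\<forall>y\<in>carrier E. y \<ominus>\<^bsub>E\<^esub> x \<in> eps_lam_nbhd M E \<epsilon> \<delta> \<longrightarrow> y \<in> U)"
  let ?O = "\<lambda>U. U \<subseteq> carrier E \<and> (\<forall>x\<in>U. \<exists>\<epsilon> \<delta>. ?P U x \<epsilon> \<delta>)"
  have mono: "eps_lam_nbhd M E \<epsilon> \<delta> \<subseteq> eps_lam_nbhd M E \<epsilon>' \<delta>'"
    if "\<epsilon> \<le> \<epsilon>'" "\<delta> \<le> \<delta>'" for \<epsilon> \<epsilon>' \<delta> \<delta>'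
    using that rnorm_closed by (intro eps_lam_nbhd_mono prob_space_axioms) (auto simp: L0_plus_def)
  have "?O (S \<inter> T)" if S: "?O S" and T: "?O T" for S T
  proof (intro conjI ballI)
    show "S \<inter> T \<subseteq> carrier E" using S by blast
    fix x assume x: "x \<in> S \<inter> T"
    obtain a b where ab: "?P S x a b" using x S by blast
    obtain c d where cd: "?P T x c d" using x T by blast
    have "?P (S \<inter> T) x (min a c) (min b d)"
      using ab cd mono[of "min a c" a "min b d" b] mono[of "min a c" c "min b d" d] by auto
    then show "\<exists>\<epsilon> \<delta>. ?P (S \<inter> T) x \<epsilon> \<delta>" by blast
  qed
  moreover have "?O (\<Union>\<K>)" if \<K>: "\<forall>K\<in>\<K>. ?O K" for \<K>
  proof (intro conjI ballI)
    show "\<Union>\<K> \<subseteq> carrier E" using \<K> by blast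
    fix x assume "x \<in> \<Union>\<K>"
    then obtain K where K: "K \<in> \<K>" "x \<in> K" by blast
    then obtain a b where "?P K x a b" using \<K> by blast
    then have "?P (\<Union>\<K>) x a b" using K by blast
    then show "\<exists>\<epsilon> \<delta>. ?P (\<Union>\<K>) x \<epsilon> \<delta>" by blast
  qed
  ultimately have "istopology ?O" unfolding istopology_def by blast
  then show ?thesis by (simp add: eps_lam_topology_def topology_inverse')
qed

subsection \<open>Convexity, compactness and normal structure\<close>

definition L0_convex ::
  "'w measure \<Rightarrow> ('w, 'k::{real_normed_field, second_countable_topology}, 'e) rn_module
    \<Rightarrow> 'e set \<Rightarrow> bool" where
  "L0_convex M E G \<longleftrightarrow>
    (\<forall>x\<in>G. \<forall>y\<in>G. \<forall>\<xi>\<in>L0_plus M. L0_le M \<xi> (L0_const M 1) \<longrightarrow>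
      (L0_map M of_real \<xi> \<odot>\<^bsub>E\<^esub> x) \<oplus>\<^bsub>E\<^esub>
      ((\<one>\<^bsub>L0_ring M\<^esub> \<ominus>\<^bsub>L0_ring M\<^esub> L0_map M of_real \<xi>) \<odot>\<^bsub>E\<^esub> y) \<in> G)"

definition L0_convexly_compact ::
  "'w measure \<Rightarrow> ('w, 'k::{real_normed_field, second_countable_topology}, 'e) rn_module
    \<Rightarrow> 'e set \<Rightarrow> bool" where
  "L0_convexly_compact M E G \<longleftrightarrow>
    G \<noteq> {} \<and> closedin (eps_lam_topology M E) G \<and> L0_convex M E G \<and>
    (\<forall>\<A>. (\<forall>A\<in>\<A>. A \<subseteq> G \<and> closedin (eps_lam_topology M E) A \<and> L0_convex M E A) \<and>
      (\<forall>\<F>\<subseteq>\<A>. finite \<F> \<and> \<F> \<noteq> {} \<longrightarrow> \<Inter>\<F> \<noteq> {}) \<longrightarrow> \<Inter>\<A> \<noteq> {})"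

definition rnorm_bar :: "'w measure \<Rightarrow> ('w, 'k, 'e) rn_module \<Rightarrow> 'e \<Rightarrow> ('w \<Rightarrow> ereal) set" where
  "rnorm_bar M E x = L0_map M ereal (rnorm E x)"

definition as_bounded :: "'w measure \<Rightarrow> ('w, 'k, 'e) rn_module \<Rightarrow> 'e set \<Rightarrow> bool" where
  "as_bounded M E G \<longleftrightarrow> \<Squnion>\<^bsub>L0_bar M\<^esub> (rnorm_bar M E ` G) \<in> L0_map M ereal ` L0_plus M"

definition rand_radius ::
  "'w measure \<Rightarrow> ('w, 'k, 'e) rn_module \<Rightarrow> 'e set \<Rightarrow> 'e \<Rightarrow> ('w \<Rightarrow> ereal) set" where
  "rand_radius M E H x = \<Squnion>\<^bsub>L0_bar M\<^esub> {rnorm_bar M E (x \<ominus>\<^bsub>E\<^esub> y) | y. y \<in> H}"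

definition rand_diam :: "'w measure \<Rightarrow> ('w, 'k, 'e) rn_module \<Rightarrow> 'e set \<Rightarrow> ('w \<Rightarrow> ereal) set" where
  "rand_diam M E H = \<Squnion>\<^bsub>L0_bar M\<^esub> {rnorm_bar M E (x \<ominus>\<^bsub>E\<^esub> y) | x y. x \<in> H \<and> y \<in> H}"

definition random_normal_structure ::
  "'w measure \<Rightarrow> ('w, 'k::{real_normed_field, second_countable_topology}, 'e) rn_module
    \<Rightarrow> 'e set \<Rightarrow> bool" where
  "random_normal_structure M E G \<longleftrightarrow>
    G \<noteq> {} \<and> closedin (eps_lam_topology M E) G \<and> L0_convex M E G \<and>
    (\<forall>H\<subseteq>G. H \<noteq> {} \<and> as_bounded M E H \<and> closedin (eps_lam_topology M E) H \<and> L0_convex M E H \<and>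
        L0_gt M (rand_diam M E H) (L0_const M 0) \<longrightarrow>
      (\<exists>z\<in>H. L0_gt_on M (L0_gt_event M (rand_diam M E H) (L0_const M 0))
        (rand_diam M E H) (rand_radius M E H z)))"

definition nonexpansive_on ::
  "'w measure \<Rightarrow> ('w, 'k, 'e) rn_module \<Rightarrow> 'e set \<Rightarrow> ('e \<Rightarrow> 'e) \<Rightarrow> bool" where
  "nonexpansive_on M E G T \<longleftrightarrow> T \<in> G \<rightarrow> G \<and>
    (\<forall>x\<in>G. \<forall>y\<in>G. L0_le M (rnorm E (T x \<ominus>\<^bsub>E\<^esub> T y)) (rnorm E (x \<ominus>\<^bsub>E\<^esub> y)))"

definition commutative_family_on :: "'e set \<Rightarrow> ('e \<Rightarrow> 'e) set \<Rightarrow> bool" where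
  "commutative_family_on G \<T> \<longleftrightarrow> (\<forall>S\<in>\<T>. \<forall>T\<in>\<T>. \<forall>x\<in>G. S (T x) = T (S x))"

end

theory Submission
  imports Defs
begin

text \<open>The argument is Kirk's: pass to a minimal invariant set and show that normal structure forces it to be
a single point. Everything is expressed through the pointwise distance \<open>dst x y w\<close>, a version of
\<open>\<parallel>x - y\<parallel>\<close>, and the combinations \<open>cmb f x y = f x + (1 - f) y\<close>. In these terms closedness means
closedness under almost everywhere convergent sequences (\<open>closedin_iff_AE_limits\<close>), and convex
compactness allows to glue countably many points of the set along a partition of the probability space
(\<open>ccompact_concatenation\<close>), which replaces every measurable selection.

Normal structure speaks about almost surely bounded sets only, so the set \<open>G\<close> first has to be shown
bounded (\<open>ccompact_bounded\<close>). For Banach spaces this is the uniform boundedness principle; here a direct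
argument avoids functionals. If \<open>G\<close> is unbounded on an event, one tries to choose contractions
\<open>\<lambda> y + (1 - \<lambda>) q\<close> of \<open>G\<close> into itself with nested images further and further away from a point \<open>p\<close> of \<open>G\<close>; a common point
of the images would be at infinite distance from \<open>p\<close>. If the choice breaks down, then every far away \<open>x\<close> has, up to a
bounded error, its reflection \<open>2 p - x\<close> in all sets \<open>\<epsilon> G + (1 - \<epsilon>) p\<close>. Compactness produces one point
common to these sets, hence a ray from \<open>p\<close> inside \<open>G\<close>, which has to be trivial
(\<open>recession_trivial\<close>), so \<open>x\<close> was not far away.

Let \<open>K\<close> be a minimal closed convex invariant set. For a commutative family, the sets \<open>s K\<close>, with \<open>s\<close> a
composition of members, form a directed family, and \<open>r(y) = inf\<^sub>s sup\<^sub>z \<parallel>s z - y\<parallel>\<close> is a convex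
continuous function with \<open>r(T y) \<le> r(y)\<close>. Its sublevel sets are closed, convex and invariant, so \<open>r\<close>
is constant on \<open>K\<close>, say equal to \<open>\<rho>\<close>. If \<open>\<rho>\<close> vanishes then any two points of \<open>K\<close> are limits of the same
net and coincide. Otherwise, as \<open>r = \<rho>\<close> at finitely many points and at a barycenter of them
simultaneously, there is a point almost at distance \<open>\<rho>\<close> from all of these (\<open>equidistant_point\<close>). Iterating
this gives a sequence whose distances are at most \<open>\<rho>\<close> and such that every point of its convex
hull is at distance almost \<open>\<rho>\<close> from the later members. The result is a closed convex set of diameter
\<open>\<rho>\<close> all of whose points have radius \<open>\<rho>\<close> (\<open>diametral_set\<close>), and normal structure excludes it
(\<open>no_diametral_set\<close>). That passage from normal structure to asymptotic centers is due to Lim.\<close>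


section \<open>Scalar multiplication by real random variables and affine combinations\<close>

context rn_module
begin

definition scale :: "('w \<Rightarrow> real) \<Rightarrow> 'e \<Rightarrow> 'e" where
  "scale f x = L0_class M (\<lambda>w. of_real (f w)) \<odot>\<^bsub>E\<^esub> x"

text \<open>The weight is not restricted to the unit interval: weights outside of it invert homotheties and reflect points.\<close>

definition cmb :: "('w \<Rightarrow> real) \<Rightarrow> 'e \<Rightarrow> 'e \<Rightarrow> 'e" where
  "cmb f x y = scale f x \<oplus>\<^bsub>E\<^esub> scale (\<lambda>w. 1 - f w) y"

definition nrm :: "'e \<Rightarrow> 'w \<Rightarrow> real" where
  "nrm x = L0_rep (rnorm E x)"

definition dst :: "'e \<Rightarrow> 'e \<Rightarrow> 'w \<Rightarrow> real" where
  "dst x y = nrm (x \<ominus>\<^bsub>E\<^esub> y)"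

lemma scalar_in_L0:
  assumes [measurable]: "f \<in> borel_measurable M"
  shows "(\<lambda>w. of_real (f w) :: 'k) \<in> borel_measurable M"
    "L0_class M (\<lambda>w. of_real (f w) :: 'k) \<in> carrier (L0_ring M)"
proof -
  show "(\<lambda>w. of_real (f w) :: 'k) \<in> borel_measurable M"
    by measurable
  then show "L0_class M (\<lambda>w. of_real (f w) :: 'k) \<in> carrier (L0_ring M)"
    by (simp add: L0_ring_simps)
qed

lemma scale_closed: "f \<in> borel_measurable M \<Longrightarrow> x \<in> carrier E \<Longrightarrow> scale f x \<in> carrier E"
  unfolding scale_def by (intro E.smult_closed scalar_in_L0)

lemma scale_add_left:
  assumes "f \<in> borel_measurable M" "g \<in> borel_measurable M" "x \<in> carrier E"
  shows "scale (\<lambda>w. f w + g w) x = scale f x \<oplus>\<^bsub>E\<^esub> scale g x"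
  unfolding scale_def using assms scalar_in_L0[OF assms(1)] scalar_in_L0[OF assms(2)]
  by (simp add: E.smult_l_distr[symmetric] L0_class_add)

lemma scale_add_right:
  assumes "f \<in> borel_measurable M" "x \<in> carrier E" "y \<in> carrier E"
  shows "scale f (x \<oplus>\<^bsub>E\<^esub> y) = scale f x \<oplus>\<^bsub>E\<^esub> scale f y"
  unfolding scale_def using assms scalar_in_L0[OF assms(1)] by (simp add: E.smult_r_distr)

lemma scale_scale:
  assumes "f \<in> borel_measurable M" "g \<in> borel_measurable M" "x \<in> carrier E"
  shows "scale f (scale g x) = scale (\<lambda>w. f w * g w) x"
  unfolding scale_def using assms scalar_in_L0[OF assms(1)] scalar_in_L0[OF assms(2)]
  by (simp add: E.smult_assoc1[symmetric] L0_class_mult)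

lemma scale_1: "x \<in> carrier E \<Longrightarrow> scale (\<lambda>w. 1) x = x"
  unfolding scale_def using E.smult_one by (simp add: L0_ring_simps)

lemma scale_0: "x \<in> carrier E \<Longrightarrow> scale (\<lambda>w. 0) x = \<zero>\<^bsub>E\<^esub>"
  unfolding scale_def using E.smult_l_null by (simp add: L0_ring_simps)

lemma minus_eq_scale:
  assumes "x \<in> carrier E" "y \<in> carrier E"
  shows "x \<ominus>\<^bsub>E\<^esub> y = x \<oplus>\<^bsub>E\<^esub> scale (\<lambda>w. - 1) y"
proof -
  have "y \<oplus>\<^bsub>E\<^esub> scale (\<lambda>w. - 1) y = scale (\<lambda>w. 1 + - 1) y"
    using assms scale_add_left[of "\<lambda>w. 1" "\<lambda>w. - 1" y] by (simp add: scale_1)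
  then have "y \<oplus>\<^bsub>E\<^esub> scale (\<lambda>w. - 1) y = \<zero>\<^bsub>E\<^esub>"
    using assms by (simp add: scale_0)
  then have "scale (\<lambda>w. - 1) y = \<ominus>\<^bsub>E\<^esub> y"
    using assms scale_closed[of "\<lambda>w. - 1" y] by (metis E.M.minus_equality E.M.add.m_comm measurable_const UNIV_I space_borel)
  then show ?thesis by (simp add: a_minus_def)
qed

text \<open>A normal form for affine identities: once every point is written as \<open>lin4\<close> with unit coefficients, an
identity between nested combinations of at most four points reduces to four identities between real
coefficient functions.\<close>

definition lin4 where
  "lin4 x y z p a b c e = (scale a x \<oplus>\<^bsub>E\<^esub> scale b y) \<oplus>\<^bsub>E\<^esub> (scale c z \<oplus>\<^bsub>E\<^esub> scale e p)"

lemma lin4_cong: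
  "(\<And>w. a w = a' w) \<Longrightarrow> (\<And>w. b w = b' w) \<Longrightarrow> (\<And>w. c w = c' w) \<Longrightarrow> (\<And>w. e w = e' w) \<Longrightarrow>
   lin4 x y z p a b c e = lin4 x y z p a' b' c' e'"
  by (metis ext)

lemma lin4_unit:
  assumes "x \<in> carrier E" "y \<in> carrier E" "z \<in> carrier E" "p \<in> carrier E"
  shows "lin4 x y z p (\<lambda>_. 1) (\<lambda>_. 0) (\<lambda>_. 0) (\<lambda>_. 0) = x"
    "lin4 x y z p (\<lambda>_. 0) (\<lambda>_. 1) (\<lambda>_. 0) (\<lambda>_. 0) = y"
    "lin4 x y z p (\<lambda>_. 0) (\<lambda>_. 0) (\<lambda>_. 1) (\<lambda>_. 0) = z"
    "lin4 x y z p (\<lambda>_. 0) (\<lambda>_. 0) (\<lambda>_. 0) (\<lambda>_. 1) = p"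
  using assms by (simp_all add: lin4_def scale_0 scale_1)

context
  fixes x y z p
  assumes pts: "x \<in> carrier E" "y \<in> carrier E" "z \<in> carrier E" "p \<in> carrier E"
begin

context
  fixes a b c e :: "'w \<Rightarrow> real"
  assumes abce: "a \<in> borel_measurable M" "b \<in> borel_measurable M" "c \<in> borel_measurable M" "e \<in> borel_measurable M"
begin

lemma lin4_closed: "lin4 x y z p a b c e \<in> carrier E"
  using abce pts by (simp add: lin4_def scale_closed)

lemma scale_lin4:
  assumes "f \<in> borel_measurable M"
  shows "scale f (lin4 x y z p a b c e) =
    lin4 x y z p (\<lambda>w. f w * a w) (\<lambda>w. f w * b w) (\<lambda>w. f w * c w) (\<lambda>w. f w * e w)"
  using assms abce pts by (simp add: lin4_def scale_closed scale_add_right scale_scale)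

end

lemma lin4_add:
  assumes "a \<in> borel_measurable M" "b \<in> borel_measurable M" "c \<in> borel_measurable M" "e \<in> borel_measurable M"
    "a' \<in> borel_measurable M" "b' \<in> borel_measurable M" "c' \<in> borel_measurable M" "e' \<in> borel_measurable M"
  shows "lin4 x y z p a b c e \<oplus>\<^bsub>E\<^esub> lin4 x y z p a' b' c' e' =
    lin4 x y z p (\<lambda>w. a w + a' w) (\<lambda>w. b w + b' w) (\<lambda>w. c w + c' w) (\<lambda>w. e w + e' w)"
  using assms pts by (simp add: lin4_def scale_closed scale_add_left E.M.a_ac)

context
  fixes a b c e a' b' c' e' :: "'w \<Rightarrow> real"
  assumes abce: "a \<in> borel_measurable M" "b \<in> borel_measurable M" "c \<in> borel_measurable M" "e \<in> borel_measurable M"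
    "a' \<in> borel_measurable M" "b' \<in> borel_measurable M" "c' \<in> borel_measurable M" "e' \<in> borel_measurable M"
begin

lemma cmb_lin4:
  assumes "f \<in> borel_measurable M"
  shows "cmb f (lin4 x y z p a b c e) (lin4 x y z p a' b' c' e') =
    lin4 x y z p (\<lambda>w. f w * a w + (1 - f w) * a' w) (\<lambda>w. f w * b w + (1 - f w) * b' w)
      (\<lambda>w. f w * c w + (1 - f w) * c' w) (\<lambda>w. f w * e w + (1 - f w) * e' w)"
  unfolding cmb_def using assms abce by (simp add: scale_lin4 lin4_add)

lemma minus_lin4:
  "lin4 x y z p a b c e \<ominus>\<^bsub>E\<^esub> lin4 x y z p a' b' c' e' =
    lin4 x y z p (\<lambda>w. a w - a' w) (\<lambda>w. b w - b' w) (\<lambda>w. c w - c' w) (\<lambda>w. e w - e' w)"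
  using abce by (simp add: minus_eq_scale lin4_closed scale_lin4 lin4_add)

end

lemmas lin4_simps = lin4_closed lin4_add scale_lin4 cmb_lin4 minus_lin4


lemmas pt_units = lin4_unit[OF pts]

abbreviation "pt1 \<equiv> lin4 x y z p (\<lambda>_. 1) (\<lambda>_. 0) (\<lambda>_. 0) (\<lambda>_. 0)"
abbreviation "pt2 \<equiv> lin4 x y z p (\<lambda>_. 0) (\<lambda>_. 1) (\<lambda>_. 0) (\<lambda>_. 0)"
abbreviation "pt3 \<equiv> lin4 x y z p (\<lambda>_. 0) (\<lambda>_. 0) (\<lambda>_. 1) (\<lambda>_. 0)"
abbreviation "pt4 \<equiv> lin4 x y z p (\<lambda>_. 0) (\<lambda>_. 0) (\<lambda>_. 0) (\<lambda>_. 1)"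

text \<open>The medial law is what makes homothetic images of convex sets, and sets of points carrying a fixed weight in a given point, convex.\<close>

lemma cmb_interchange:
  assumes [measurable]: "f \<in> borel_measurable M" "h \<in> borel_measurable M"
  shows "cmb h (cmb f x y) (cmb f z p) = cmb f (cmb h x z) (cmb h y p)"
proof -
  have "cmb h (cmb f pt1 pt2) (cmb f pt3 pt4) = cmb f (cmb h pt1 pt3) (cmb h pt2 pt4)"
    by (simp add: lin4_simps, rule lin4_cong; simp add: algebra_simps)
  then show ?thesis by (simp only: pt_units)
qed

lemma cmb_minus_cmb:
  assumes [measurable]: "f \<in> borel_measurable M"
  shows "cmb f x y \<ominus>\<^bsub>E\<^esub> cmb f z p = scale f (x \<ominus>\<^bsub>E\<^esub> z) \<oplus>\<^bsub>E\<^esub> scale (\<lambda>w. 1 - f w) (y \<ominus>\<^bsub>E\<^esub> p)"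
proof -
  have "cmb f pt1 pt2 \<ominus>\<^bsub>E\<^esub> cmb f pt3 pt4 =
      scale f (pt1 \<ominus>\<^bsub>E\<^esub> pt3) \<oplus>\<^bsub>E\<^esub> scale (\<lambda>w. 1 - f w) (pt2 \<ominus>\<^bsub>E\<^esub> pt4)"
    by (simp add: lin4_simps)
  then show ?thesis by (simp only: pt_units)
qed

end

context
  fixes x y z
  assumes pts: "x \<in> carrier E" "y \<in> carrier E" "z \<in> carrier E"
begin

lemmas tri_simps = lin4_simps[OF pts pts(3)]
lemmas tri_units = lin4_unit[OF pts pts(3)]

abbreviation "tri1 \<equiv> lin4 x y z z (\<lambda>_. 1) (\<lambda>_. 0) (\<lambda>_. 0) (\<lambda>_. 0)"
abbreviation "tri2 \<equiv> lin4 x y z z (\<lambda>_. 0) (\<lambda>_. 1) (\<lambda>_. 0) (\<lambda>_. 0)"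
abbreviation "tri3 \<equiv> lin4 x y z z (\<lambda>_. 0) (\<lambda>_. 0) (\<lambda>_. 1) (\<lambda>_. 0)"

lemma cmb_minus_cmb_same:
  assumes [measurable]: "f \<in> borel_measurable M"
  shows "cmb f x y \<ominus>\<^bsub>E\<^esub> cmb f z y = scale f (x \<ominus>\<^bsub>E\<^esub> z)"
proof -
  have "cmb f tri1 tri2 \<ominus>\<^bsub>E\<^esub> cmb f tri3 tri2 = scale f (tri1 \<ominus>\<^bsub>E\<^esub> tri3)"
    by (simp add: tri_simps)
  then show ?thesis by (simp only: tri_units)
qed

lemma minus_minus_chain: "x \<ominus>\<^bsub>E\<^esub> z = (x \<ominus>\<^bsub>E\<^esub> y) \<oplus>\<^bsub>E\<^esub> (y \<ominus>\<^bsub>E\<^esub> z)"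
proof -
  have "tri1 \<ominus>\<^bsub>E\<^esub> tri3 = (tri1 \<ominus>\<^bsub>E\<^esub> tri2) \<oplus>\<^bsub>E\<^esub> (tri2 \<ominus>\<^bsub>E\<^esub> tri3)"
    by (simp add: tri_simps)
  then show ?thesis by (simp only: tri_units)
qed

text \<open>A homothety applied to a combination of \<open>x\<close> is again a homothety applied to \<open>x\<close>; so nested contractions keep the form \<open>\<lambda> x + (1 - \<lambda>) q\<close>.\<close>

lemma cmb_rebracket:
  fixes l m :: real
  assumes "l * m \<noteq> 1"
  shows "cmb (\<lambda>_. l) (cmb (\<lambda>_. m) x y) z =
    cmb (\<lambda>_. l * m) x (cmb (\<lambda>_. l * (1 - m) / (1 - l * m)) y z)"
proof -
  have "cmb (\<lambda>_. l) (cmb (\<lambda>_. m) tri1 tri2) tri3 =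
      cmb (\<lambda>_. l * m) tri1 (cmb (\<lambda>_. l * (1 - m) / (1 - l * m)) tri2 tri3)"
    using assms by (simp add: tri_simps, intro lin4_cong) (simp_all add: field_simps)
  then show ?thesis by (simp only: tri_units)
qed

text \<open>Let \<open>u\<close> be the inner combination on the left. The identity computes the midpoint of \<open>u\<close> and \<open>x\<close>:
if \<open>m y + (1 - m) x\<close> is close to \<open>z\<close>, then so is this midpoint, i.e. \<open>u\<close> is close to
the reflection of \<open>x\<close> in \<open>z\<close>.\<close>

lemma cmb_half_exchange:
  fixes m :: real
  assumes "m \<noteq> 1"
  shows "cmb (\<lambda>_. 1/2) (cmb (\<lambda>_. m / (1 - m)) y z) x =
    cmb (\<lambda>_. 1 / (2 * (1 - m))) (cmb (\<lambda>_. m) y x) z"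
proof -
  have "cmb (\<lambda>_. 1/2) (cmb (\<lambda>_. m / (1 - m)) tri2 tri3) tri1 =
      cmb (\<lambda>_. 1 / (2 * (1 - m))) (cmb (\<lambda>_. m) tri2 tri1) tri3"
    using assms by (simp add: tri_simps, intro lin4_cong) (simp_all add: field_simps)
  then show ?thesis by (simp only: tri_units)
qed

end

context
  fixes x y
  assumes pts: "x \<in> carrier E" "y \<in> carrier E"
begin

lemmas duo_simps = lin4_simps[OF pts pts(2) pts(2)]
lemmas duo_units = lin4_unit[OF pts pts(2) pts(2)]

abbreviation "duo1 \<equiv> lin4 x y y y (\<lambda>_. 1) (\<lambda>_. 0) (\<lambda>_. 0) (\<lambda>_. 0)"
abbreviation "duo2 \<equiv> lin4 x y y y (\<lambda>_. 0) (\<lambda>_. 1) (\<lambda>_. 0) (\<lambda>_. 0)"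

lemma cmb_minus_ray:
  assumes [measurable]: "f \<in> borel_measurable M" "g \<in> borel_measurable M"
  shows "cmb f x y \<ominus>\<^bsub>E\<^esub> cmb g x y = scale (\<lambda>w. f w - g w) (x \<ominus>\<^bsub>E\<^esub> y)"
proof -
  have "cmb f duo1 duo2 \<ominus>\<^bsub>E\<^esub> cmb g duo1 duo2 = scale (\<lambda>w. f w - g w) (duo1 \<ominus>\<^bsub>E\<^esub> duo2)"
    by (simp add: duo_simps)
  then show ?thesis by (simp only: duo_units)
qed

lemma minus_swap: "x \<ominus>\<^bsub>E\<^esub> y = scale (\<lambda>_. - 1) (y \<ominus>\<^bsub>E\<^esub> x)"
proof -
  have "duo1 \<ominus>\<^bsub>E\<^esub> duo2 = scale (\<lambda>_. - 1) (duo2 \<ominus>\<^bsub>E\<^esub> duo1)"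
    by (simp add: duo_simps)
  then show ?thesis by (simp only: duo_units)
qed

lemma eq_if_minus_zero: "x \<ominus>\<^bsub>E\<^esub> y = \<zero>\<^bsub>E\<^esub> \<Longrightarrow> x = y"
proof -
  assume *: "x \<ominus>\<^bsub>E\<^esub> y = \<zero>\<^bsub>E\<^esub>"
  have "duo1 = (duo1 \<ominus>\<^bsub>E\<^esub> duo2) \<oplus>\<^bsub>E\<^esub> duo2"
    by (simp add: duo_simps)
  then show ?thesis using * pts by (simp add: duo_units)
qed

lemma cmb_swap:
  assumes [measurable]: "f \<in> borel_measurable M"
  shows "cmb f x y = cmb (\<lambda>w. 1 - f w) y x"
proof -
  have "cmb f duo1 duo2 = cmb (\<lambda>w. 1 - f w) duo2 duo1"
    by (simp add: duo_simps)
  then show ?thesis by (simp only: duo_units)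
qed

lemma cmb_1: "cmb (\<lambda>_. 1) x y = x"
proof -
  have "cmb (\<lambda>_. 1) duo1 duo2 = duo1"
    by (simp add: duo_simps)
  then show ?thesis by (simp only: duo_units)
qed

lemma cmb_0: "cmb (\<lambda>_. 0) x y = y"
proof -
  have "cmb (\<lambda>_. 0) duo1 duo2 = duo2"
    by (simp add: duo_simps)
  then show ?thesis by (simp only: duo_units)
qed

lemma cmb_ray_cmb:
  assumes [measurable]: "f \<in> borel_measurable M" "g \<in> borel_measurable M"
  shows "cmb f (cmb g x y) y = cmb (\<lambda>w. f w * g w) x y"
proof -
  have "cmb f (cmb g duo1 duo2) duo2 = cmb (\<lambda>w. f w * g w) duo1 duo2"
    by (simp add: duo_simps, rule lin4_cong; simp add: algebra_simps)
  then show ?thesis by (simp only: duo_units)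
qed

text \<open>A weight \<open>a \<ge> k\<close> may be lowered to \<open>k\<close> by moving the excess into the second point.\<close>

lemma cmb_split:
  fixes a k :: real
  assumes "k \<noteq> 1"
  shows "cmb (\<lambda>_. a) x y = cmb (\<lambda>_. k) x (cmb (\<lambda>_. (a - k) / (1 - k)) x y)"
proof -
  have "cmb (\<lambda>_. a) duo1 duo2 = cmb (\<lambda>_. k) duo1 (cmb (\<lambda>_. (a - k) / (1 - k)) duo1 duo2)"
    using assms by (simp add: duo_simps, intro lin4_cong) (simp_all add: field_simps)
  then show ?thesis by (simp only: duo_units)
qed

end

lemma cmb_refl:
  assumes "x \<in> carrier E" "f \<in> borel_measurable M"
  shows "cmb f x x = x"
  unfolding cmb_def using assms by (subst scale_add_left[symmetric]) (auto simp: scale_1)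

lemma minus_self: "x \<in> carrier E \<Longrightarrow> x \<ominus>\<^bsub>E\<^esub> x = scale (\<lambda>_. 0) x"
  using scale_add_left[of "\<lambda>_. 1" "\<lambda>_. - 1" x] by (simp add: minus_eq_scale scale_1)

lemma cmb_closed: "f \<in> borel_measurable M \<Longrightarrow> x \<in> carrier E \<Longrightarrow> y \<in> carrier E \<Longrightarrow> cmb f x y \<in> carrier E"
  by (simp add: cmb_def scale_closed)

section \<open>The pointwise distance\<close>

lemma minus_closed: "x \<in> carrier E \<Longrightarrow> y \<in> carrier E \<Longrightarrow> x \<ominus>\<^bsub>E\<^esub> y \<in> carrier E"
  by simp

lemma rnorm_in_L0: "x \<in> carrier E \<Longrightarrow> rnorm E x \<in> L0 M"
  using rnorm_closed by (auto simp: L0_plus_def)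

lemma nrm_measurable: "x \<in> carrier E \<Longrightarrow> nrm x \<in> borel_measurable M"
  using rnorm_in_L0 by (auto simp: nrm_def)

lemma AE_nrm_nonneg: "x \<in> carrier E \<Longrightarrow> AE w in M. 0 \<le> nrm x w"
proof -
  assume x: "x \<in> carrier E"
  have "AE w in M. L0_rep (L0_const M 0) w \<le> nrm x w"
    using rnorm_closed[OF x] by (auto simp: L0_plus_def L0_le_def nrm_def)
  moreover have "AE w in M. L0_rep (L0_const M (0::real)) w = 0"
    unfolding L0_const_def by (rule L0_rep_class) simp
  ultimately show ?thesis by eventually_elim simp
qed

lemma AE_nrm_scale:
  assumes f[measurable]: "f \<in> borel_measurable M" and x: "x \<in> carrier E"
  shows "AE w in M. nrm (scale f x) w = \<bar>f w\<bar> * nrm x w"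
proof -
  note [measurable] = nrm_measurable[OF x]
  have [measurable]: "(\<lambda>w. of_real (f w) :: 'k) \<in> borel_measurable M" using f by (rule scalar_in_L0)
  let ?c = "L0_class M (\<lambda>w. of_real (f w) :: 'k)"
  have "?c \<in> L0 M" by (rule L0_class_in_L0) simp
  have 1: "AE w in M. L0_rep ?c w = of_real (f w)" by (rule L0_rep_class) simp
  have m1[measurable]: "L0_rep ?c \<in> borel_measurable M" by (rule L0_rep_class) simp
  have 2: "AE w in M. L0_rep (L0_map M norm ?c) w = norm (L0_rep ?c w)"
    unfolding L0_map_def by (rule L0_rep_class) simp
  have m2[measurable]: "L0_rep (L0_map M norm ?c) \<in> borel_measurable M"
    unfolding L0_map_def by (rule L0_rep_class) simp
  have 3: "AE w in M. nrm (scale f x) w = L0_rep (L0_map M norm ?c) w * nrm x w"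
    unfolding nrm_def scale_def rnorm_smult[OF \<open>?c \<in> L0 M\<close> x]
    unfolding L0_ring_def by (simp, rule L0_rep_class) (simp add: nrm_def[symmetric])
  show ?thesis using 1 2 3 by eventually_elim simp
qed

lemma AE_nrm_add:
  assumes x: "x \<in> carrier E" and y: "y \<in> carrier E"
  shows "AE w in M. nrm (x \<oplus>\<^bsub>E\<^esub> y) w \<le> nrm x w + nrm y w"
proof -
  note [measurable] = nrm_measurable[OF x] nrm_measurable[OF y]
  have 1: "AE w in M. nrm (x \<oplus>\<^bsub>E\<^esub> y) w \<le> L0_rep (rnorm E x \<oplus>\<^bsub>L0_ring M\<^esub> rnorm E y) w"
    using rnorm_triangle[OF x y] by (simp add: L0_le_def nrm_def)
  have 2: "AE w in M. L0_rep (rnorm E x \<oplus>\<^bsub>L0_ring M\<^esub> rnorm E y) w = nrm x w + nrm y w"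
    unfolding L0_ring_def nrm_def by (simp, rule L0_rep_class) (simp add: nrm_def[symmetric])
  show ?thesis using 1 2 by eventually_elim simp
qed

lemma zero_if_nrm_zero:
  assumes x: "x \<in> carrier E" and "AE w in M. nrm x w = 0"
  shows "x = \<zero>\<^bsub>E\<^esub>"
proof (rule rnorm_eq_0[OF x])
  have "rnorm E x = L0_class M (nrm x)"
    unfolding nrm_def using L0_class_rep[OF rnorm_in_L0[OF x]] by simp
  also have "\<dots> = L0_const M 0"
    unfolding L0_const_def by (rule L0_class_cong) fact
  finally show "rnorm E x = L0_const M 0" .
qed

lemma dst_measurable[measurable (raw)]:
  "x \<in> carrier E \<Longrightarrow> y \<in> carrier E \<Longrightarrow> dst x y \<in> borel_measurable M"
  unfolding dst_def by (intro nrm_measurable minus_closed)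

lemma AE_dst_nonneg: "x \<in> carrier E \<Longrightarrow> y \<in> carrier E \<Longrightarrow> AE w in M. 0 \<le> dst x y w"
  unfolding dst_def by (intro AE_nrm_nonneg minus_closed)

lemma AE_dst_self: "x \<in> carrier E \<Longrightarrow> AE w in M. dst x x w = 0"
  using AE_nrm_scale[of "\<lambda>_. 0" x] by (simp add: dst_def minus_self)

lemma AE_dst_commute:
  assumes "x \<in> carrier E" "y \<in> carrier E" shows "AE w in M. dst x y w = dst y x w"
  using AE_nrm_scale[of "\<lambda>_. - 1" "y \<ominus>\<^bsub>E\<^esub> x"] minus_swap[of x y] assms by (simp add: dst_def)

lemma AE_dst_triangle:
  assumes "x \<in> carrier E" "y \<in> carrier E" "z \<in> carrier E"
  shows "AE w in M. dst x z w \<le> dst x y w + dst y z w"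
  using AE_nrm_add[of "x \<ominus>\<^bsub>E\<^esub> y" "y \<ominus>\<^bsub>E\<^esub> z"] minus_minus_chain[of x y z] assms
  by (simp add: dst_def)

lemma eq_if_AE_dst_zero:
  assumes "x \<in> carrier E" "y \<in> carrier E" "AE w in M. dst x y w = 0"
  shows "x = y"
  using zero_if_nrm_zero[of "x \<ominus>\<^bsub>E\<^esub> y"] eq_if_minus_zero[of x y] assms by (simp add: dst_def)

lemma AE_dst_cmb:
  assumes [measurable]: "f \<in> borel_measurable M"
    and "x \<in> carrier E" "y \<in> carrier E" "x' \<in> carrier E" "y' \<in> carrier E"
  shows "AE w in M. dst (cmb f x y) (cmb f x' y') w \<le> \<bar>f w\<bar> * dst x x' w + \<bar>1 - f w\<bar> * dst y y' w"
proof -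
  have 1: "AE w in M. dst (cmb f x y) (cmb f x' y') w \<le>
      nrm (scale f (x \<ominus>\<^bsub>E\<^esub> x')) w + nrm (scale (\<lambda>w. 1 - f w) (y \<ominus>\<^bsub>E\<^esub> y')) w"
    using assms by (auto simp: dst_def cmb_minus_cmb intro!: AE_nrm_add scale_closed)
  have 2: "AE w in M. nrm (scale f (x \<ominus>\<^bsub>E\<^esub> x')) w = \<bar>f w\<bar> * dst x x' w"
    unfolding dst_def using assms by (intro AE_nrm_scale minus_closed)
  have 3: "AE w in M. nrm (scale (\<lambda>w. 1 - f w) (y \<ominus>\<^bsub>E\<^esub> y')) w = \<bar>1 - f w\<bar> * dst y y' w"
    unfolding dst_def using assms by (intro AE_nrm_scale minus_closed) auto
  show ?thesis using 1 2 3 by eventually_elim simp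
qed

lemma AE_dst_cmb_same:
  assumes "f \<in> borel_measurable M" "x \<in> carrier E" "y \<in> carrier E" "x' \<in> carrier E"
  shows "AE w in M. dst (cmb f x y) (cmb f x' y) w = \<bar>f w\<bar> * dst x x' w"
  using AE_nrm_scale[of f "x \<ominus>\<^bsub>E\<^esub> x'"] assms by (simp add: dst_def cmb_minus_cmb_same)

lemma AE_dst_ray:
  assumes "f \<in> borel_measurable M" "g \<in> borel_measurable M" "x \<in> carrier E" "y \<in> carrier E"
  shows "AE w in M. dst (cmb f x y) (cmb g x y) w = \<bar>f w - g w\<bar> * dst x y w"
  using AE_nrm_scale[of "\<lambda>w. f w - g w" "x \<ominus>\<^bsub>E\<^esub> y"] assms cmb_minus_ray[of x y]
  by (simp add: dst_def)

end

section \<open>Essential suprema\<close>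

text \<open>By exhaustion: take a countable subfamily whose union has the largest probability.\<close>

lemma (in prob_space) ess_union:
  assumes B: "\<And>i. i \<in> I \<Longrightarrow> B i \<in> sets M"
  obtains J where "J \<subseteq> I" "countable J" "\<And>i. i \<in> I \<Longrightarrow> AE w in M. w \<in> B i \<longrightarrow> w \<in> (\<Union>j\<in>J. B j)"
proof -
  define \<C> where "\<C> = {J. J \<subseteq> I \<and> countable J}"
  define m where "m J = prob (\<Union>j\<in>J. B j)" for J
  have ms: "(\<Union>j\<in>J. B j) \<in> sets M" if "J \<in> \<C>" for J
    using that B by (intro sets.countable_UN') (auto simp: \<C>_def)
  have bdd: "bdd_above (m ` \<C>)" unfolding m_def by (rule bdd_aboveI[of _ 1]) auto
  have ne: "m ` \<C> \<noteq> {}" by (auto simp: \<C>_def)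
  have "\<exists>J\<in>\<C>. Sup (m ` \<C>) - 1 / real (Suc n) < m J" for n
    using less_cSup_iff[OF ne bdd, of "Sup (m ` \<C>) - 1 / real (Suc n)"] by auto
  then obtain J where J: "\<And>n. J n \<in> \<C>" "\<And>n. Sup (m ` \<C>) - 1 / real (Suc n) < m (J n)" by metis
  define K where "K = (\<Union>n. J n)"
  have K: "K \<in> \<C>" using J(1) by (auto simp: K_def \<C>_def)
  have "m (J n) \<le> m K" for n
    unfolding m_def by (intro finite_measure_mono ms K) (auto simp: K_def)
  then have "Sup (m ` \<C>) - 1 / real (Suc n) \<le> m K" for n
    using J(2)[of n] by (meson less_le_trans less_imp_le)
  then have supK: "Sup (m ` \<C>) \<le> m K"
    by (intro LIMSEQ_le_const2[OF tendsto_diff[OF tendsto_const LIMSEQ_inverse_real_of_nat, of "Sup (m ` \<C>)", simplified]])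
       (auto simp: inverse_eq_divide)
  show ?thesis
  proof
    show "K \<subseteq> I" "countable K" using K by (auto simp: \<C>_def)
    fix i assume i: "i \<in> I"
    let ?U = "\<Union>j\<in>K. B j"
    have K': "insert i K \<in> \<C>" using K i by (auto simp: \<C>_def)
    have [measurable]: "?U \<in> sets M" "B i \<in> sets M" using ms[OF K] B[OF i] by auto
    have "m (insert i K) \<le> Sup (m ` \<C>)" using K' bdd by (intro cSup_upper) auto
    moreover have "m (insert i K) = m K + prob (B i - ?U)"
    proof -
      have "(\<Union>j\<in>insert i K. B j) = ?U \<union> (B i - ?U)" by auto
      then show ?thesis unfolding m_def by (simp, subst finite_measure_Union[symmetric]) auto
    qed
    ultimately have "prob (B i - ?U) = 0" using supK measure_nonneg[of M "B i - ?U"] by linarith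
    then have "B i - ?U \<in> null_sets M" by (simp add: null_setsI emeasure_eq_measure)
    from AE_not_in[OF this] show "AE w in M. w \<in> B i \<longrightarrow> w \<in> ?U" by eventually_elim blast
  qed
qed

text \<open>Apply the previous lemma to the events \<open>\<phi> i > q\<close> for each rational \<open>q\<close>.\<close>

lemma (in prob_space) ess_sup_countable:
  fixes \<phi> :: "'i \<Rightarrow> 'a \<Rightarrow> ereal"
  assumes [measurable]: "\<And>i. i \<in> I \<Longrightarrow> \<phi> i \<in> borel_measurable M"
  obtains J where "J \<subseteq> I" "countable J" "\<And>i. i \<in> I \<Longrightarrow> AE w in M. \<phi> i w \<le> (SUP j\<in>J. \<phi> j w)"
proof -
  define B where "B q i = {w \<in> space M. ereal (of_rat q) < \<phi> i w}" for q i
  define P where "P q J \<longleftrightarrow> J \<subseteq> I \<and> countable J \<and>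
    (\<forall>i\<in>I. AE w in M. w \<in> B q i \<longrightarrow> w \<in> (\<Union>j\<in>J. B q j))" for q J
  have "\<exists>J. P q J" for q
  proof -
    have m: "B q i \<in> sets M" if "i \<in> I" for i
      unfolding B_def using assms[OF that] by measurable
    show ?thesis unfolding P_def by (rule ess_union[of I "B q", OF m]) blast+
  qed
  then obtain J where "\<And>q. P q (J q)" by metis
  then have J: "\<And>q. J q \<subseteq> I" "\<And>q. countable (J q)"
    "\<And>q i. i \<in> I \<Longrightarrow> AE w in M. w \<in> B q i \<longrightarrow> w \<in> (\<Union>j\<in>J q. B q j)"
    unfolding P_def by simp_all
  show ?thesis
  proof
    show "(\<Union>q. J q) \<subseteq> I" "countable (\<Union>q. J q)" using J by auto
    fix i assume i: "i \<in> I"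
    have "AE w in M. \<forall>q. w \<in> B q i \<longrightarrow> w \<in> (\<Union>j\<in>J q. B q j)"
      unfolding AE_all_countable using J(3)[OF i] by auto
    then show "AE w in M. \<phi> i w \<le> (SUP j\<in>(\<Union>q. J q). \<phi> j w)"
    proof (rule AE_mp, intro AE_I2 impI)
      fix w assume w: "w \<in> space M" and H: "\<forall>q. w \<in> B q i \<longrightarrow> w \<in> (\<Union>j\<in>J q. B q j)"
      show "\<phi> i w \<le> (SUP j\<in>(\<Union>q. J q). \<phi> j w)"
      proof (rule ccontr)
        assume "\<not> ?thesis"
        then obtain q where q: "(SUP j\<in>(\<Union>q. J q). \<phi> j w) < ereal (of_rat q)" "ereal (of_rat q) < \<phi> i w"
          using ereal_dense3 by (metis not_le)
        then obtain j where "j \<in> J q" "ereal (of_rat q) < \<phi> j w" using H w unfolding B_def by blast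
        moreover then have "\<phi> j w \<le> (SUP j\<in>(\<Union>q. J q). \<phi> j w)" by (intro SUP_upper) auto
        ultimately show False using q by auto
      qed
    qed
  qed
qed

lemma (in prob_space) ess_sup_sequence:
  fixes \<phi> :: "'i \<Rightarrow> 'a \<Rightarrow> ereal"
  assumes "\<And>i. i \<in> I \<Longrightarrow> \<phi> i \<in> borel_measurable M" and i0: "i0 \<in> I"
  obtains x :: "nat \<Rightarrow> 'i" where "\<And>k. x k \<in> I"
    "\<And>i. i \<in> I \<Longrightarrow> AE w in M. \<phi> i w \<le> (SUP k. \<phi> (x k) w)"
proof -
  obtain J where J: "J \<subseteq> I" "countable J"
    "\<And>i. i \<in> I \<Longrightarrow> AE w in M. \<phi> i w \<le> (SUP j\<in>J. \<phi> j w)"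
    using ess_sup_countable[of I \<phi>, OF assms(1)] by blast
  define x where "x = from_nat_into (insert i0 J)"
  have rx: "range x = insert i0 J" unfolding x_def using J(2) by (intro range_from_nat_into) auto
  show ?thesis
  proof (rule that)
    show "x k \<in> I" for k using rx J(1) i0 rangeI[of x k] by auto
    have "(SUP j\<in>J. \<phi> j w) \<le> (SUP k. \<phi> (x k) w)" for w
      unfolding image_image[symmetric, of "\<lambda>j. \<phi> j w" x] rx by (intro SUP_subset_mono) auto
    then show "AE w in M. \<phi> i w \<le> (SUP k. \<phi> (x k) w)" if "i \<in> I" for i
      using J(3)[OF that] by (auto elim!: eventually_mono intro: order_trans)
  qed
qed

text \<open>The supremum in the order of classes is defined by a choice operator; these three facts are all that is needed about it.\<close>

lemma (in prob_space) L0_bar_sup: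
  assumes \<Phi>: "\<Phi> \<subseteq> L0 M"
  shows "\<Squnion>\<^bsub>L0_bar M\<^esub> \<Phi> \<in> L0 M"
    and "\<xi> \<in> \<Phi> \<Longrightarrow> AE w in M. L0_rep \<xi> w \<le> L0_rep (\<Squnion>\<^bsub>L0_bar M\<^esub> \<Phi>) w"
    and "h \<in> borel_measurable M \<Longrightarrow> (\<And>\<xi>. \<xi> \<in> \<Phi> \<Longrightarrow> AE w in M. L0_rep \<xi> w \<le> h w) \<Longrightarrow>
      AE w in M. L0_rep (\<Squnion>\<^bsub>L0_bar M\<^esub> \<Phi>) w \<le> h w"
proof -
  obtain J where J: "J \<subseteq> \<Phi>" "countable J"
    "\<And>\<xi>. \<xi> \<in> \<Phi> \<Longrightarrow> AE w in M. L0_rep \<xi> w \<le> (SUP j\<in>J. L0_rep j w)"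
    using ess_sup_countable[of \<Phi> L0_rep] \<Phi> L0_rep_measurable by blast
  let ?g = "\<lambda>w. SUP j\<in>J. L0_rep j w"
  have g[measurable]: "?g \<in> borel_measurable M"
    using J \<Phi> by (intro borel_measurable_SUP) (auto intro: L0_rep_measurable)
  have gl: "AE w in M. L0_rep (L0_class M ?g) w = ?g w" by (rule L0_rep_class) fact
  have "least (L0_bar M) (L0_class M ?g) (Upper (L0_bar M) \<Phi>)"
    unfolding least_def
  proof (intro conjI ballI)
    show "Upper (L0_bar M) \<Phi> \<subseteq> carrier (L0_bar M)" by (auto simp: Upper_def)
    have "AE w in M. L0_rep \<xi> w \<le> L0_rep (L0_class M ?g) w" if "\<xi> \<in> \<Phi>" for \<xi>
      using J(3)[OF that] gl by eventually_elim simp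
    then show "L0_class M ?g \<in> Upper (L0_bar M) \<Phi>"
      by (auto simp: Upper_def L0_bar_def L0_le_def L0_class_in_L0)
    fix u assume "u \<in> Upper (L0_bar M) \<Phi>"
    then have u: "\<xi> \<in> \<Phi> \<Longrightarrow> AE w in M. L0_rep \<xi> w \<le> L0_rep u w" for \<xi>
      using \<Phi> by (auto simp: Upper_def L0_bar_def L0_le_def)
    have "AE w in M. \<forall>j\<in>J. L0_rep j w \<le> L0_rep u w"
      using J u by (subst AE_ball_countable) auto
    then have "AE w in M. L0_rep (L0_class M ?g) w \<le> L0_rep u w"
      using gl by eventually_elim (auto intro: SUP_least)
    then show "L0_class M ?g \<sqsubseteq>\<^bsub>L0_bar M\<^esub> u" by (simp add: L0_bar_def L0_le_def)
  qed
  then have "least (L0_bar M) (\<Squnion>\<^bsub>L0_bar M\<^esub> \<Phi>) (Upper (L0_bar M) \<Phi>)"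
    unfolding sup_def by (rule someI)
  then have *: "\<Squnion>\<^bsub>L0_bar M\<^esub> \<Phi> \<in> Upper (L0_bar M) \<Phi>"
    "\<And>u. u \<in> Upper (L0_bar M) \<Phi> \<Longrightarrow> L0_le M (\<Squnion>\<^bsub>L0_bar M\<^esub> \<Phi>) u"
    by (auto simp: least_def L0_bar_def)
  show "\<Squnion>\<^bsub>L0_bar M\<^esub> \<Phi> \<in> L0 M" using *(1) by (auto simp: Upper_def L0_bar_def)
  show "AE w in M. L0_rep \<xi> w \<le> L0_rep (\<Squnion>\<^bsub>L0_bar M\<^esub> \<Phi>) w" if "\<xi> \<in> \<Phi>"
    using *(1) that \<Phi> by (auto simp: Upper_def L0_bar_def L0_le_def)
  assume h: "h \<in> borel_measurable M" and up: "\<And>\<xi>. \<xi> \<in> \<Phi> \<Longrightarrow> AE w in M. L0_rep \<xi> w \<le> h w"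
  have hl: "AE w in M. L0_rep (L0_class M h) w = h w" by (rule L0_rep_class) fact
  have "AE w in M. L0_rep \<xi> w \<le> L0_rep (L0_class M h) w" if "\<xi> \<in> \<Phi>" for \<xi>
    using up[OF that] hl by eventually_elim simp
  then have "L0_class M h \<in> Upper (L0_bar M) \<Phi>"
    using h by (auto simp: Upper_def L0_bar_def L0_le_def L0_class_in_L0)
  from *(2)[OF this] show "AE w in M. L0_rep (\<Squnion>\<^bsub>L0_bar M\<^esub> \<Phi>) w \<le> h w"
    unfolding L0_le_def using hl by eventually_elim simp
qed

section \<open>Closed convex sets\<close>

lemma (in prob_space) AE_tendsto_imp_prob:
  assumes [measurable]: "\<And>k. X k \<in> borel_measurable M"
    and lim: "AE w in M. (\<lambda>k. X k w) \<longlonglongrightarrow> (0::real)" and "\<epsilon> > 0" "\<delta> > 0"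
  shows "\<exists>k. prob {w \<in> space M. X k w < \<epsilon>} > 1 - \<delta>"
proof -
  define A where "A k = {w \<in> space M. \<exists>j\<ge>k. X j w \<ge> \<epsilon>}" for k
  have [measurable]: "A k \<in> sets M" for k unfolding A_def by measurable
  have "AE w in M. w \<notin> (\<Inter>k. A k)"
    using lim
  proof (rule AE_mp, intro AE_I2 impI)
    fix w assume "(\<lambda>k. X k w) \<longlonglongrightarrow> 0"
    then have "\<forall>\<^sub>F k in sequentially. X k w < \<epsilon>" using \<open>\<epsilon> > 0\<close> by (rule order_tendstoD)
    then show "w \<notin> (\<Inter>k. A k)" by (auto simp: A_def eventually_sequentially not_le[symmetric])
  qed
  then have 0: "prob (\<Inter>k. A k) = 0" by (subst prob_eq_0) auto
  have "(\<lambda>k. prob (A k)) \<longlonglongrightarrow> prob (\<Inter>k. A k)"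
    by (rule finite_Lim_measure_decseq) (auto simp: decseq_def A_def intro: order_trans)
  then have "\<forall>\<^sub>F k in sequentially. prob (A k) < \<delta>" using \<open>\<delta> > 0\<close> unfolding 0 by (rule order_tendstoD)
  then obtain k where k: "prob (A k) < \<delta>" by (auto simp: eventually_sequentially)
  have "1 - prob (A k) = prob (space M - A k)" by (simp add: prob_compl)
  also have "\<dots> \<le> prob {w \<in> space M. X k w < \<epsilon>}"
    by (intro finite_measure_mono) (auto simp: A_def not_le)
  finally show ?thesis using k by (intro exI[of _ k]) linarith
qed

text \<open>Borel-Cantelli.\<close>

lemma (in prob_space) AE_tendsto_if_prob_fast:
  assumes X[measurable]: "\<And>k. X k \<in> borel_measurable M"
    and nn: "\<And>k. AE w in M. 0 \<le> X k w"
    and fast: "\<And>k. prob {w \<in> space M. X k w < (1/2)^k} > 1 - (1/2)^k"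
  shows "AE w in M. (\<lambda>k. X k w) \<longlonglongrightarrow> (0::real)"
proof -
  define A where "A k = {w \<in> space M. X k w \<ge> (1/2)^k}" for k
  have [measurable]: "A k \<in> sets M" for k unfolding A_def by measurable
  have "prob (A k) \<le> (1/2)^k" for k
  proof -
    have "A k = space M - {w \<in> space M. X k w < (1/2)^k}" by (auto simp: A_def)
    then show ?thesis using fast[of k] by (simp add: prob_compl)
  qed
  then have "summable (\<lambda>k. prob (A k))"
    by (intro summable_comparison_test[OF _ summable_geometric[of "1/2::real"]]) auto
  then have "AE w in M. eventually (\<lambda>k. w \<in> space M - A k) sequentially"
    by (intro borel_cantelli_AE1) (auto simp: emeasure_eq_measure)
  moreover have "AE w in M. \<forall>k. 0 \<le> X k w" using nn by (simp add: AE_all_countable)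
  ultimately show ?thesis
  proof eventually_elim
    case (elim w)
    have "\<forall>\<^sub>F k in sequentially. X k w \<le> (1/2)^k"
      using elim(1) by eventually_elim (auto simp: A_def)
    then show ?case
      using elim(2) by (intro tendsto_sandwich[OF _ _ tendsto_const LIMSEQ_realpow_zero[of "1/2"]]) auto
  qed
qed

context rn_module
begin

definition closed_convex :: "'e set \<Rightarrow> bool" where
  "closed_convex V \<longleftrightarrow> closedin (eps_lam_topology M E) V \<and> L0_convex M E V"

lemma minus_in_nbhd_iff:
  "x \<in> carrier E \<Longrightarrow> y \<in> carrier E \<Longrightarrow>
    y \<ominus>\<^bsub>E\<^esub> x \<in> eps_lam_nbhd M E \<epsilon> \<delta> \<longleftrightarrow> prob {w \<in> space M. dst y x w < \<epsilon>} > 1 - \<delta>"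
  by (simp add: eps_lam_nbhd_def dst_def nrm_def)

lemma topspace_eps_lam: "topspace (eps_lam_topology M E) = carrier E"
proof -
  have "openin (eps_lam_topology M E) (carrier E)"
    unfolding openin_eps_lam_topology by (auto intro!: exI[of _ "1/2::real"])
  then show ?thesis
    unfolding topspace_def using openin_eps_lam_topology by blast
qed

text \<open>A point all of whose neighbourhoods meet \<open>V\<close> is the limit in probability of a sequence in \<open>V\<close> whose rate can
be chosen so fast that the convergence is almost sure.\<close>

lemma closedin_iff_AE_limits:
  "closedin (eps_lam_topology M E) V \<longleftrightarrow> V \<subseteq> carrier E \<and>
    (\<forall>u y. (\<forall>k. u k \<in> V) \<longrightarrow> y \<in> carrier E \<longrightarrow> (AE w in M. (\<lambda>k. dst (u k) y w) \<longlonglongrightarrow> 0) \<longrightarrow> y \<in> V)"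
  (is "_ \<longleftrightarrow> _ \<and> ?L")
proof (cases "V \<subseteq> carrier E")
  case False
  then show ?thesis using closedin_subset topspace_eps_lam by blast
next
  case V: True
  have "openin (eps_lam_topology M E) (carrier E - V) \<longleftrightarrow> ?L"
  proof
    assume op: "openin (eps_lam_topology M E) (carrier E - V)"
    show ?L
    proof (intro allI impI, rule ccontr)
      fix u y assume u: "\<forall>k. u k \<in> V" and y: "y \<in> carrier E"
        and lim: "AE w in M. (\<lambda>k. dst (u k) y w) \<longlonglongrightarrow> 0" and "y \<notin> V"
      then obtain \<epsilon> \<delta> where ed: "0 < \<epsilon>" "0 < \<delta>"
        "\<forall>z\<in>carrier E. z \<ominus>\<^bsub>E\<^esub> y \<in> eps_lam_nbhd M E \<epsilon> \<delta> \<longrightarrow> z \<in> carrier E - V"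
        using op unfolding openin_eps_lam_topology by blast
      have uc: "\<And>k. u k \<in> carrier E" using u V by auto
      obtain k where "prob {w \<in> space M. dst (u k) y w < \<epsilon>} > 1 - \<delta>"
        using AE_tendsto_imp_prob[OF _ lim ed(1,2)] uc y by auto
      then show False using ed(3) uc y u by (auto simp: minus_in_nbhd_iff)
    qed
  next
    assume L: ?L
    show "openin (eps_lam_topology M E) (carrier E - V)"
      unfolding openin_eps_lam_topology
    proof (intro conjI ballI, blast, rule ccontr)
      fix y assume y: "y \<in> carrier E - V"
      assume neg: "\<nexists>\<epsilon> \<delta>. 0 < \<epsilon> \<and> 0 < \<delta> \<and> \<delta> < 1 \<and>
        (\<forall>z\<in>carrier E. z \<ominus>\<^bsub>E\<^esub> y \<in> eps_lam_nbhd M E \<epsilon> \<delta> \<longrightarrow> z \<in> carrier E - V)"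
      have "\<exists>z\<in>V. prob {w \<in> space M. dst z y w < (1/2)^(Suc k)} > 1 - (1/2)^(Suc k)" for k
      proof -
        have "(0::real) < (1/2)^(Suc k)" "(1/2)^(Suc k) < (1::real)"
          by (simp, rule power_Suc_less_one) simp_all
        then obtain z where "z \<in> carrier E" "z \<ominus>\<^bsub>E\<^esub> y \<in> eps_lam_nbhd M E ((1/2)^(Suc k)) ((1/2)^(Suc k))"
          "z \<notin> carrier E - V" using neg by blast
        then show ?thesis using y minus_in_nbhd_iff[of y z] by blast
      qed
      then obtain u where u: "\<And>k. u k \<in> V"
        "\<And>k. prob {w \<in> space M. dst (u k) y w < (1/2)^(Suc k)} > 1 - (1/2)^(Suc k)" by metis
      have uc: "\<And>k. u k \<in> carrier E" using u V by auto
      have "AE w in M. (\<lambda>k. dst (u k) y w) \<longlonglongrightarrow> 0"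
      proof (rule AE_tendsto_if_prob_fast)
        fix k
        show [measurable]: "dst (u k) y \<in> borel_measurable M" using uc y by auto
        show "AE w in M. 0 \<le> dst (u k) y w" using uc y by (intro AE_dst_nonneg) auto
        have "prob {w \<in> space M. dst (u k) y w < (1/2)^(Suc k)} \<le> prob {w \<in> space M. dst (u k) y w < (1/2)^k}"
        proof (intro finite_measure_mono)
          have "(1/2)^(Suc k) \<le> ((1/2)^k::real)" by simp
          then show "{w \<in> space M. dst (u k) y w < (1/2)^(Suc k)} \<subseteq> {w \<in> space M. dst (u k) y w < (1/2)^k}"
            by (auto intro: less_le_trans simp del: power_Suc)
        qed measurable
        moreover have "(1/2)^(Suc k) \<le> ((1/2)^k::real)" by simp
        ultimately show "prob {w \<in> space M. dst (u k) y w < (1/2)^k} > 1 - (1/2)^k"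
          using u(2)[of k] by linarith
      qed
      then show False using L u(1) y by blast
    qed
  qed
  then show ?thesis using V by (simp add: closedin_def topspace_eps_lam)
qed

lemma scale_AE_cong:
  assumes "AE w in M. f w = g w"
  shows "scale f x = scale g x"
proof -
  have "L0_class M (\<lambda>w. of_real (f w) :: 'k) = L0_class M (\<lambda>w. of_real (g w))"
    using assms by (intro L0_class_cong) auto
  then show ?thesis by (simp add: scale_def)
qed

lemma cmb_AE_cong:
  assumes "AE w in M. f w = g w"
  shows "cmb f x y = cmb g x y"
  unfolding cmb_def using scale_AE_cong[OF assms, of x] scale_AE_cong[of "\<lambda>w. 1 - f w" "\<lambda>w. 1 - g w" y] assms by auto

lemma L0_convex_expr_eq_cmb:
  assumes "\<xi> \<in> L0 M"
  shows "(L0_map M of_real \<xi> \<odot>\<^bsub>E\<^esub> x) \<oplus>\<^bsub>E\<^esub>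
      ((\<one>\<^bsub>L0_ring M\<^esub> \<ominus>\<^bsub>L0_ring M\<^esub> L0_map M of_real \<xi>) \<odot>\<^bsub>E\<^esub> y) = cmb (L0_rep \<xi>) x y"
proof -
  have [measurable]: "L0_rep \<xi> \<in> borel_measurable M" using assms by (rule L0_rep_measurable)
  have [measurable]: "(\<lambda>w. of_real (L0_rep \<xi> w) :: 'k) \<in> borel_measurable M"
    by (rule scalar_in_L0) simp
  let ?c = "L0_class M (\<lambda>w. of_real (L0_rep \<xi> w) :: 'k)"
  have c: "?c \<in> carrier (L0_ring M)" by (rule scalar_in_L0) simp
  have d: "L0_class M (\<lambda>w. of_real (- L0_rep \<xi> w) :: 'k) \<in> carrier (L0_ring M)"
    by (rule scalar_in_L0) simp
  have "?c \<oplus>\<^bsub>L0_ring M\<^esub> L0_class M (\<lambda>w. of_real (- L0_rep \<xi> w)) = \<zero>\<^bsub>L0_ring M\<^esub>"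
    by (subst L0_class_add) (auto simp: L0_ring_simps)
  then have "\<ominus>\<^bsub>L0_ring M\<^esub> ?c = L0_class M (\<lambda>w. of_real (- L0_rep \<xi> w))"
    using c d by (metis E.R.minus_equality E.R.add.m_comm)
  then have "\<one>\<^bsub>L0_ring M\<^esub> \<ominus>\<^bsub>L0_ring M\<^esub> ?c = L0_class M (\<lambda>w. of_real (1 - L0_rep \<xi> w))"
    by (simp add: a_minus_def L0_ring_simps(2) L0_class_add)
  then show ?thesis by (simp add: cmb_def scale_def L0_map_def)
qed

text \<open>Representatives of the weights can be truncated, so weights may be assumed to lie in the unit interval everywhere.\<close>

lemma L0_convex_iff_cmb:
  "L0_convex M E V \<longleftrightarrow>
    (\<forall>x\<in>V. \<forall>y\<in>V. \<forall>f\<in>borel_measurable M. (\<forall>w. 0 \<le> f w \<and> f w \<le> 1) \<longrightarrow> cmb f x y \<in> V)"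
  (is "_ \<longleftrightarrow> ?R")
proof
  have c0: "AE w in M. L0_rep (L0_const M (0::real)) w = 0" "AE w in M. L0_rep (L0_const M (1::real)) w = 1"
    unfolding L0_const_def by (rule L0_rep_class, simp)+
  {
    assume conv: "L0_convex M E V"
    show ?R
    proof (intro ballI impI)
      fix x y f assume x: "x \<in> V" and y: "y \<in> V" and f: "f \<in> borel_measurable M" "\<forall>w. 0 \<le> f w \<and> f w \<le> (1::real)"
      let ?\<xi> = "L0_class M f"
      have m: "?\<xi> \<in> L0 M" using f(1) by (rule L0_class_in_L0)
      have r: "AE w in M. L0_rep ?\<xi> w = f w" using f(1) by (rule L0_rep_class)
      have a: "AE w in M. L0_rep (L0_const M 0) w \<le> L0_rep ?\<xi> w"
        using c0(1) r by eventually_elim (use f(2) in auto)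
      have b: "AE w in M. L0_rep ?\<xi> w \<le> L0_rep (L0_const M 1) w"
        using c0(2) r by eventually_elim (use f(2) in auto)
      have "cmb (L0_rep ?\<xi>) x y \<in> V"
        using conv x y m a b unfolding L0_convex_def L0_plus_def L0_le_def
        by (auto simp: L0_convex_expr_eq_cmb)
      then show "cmb f x y \<in> V" using cmb_AE_cong[OF r] by simp
    qed
  next
    assume R: ?R
    show "L0_convex M E V"
      unfolding L0_convex_def
    proof (intro ballI impI)
      fix x y \<xi> assume x: "x \<in> V" and y: "y \<in> V" and \<xi>: "\<xi> \<in> L0_plus M" "L0_le M \<xi> (L0_const M 1)"
      have m: "\<xi> \<in> L0 M" using \<xi>(1) by (simp add: L0_plus_def)
      have [measurable]: "L0_rep \<xi> \<in> borel_measurable M" using m by (rule L0_rep_measurable)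
      let ?f = "\<lambda>w. min 1 (max 0 (L0_rep \<xi> w))"
      have "AE w in M. L0_rep (L0_const M 0) w \<le> L0_rep \<xi> w" "AE w in M. L0_rep \<xi> w \<le> L0_rep (L0_const M 1) w"
        using \<xi> by (auto simp: L0_plus_def L0_le_def)
      then have "AE w in M. L0_rep \<xi> w = ?f w" using c0 by eventually_elim auto
      then have "cmb (L0_rep \<xi>) x y = cmb ?f x y" by (rule cmb_AE_cong)
      moreover have "cmb ?f x y \<in> V" using R x y by auto
      ultimately show "(L0_map M of_real \<xi> \<odot>\<^bsub>E\<^esub> x) \<oplus>\<^bsub>E\<^esub>
        ((\<one>\<^bsub>L0_ring M\<^esub> \<ominus>\<^bsub>L0_ring M\<^esub> L0_map M of_real \<xi>) \<odot>\<^bsub>E\<^esub> y) \<in> V"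
        by (simp add: L0_convex_expr_eq_cmb[OF m])
    qed
  }
qed

lemma closed_convex_cmb:
  assumes "closed_convex V" "x \<in> V" "y \<in> V" "f \<in> borel_measurable M" "\<And>w. 0 \<le> f w" "\<And>w. f w \<le> 1"
  shows "cmb f x y \<in> V"
  using assms by (auto simp: closed_convex_def L0_convex_iff_cmb)

lemma closed_convex_limit:
  assumes "closed_convex V" "\<And>k. u k \<in> V" "y \<in> carrier E" "AE w in M. (\<lambda>k. dst (u k) y w) \<longlonglongrightarrow> 0"
  shows "y \<in> V"
  using assms by (auto simp: closed_convex_def closedin_iff_AE_limits)

lemma closed_convex_carrier: "closed_convex V \<Longrightarrow> x \<in> V \<Longrightarrow> x \<in> carrier E"
  by (auto simp: closed_convex_def closedin_iff_AE_limits)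

lemma ccsetI:
  assumes "V \<subseteq> carrier E"
    and "\<And>u y. (\<And>k. u k \<in> V) \<Longrightarrow> y \<in> carrier E \<Longrightarrow> AE w in M. (\<lambda>k. dst (u k) y w) \<longlonglongrightarrow> 0 \<Longrightarrow> y \<in> V"
    and "\<And>x y f. x \<in> V \<Longrightarrow> y \<in> V \<Longrightarrow> f \<in> borel_measurable M \<Longrightarrow> (\<And>w. 0 \<le> f w) \<Longrightarrow> (\<And>w. f w \<le> 1) \<Longrightarrow> cmb f x y \<in> V"
  shows "closed_convex V"
  using assms by (auto simp: closed_convex_def L0_convex_iff_cmb closedin_iff_AE_limits)

lemma closed_convex_Inter:
  assumes "\<V> \<noteq> {}" "\<And>V. V \<in> \<V> \<Longrightarrow> closed_convex V"
  shows "closed_convex (\<Inter>\<V>)"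
proof -
  have "closedin (eps_lam_topology M E) (\<Inter>\<V>)"
    using assms by (intro closedin_Inter) (auto simp: closed_convex_def)
  moreover have "L0_convex M E (\<Inter>\<V>)"
    unfolding L0_convex_iff_cmb
  proof (intro ballI impI InterI)
    fix x y V and f :: "'w \<Rightarrow> real" assume *: "x \<in> \<Inter>\<V>" "y \<in> \<Inter>\<V>" "f \<in> borel_measurable M" "\<forall>w. 0 \<le> f w \<and> f w \<le> 1" "V \<in> \<V>"
    then have "x \<in> V" "y \<in> V" by auto
    with * show "cmb f x y \<in> V" by (intro closed_convex_cmb[OF assms(2)]) auto
  qed
  ultimately show ?thesis by (simp add: closed_convex_def)
qed

lemma AE_dst_cmb_point:
  assumes "f \<in> borel_measurable M" "\<And>w. 0 \<le> f w" "\<And>w. f w \<le> 1"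
    and "x \<in> carrier E" "y \<in> carrier E" "z \<in> carrier E"
  shows "AE w in M. dst (cmb f x y) z w \<le> f w * dst x z w + (1 - f w) * dst y z w"
proof -
  have "\<bar>f w\<bar> = f w" "\<bar>1 - f w\<bar> = 1 - f w" for w using assms(2,3)[of w] by auto
  then show ?thesis
    using AE_dst_cmb[of f x y z z] cmb_refl[of z f] assms by simp
qed

text \<open>Conditions on the distances to countably many points define closed convex sets as soon as, for each \<open>w\<close>, they pass to
uniform limits, to smaller distance functions and to convex combinations. They have to hold for almost every \<open>w\<close>
only, so that closedness can be checked pointwise along an almost everywhere convergent sequence.\<close>

lemma closed_convex_distance_condition:
  fixes x :: "nat \<Rightarrow> 'e" and R :: "'w \<Rightarrow> (nat \<Rightarrow> real) \<Rightarrow> bool"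
  assumes V: "closed_convex V" and x: "\<And>n. x n \<in> carrier E"
    and lim: "\<And>w \<phi>. (\<And>\<delta>. \<delta> > 0 \<Longrightarrow> \<exists>\<psi>. R w \<psi> \<and> (\<forall>n. \<phi> n \<le> \<psi> n + \<delta>)) \<Longrightarrow> R w \<phi>"
    and conv: "\<And>w t \<phi> \<psi> \<theta>. R w \<phi> \<Longrightarrow> R w \<psi> \<Longrightarrow> 0 \<le> t \<Longrightarrow> t \<le> 1 \<Longrightarrow>
      (\<And>n. \<theta> n \<le> t * \<phi> n + (1 - t) * \<psi> n) \<Longrightarrow> R w \<theta>"
  shows "closed_convex {z \<in> V. AE w in M. R w (\<lambda>n. dst z (x n) w)}" (is "closed_convex ?W")
proof (rule ccsetI)
  show "?W \<subseteq> carrier E" using closed_convex_carrier[OF V] by auto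
next
  fix s y assume s: "\<And>k. s k \<in> ?W" and y: "y \<in> carrier E" and l: "AE w in M. (\<lambda>k. dst (s k) y w) \<longlonglongrightarrow> 0"
  have sV: "s k \<in> V" and sc: "s k \<in> carrier E" for k using s closed_convex_carrier[OF V] by auto
  have "AE w in M. \<forall>k. R w (\<lambda>n. dst (s k) (x n) w)"
    unfolding AE_all_countable using s by simp
  moreover have "AE w in M. \<forall>k n. dst y (x n) w \<le> dst y (s k) w + dst (s k) (x n) w"
    unfolding AE_all_countable using sc y x by (intro allI AE_dst_triangle)
  moreover have "AE w in M. \<forall>k. dst y (s k) w = dst (s k) y w"
    unfolding AE_all_countable using sc y by (intro allI AE_dst_commute)
  ultimately have "AE w in M. R w (\<lambda>n. dst y (x n) w)"
    using l
  proof eventually_elim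
    case (elim w)
    show ?case
    proof (rule lim)
      fix \<delta> :: real assume "\<delta> > 0"
      then have "\<forall>\<^sub>F k in sequentially. dst (s k) y w < \<delta>" by (rule order_tendstoD[OF elim(4)])
      then obtain k where k: "dst (s k) y w < \<delta>" by (auto simp: eventually_sequentially)
      have "dst y (x n) w \<le> dst (s k) (x n) w + \<delta>" for n
        using k elim(2)[rule_format, of n k] elim(3)[rule_format, of k] by linarith
      then show "\<exists>\<psi>. R w \<psi> \<and> (\<forall>n. dst y (x n) w \<le> \<psi> n + \<delta>)" using elim(1) by blast
    qed
  qed
  then show "y \<in> ?W" using closed_convex_limit[OF V sV y l] by simp
next
  fix a b and f :: "'w \<Rightarrow> real" assume ab: "a \<in> ?W" "b \<in> ?W"
    and f: "f \<in> borel_measurable M" "\<And>w. 0 \<le> f w" "\<And>w. f w \<le> 1"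
  have c: "a \<in> carrier E" "b \<in> carrier E" using ab closed_convex_carrier[OF V] by auto
  have "AE w in M. \<forall>n. dst (cmb f a b) (x n) w \<le> f w * dst a (x n) w + (1 - f w) * dst b (x n) w"
    unfolding AE_all_countable using f c x by (intro allI AE_dst_cmb_point)
  moreover have "AE w in M. R w (\<lambda>n. dst a (x n) w)" "AE w in M. R w (\<lambda>n. dst b (x n) w)" using ab by auto
  ultimately have "AE w in M. R w (\<lambda>n. dst (cmb f a b) (x n) w)"
  proof eventually_elim
    case (elim w)
    show ?case by (rule conv[OF elim(2,3) f(2,3)]) (use elim(1) in blast)
  qed
  then show "cmb f a b \<in> ?W" using ab f closed_convex_cmb[OF V] by auto
qed

lemma closed_convex_ball:
  assumes V: "closed_convex V" and q: "q \<in> carrier E"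
  shows "closed_convex {z \<in> V. AE w in M. w \<in> B \<longrightarrow> dst z q w \<le> u w}"
proof (rule closed_convex_distance_condition[OF V, of "\<lambda>_. q" "\<lambda>w \<phi>. w \<in> B \<longrightarrow> \<phi> 0 \<le> u w"])
  fix w and \<phi> :: "nat \<Rightarrow> real"
  assume lim: "\<And>\<delta>. \<delta> > 0 \<Longrightarrow> \<exists>\<psi>. (w \<in> B \<longrightarrow> \<psi> 0 \<le> u w) \<and> (\<forall>n. \<phi> n \<le> \<psi> n + \<delta>)"
  show "w \<in> B \<longrightarrow> \<phi> 0 \<le> u w"
  proof
    assume "w \<in> B"
    show "\<phi> 0 \<le> u w"
    proof (rule field_le_epsilon)
      fix \<delta> :: real assume "\<delta> > 0"
      then obtain \<psi> :: "nat \<Rightarrow> real" where "\<psi> 0 \<le> u w" "\<phi> 0 \<le> \<psi> 0 + \<delta>" using lim \<open>w \<in> B\<close> by blast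
      then show "\<phi> 0 \<le> u w + \<delta>" by simp
    qed
  qed
next
  fix w t and \<phi> \<psi> \<theta> :: "nat \<Rightarrow> real"
  assume h: "w \<in> B \<longrightarrow> \<phi> 0 \<le> u w" "w \<in> B \<longrightarrow> \<psi> 0 \<le> u w" "0 \<le> t" "t \<le> 1"
    and le: "\<And>n. \<theta> n \<le> t * \<phi> n + (1 - t) * \<psi> n"
  show "w \<in> B \<longrightarrow> \<theta> 0 \<le> u w"
    using le[of 0] convex_bound_le[of "\<phi> 0" "u w" "\<psi> 0" t "1 - t"] h by auto
qed (fact q)

section \<open>Convex compactness and gluing\<close>

abbreviation "ccompact \<equiv> L0_convexly_compact M E"

lemma ccompact_closed_convex: "ccompact G \<Longrightarrow> closed_convex G"
  by (simp add: L0_convexly_compact_def closed_convex_def)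

lemma ccompact_nonempty: "ccompact G \<Longrightarrow> G \<noteq> {}"
  by (simp add: L0_convexly_compact_def)

lemma ccompact_Inter:
  assumes "ccompact G" "\<And>A. A \<in> \<A> \<Longrightarrow> A \<subseteq> G \<and> closed_convex A"
    and "\<And>\<F>. \<F> \<subseteq> \<A> \<Longrightarrow> finite \<F> \<Longrightarrow> \<F> \<noteq> {} \<Longrightarrow> \<Inter>\<F> \<noteq> {}"
  shows "\<Inter>\<A> \<noteq> {}"
proof -
  have *: "\<forall>\<A>. (\<forall>A\<in>\<A>. A \<subseteq> G \<and> closedin (eps_lam_topology M E) A \<and> L0_convex M E A) \<and>
      (\<forall>\<F>\<subseteq>\<A>. finite \<F> \<and> \<F> \<noteq> {} \<longrightarrow> \<Inter>\<F> \<noteq> {}) \<longrightarrow> \<Inter>\<A> \<noteq> {}"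
    using assms(1) unfolding L0_convexly_compact_def by (elim conjE)
  show ?thesis
    by (rule *[rule_format]) (use assms(2,3) in \<open>auto simp: closed_convex_def\<close>)
qed

lemma ccompact_subset:
  assumes "ccompact G" "V \<subseteq> G" "closed_convex V" "V \<noteq> {}"
  shows "ccompact V"
  unfolding L0_convexly_compact_def
proof (intro conjI allI impI)
  fix \<A> assume a: "(\<forall>A\<in>\<A>. A \<subseteq> V \<and> closedin (eps_lam_topology M E) A \<and> L0_convex M E A) \<and>
      (\<forall>\<F>\<subseteq>\<A>. finite \<F> \<and> \<F> \<noteq> {} \<longrightarrow> \<Inter>\<F> \<noteq> {})"
  show "\<Inter>\<A> \<noteq> {}"
    by (rule ccompact_Inter[OF assms(1)]) (use a assms(2) in \<open>auto simp: closed_convex_def\<close>)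
qed (use assms in \<open>auto simp: closed_convex_def\<close>)

lemma ccompact_chain:
  assumes "ccompact G" "\<V> \<noteq> {}" "\<And>V. V \<in> \<V> \<Longrightarrow> V \<subseteq> G \<and> closed_convex V \<and> V \<noteq> {}"
    and "\<And>U V. U \<in> \<V> \<Longrightarrow> V \<in> \<V> \<Longrightarrow> U \<subseteq> V \<or> V \<subseteq> U"
  shows "\<Inter>\<V> \<noteq> {}"
proof (rule ccompact_Inter[OF assms(1)])
  fix \<F> assume \<F>: "finite \<F>" "\<F> \<noteq> {}" "\<F> \<subseteq> \<V>"
  then have "\<Inter>\<F> \<in> \<F>"
  proof (induction rule: finite_ne_induct)
    case (insert V \<F>)
    then have "\<Inter>\<F> \<in> \<F>" by auto
    then have "V \<subseteq> \<Inter>\<F> \<or> \<Inter>\<F> \<subseteq> V" using assms(4) insert.prems by blast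
    then show ?case
    proof
      assume "V \<subseteq> \<Inter>\<F>"
      then have "\<Inter>(insert V \<F>) = V" by auto
      then show ?thesis by simp
    next
      assume "\<Inter>\<F> \<subseteq> V"
      then have "\<Inter>(insert V \<F>) = \<Inter>\<F>" by auto
      then show ?thesis using \<open>\<Inter>\<F> \<in> \<F>\<close> by simp
    qed
  qed simp
  then show "\<Inter>\<F> \<noteq> {}" using assms(3) \<F> by blast
qed (use assms in auto)

lemma ccompact_decreasing:
  assumes "ccompact G" "\<And>n::nat. V n \<subseteq> G" "\<And>n. closed_convex (V n)" "\<And>n. V n \<noteq> {}" "\<And>n. V (Suc n) \<subseteq> V n"
  obtains z where "\<And>n. z \<in> V n"
proof -
  have "V n \<subseteq> V m" if "m \<le> n" for m n using assms(5) that by (rule lift_Suc_antimono_le)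
  then have "V n \<subseteq> V m \<or> V m \<subseteq> V n" for m n using nat_le_linear by metis
  then have "\<Inter>(range V) \<noteq> {}"
    using assms(2-4) by (intro ccompact_chain[OF assms(1)]) blast+
  then show ?thesis using that by auto
qed

lemma AE_dst_cmb_indicator:
  assumes [measurable]: "A \<in> sets M" and c: "x \<in> carrier E" "y \<in> carrier E"
  shows "AE w in M. w \<in> A \<longrightarrow> dst (cmb (indicator A) x y) x w \<le> 0"
    "AE w in M. w \<notin> A \<longrightarrow> dst (cmb (indicator A) x y) y w \<le> 0"
proof -
  have m: "(indicator A :: _ \<Rightarrow> real) \<in> borel_measurable M" by measurable
  have "AE w in M. dst (cmb (indicator A) x y) x w \<le> indicator A w * dst x x w + (1 - indicator A w) * dst y x w"
    using m c by (intro AE_dst_cmb_point) (auto split: split_indicator)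
  then show "AE w in M. w \<in> A \<longrightarrow> dst (cmb (indicator A) x y) x w \<le> 0"
    using AE_dst_self[OF c(1)] by eventually_elim auto
  have "AE w in M. dst (cmb (indicator A) x y) y w \<le> indicator A w * dst x y w + (1 - indicator A w) * dst y y w"
    using m c by (intro AE_dst_cmb_point) (auto split: split_indicator)
  then show "AE w in M. w \<notin> A \<longrightarrow> dst (cmb (indicator A) x y) y w \<le> 0"
    using AE_dst_self[OF c(2)] by eventually_elim auto
qed

text \<open>The points of \<open>G\<close> that agree with \<open>x k\<close> on the \<open>k\<close>-th piece of the partition for all \<open>k \<le> n\<close> form a
decreasing sequence of nonempty closed convex sets, and a common point is the wanted concatenation.\<close>

lemma ccompact_concatenation:
  assumes G: "ccompact G" and x: "\<And>k::nat. x k \<in> G" and A[measurable]: "\<And>k. A k \<in> sets M"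
  obtains z where "z \<in> G" "AE w in M. \<forall>k. w \<in> disjointed A k \<longrightarrow> dst z (x k) w \<le> 0"
proof -
  note cc = ccompact_closed_convex[OF G]
  have xc: "x k \<in> carrier E" for k using x closed_convex_carrier[OF cc] by auto
  let ?D = "disjointed A"
  have D[measurable]: "?D k \<in> sets M" for k
    using sets.range_disjointed_sets[of A M] A by blast
  define W where "W k = {z \<in> G. AE w in M. w \<in> ?D k \<longrightarrow> dst z (x k) w \<le> 0}" for k
  define V where "V n = (\<Inter>k\<in>{..n}. W k)" for n
  have ccW: "closed_convex (W k)" for k unfolding W_def using cc xc by (rule closed_convex_ball)
  have "V n \<noteq> {}" for n
  proof (induction n)
    case 0
    have "AE w in M. w \<in> ?D 0 \<longrightarrow> dst (x 0) (x 0) w \<le> 0"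
      using AE_dst_self[OF xc[of 0]] by eventually_elim simp
    then have "x 0 \<in> V 0" using x by (auto simp: V_def W_def)
    then show ?case by auto
  next
    case (Suc n)
    then obtain z where z: "z \<in> V n" by auto
    have zG: "z \<in> G" and zc: "z \<in> carrier E" using z closed_convex_carrier[OF cc] by (auto simp: V_def W_def)
    let ?z = "cmb (indicator (?D (Suc n))) (x (Suc n)) z"
    have zG': "?z \<in> G" using x zG by (intro closed_convex_cmb[OF cc]) (auto split: split_indicator)
    then have zc': "?z \<in> carrier E" using closed_convex_carrier[OF cc] by auto
    have "?z \<in> W k" if "k \<le> n" for k
    proof -
      have "?D k \<inter> ?D (Suc n) = {}"
        using disjoint_family_disjointed[of A] \<open>k \<le> n\<close> unfolding disjoint_family_on_def by simp
      then have dj: "w \<notin> ?D (Suc n)" if "w \<in> ?D k" for w using that by blast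
      have "AE w in M. w \<in> ?D k \<longrightarrow> dst z (x k) w \<le> 0" using z that by (auto simp: V_def W_def)
      moreover have "AE w in M. w \<notin> ?D (Suc n) \<longrightarrow> dst ?z z w \<le> 0"
        using AE_dst_cmb_indicator(2) D xc zc by blast
      moreover have "AE w in M. dst ?z (x k) w \<le> dst ?z z w + dst z (x k) w"
        using zc' zc xc by (rule AE_dst_triangle)
      ultimately have "AE w in M. w \<in> ?D k \<longrightarrow> dst ?z (x k) w \<le> 0"
      proof eventually_elim
        case (elim w)
        then show ?case using dj[of w] by linarith
      qed
      then show ?thesis using zG' by (simp add: W_def)
    qed
    moreover have "?z \<in> W (Suc n)"
      using AE_dst_cmb_indicator(1)[OF D xc zc] zG' by (simp add: W_def)
    ultimately have "?z \<in> V (Suc n)" by (auto simp: V_def le_Suc_eq)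
    then show ?case by auto
  qed
  moreover have "V n \<subseteq> G" for n by (auto simp: V_def W_def)
  moreover have "closed_convex (V n)" for n unfolding V_def using ccW by (intro closed_convex_Inter) auto
  moreover have "V (Suc n) \<subseteq> V n" for n by (auto simp: V_def)
  ultimately obtain z where z: "\<And>n. z \<in> V n" using ccompact_decreasing[OF G, of V] by blast
  then have "z \<in> G" "\<forall>k. AE w in M. w \<in> ?D k \<longrightarrow> dst z (x k) w \<le> 0"
    by (auto simp: V_def W_def)
  then show ?thesis using that by (simp add: AE_all_countable)
qed

text \<open>The form in which gluing is used: each \<open>x k\<close> solves a problem on \<open>C k\<close>, and \<open>z\<close> solves it on the union.\<close>

lemma ccompact_select:
  assumes G: "ccompact G" and x: "\<And>k::nat. x k \<in> G" and C: "\<And>k. C k \<in> sets M"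
  obtains z where "z \<in> G" "AE w in M. w \<in> (\<Union>k. C k) \<longrightarrow> (\<exists>k. w \<in> C k \<and> dst z (x k) w \<le> 0)"
proof -
  obtain z where z: "z \<in> G" "AE w in M. \<forall>k. w \<in> disjointed C k \<longrightarrow> dst z (x k) w \<le> 0"
    using ccompact_concatenation[of G x C, OF G x C] by blast
  from z(2) have "AE w in M. w \<in> (\<Union>k. C k) \<longrightarrow> (\<exists>k. w \<in> C k \<and> dst z (x k) w \<le> 0)"
  proof eventually_elim
    case (elim w)
    have "\<exists>k. w \<in> C k \<and> dst z (x k) w \<le> 0" if "w \<in> (\<Union>k. C k)"
    proof -
      have "w \<in> (\<Union>k. disjointed C k)" using that by (simp only: UN_disjointed_eq)
      then obtain k where k: "w \<in> disjointed C k" by blast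
      then show ?thesis using elim disjointed_subset[of C k] by auto
    qed
    then show ?case by blast
  qed
  with z(1) show ?thesis by (rule that)
qed

end

section \<open>Boundedness of convexly compact sets\<close>

context rn_module
begin

lemma closed_convex_cmb_const:
  assumes "closed_convex V" "x \<in> V" "y \<in> V" "0 \<le> c" "c \<le> 1"
  shows "cmb (\<lambda>_. c) x y \<in> V"
  using assms by (intro closed_convex_cmb) auto

lemma AE_dst_ray_const:
  assumes "x \<in> carrier E" "y \<in> carrier E"
  shows "AE w in M. dst (cmb (\<lambda>_. a) x y) (cmb (\<lambda>_. b) x y) w = \<bar>a - b\<bar> * dst x y w"
  using AE_dst_ray[of "\<lambda>_. a" "\<lambda>_. b"] assms by simp

text \<open>A nontrivial ray \<open>x m = p + (m + 1) (u - p)\<close> in \<open>G\<close> contradicts compactness. The sets to intersect are the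
horoballs \<open>{z. b z \<le> - n \<parallel>u - p\<parallel>}\<close> of the Busemann function \<open>b z = lim (\<parallel>z - x m\<parallel> - m \<parallel>u - p\<parallel>)\<close>, which is
convex and continuous. They are easier to handle than the tails of the ray itself, for which closedness would
involve limits of unbounded random coefficients. The ray meets all horoballs, while \<open>b z\<close> is finite at
each \<open>z\<close>.\<close>

lemma recession_trivial:
  assumes G: "ccompact G" and p: "p \<in> G" and u: "u \<in> G"
    and ray: "\<And>m::nat. cmb (\<lambda>_. real m + 1) u p \<in> G"
  shows "u = p"
proof -
  note cc = ccompact_closed_convex[OF G]
  have pc: "p \<in> carrier E" and uc: "u \<in> carrier E" using p u closed_convex_carrier[OF cc] by auto
  define x where "x m = cmb (\<lambda>_. real m + 1) u p" for m
  have xG: "x m \<in> G" and xc: "x m \<in> carrier E" for m using ray closed_convex_carrier[OF cc] by (auto simp: x_def)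
  \<comment> \<open>P n z w below says that z lies in the n-th horoball, with the limit in the Busemann function spelled out\<close>
  define R where "R n w \<phi> \<longleftrightarrow> (\<forall>\<delta>>0. \<exists>k. \<forall>m\<ge>k. \<phi> m \<le> (real m - real n) * dst u p w + \<delta>)"
    for n :: nat and w and \<phi> :: "nat \<Rightarrow> real"
  define P where "P n z w \<longleftrightarrow> R n w (\<lambda>m. dst z (x m) w)" for n z w
  note P_R = P_def and P_def = P_def[unfolded R_def]
  define W where "W n = {z \<in> G. AE w in M. P n z w}" for n
  have cW: "closed_convex (W n)" for n
    unfolding W_def P_R
  proof (rule closed_convex_distance_condition[OF cc xc])
    fix w \<phi> assume lim: "\<And>\<delta>. \<delta> > 0 \<Longrightarrow> \<exists>\<psi>. R n w \<psi> \<and> (\<forall>m. \<phi> m \<le> \<psi> m + \<delta>)"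
    show "R n w \<phi>"
      unfolding R_def
    proof (intro allI impI)
      fix \<delta> :: real assume "\<delta> > 0"
      then have d: "\<delta> / 2 > 0" by simp
      then obtain \<psi> where psi: "R n w \<psi>" "\<And>m. \<phi> m \<le> \<psi> m + \<delta> / 2" using lim by blast
      then obtain k where k: "\<forall>m\<ge>k. \<psi> m \<le> (real m - real n) * dst u p w + \<delta> / 2"
        using d unfolding R_def by blast
      have "\<phi> m \<le> (real m - real n) * dst u p w + \<delta>" if "m \<ge> k" for m
        using k[rule_format, OF that] psi(2)[of m] by linarith
      then show "\<exists>k. \<forall>m\<ge>k. \<phi> m \<le> (real m - real n) * dst u p w + \<delta>" by blast
    qed
  next
    fix w t \<phi> \<psi> \<theta> assume R: "R n w \<phi>" "R n w \<psi>" and t: "0 \<le> t" "t \<le> 1"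
      and le: "\<And>m. \<theta> m \<le> t * \<phi> m + (1 - t) * \<psi> m"
    show "R n w \<theta>"
      unfolding R_def
    proof (intro allI impI)
      fix \<delta> :: real assume "\<delta> > 0"
      let ?r = "\<lambda>m. (real m - real n) * dst u p w + \<delta>"
      obtain i j where ij: "\<forall>m\<ge>i. \<phi> m \<le> ?r m" "\<forall>m\<ge>j. \<psi> m \<le> ?r m"
        using R \<open>\<delta> > 0\<close> unfolding R_def by metis
      have "\<theta> m \<le> ?r m" if "m \<ge> max i j" for m
        using le[of m] convex_bound_le[of "\<phi> m" "?r m" "\<psi> m" t "1 - t"] ij t that by auto
      then show "\<exists>k. \<forall>m\<ge>k. \<theta> m \<le> ?r m" by blast
    qed
  qed
  have v0: "AE w in M. 0 \<le> dst u p w" using uc pc by (rule AE_dst_nonneg)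
  have xW: "x n \<in> W n" for n
  proof -
    have "AE w in M. \<forall>m. dst (x n) (x m) w = \<bar>(real n + 1) - (real m + 1)\<bar> * dst u p w"
      unfolding AE_all_countable x_def using uc pc by (intro allI AE_dst_ray_const)
    then have "AE w in M. P n (x n) w"
    proof eventually_elim
      case (elim w)
      have "dst (x n) (x m) w \<le> (real m - real n) * dst u p w + \<delta>" if "m \<ge> n" "\<delta> > 0" for m \<delta>
        using elim[rule_format, of m] that by (simp add: abs_real_def)
      then show ?case unfolding P_def by blast
    qed
    then show ?thesis using xG by (simp add: W_def)
  qed
  have dec: "W (Suc n) \<subseteq> W n" for n
  proof
    fix z assume z: "z \<in> W (Suc n)"
    then have "AE w in M. P (Suc n) z w" by (simp add: W_def)
    with v0 have "AE w in M. P n z w"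
    proof eventually_elim
      case (elim w)
      have *: "(real m - real (Suc n)) * dst u p w \<le> (real m - real n) * dst u p w" for m
        using elim(1) by (intro mult_right_mono) auto
      show ?case
        unfolding P_def
      proof (intro allI impI)
        fix \<delta> :: real assume "\<delta> > 0"
        then obtain k where k: "\<forall>m\<ge>k. dst z (x m) w \<le> (real m - real (Suc n)) * dst u p w + \<delta>"
          using elim(2) unfolding P_def by blast
        have "dst z (x m) w \<le> (real m - real n) * dst u p w + \<delta>" if "m \<ge> k" for m
          using k[rule_format, OF that] *[of m] by linarith
        then show "\<exists>k. \<forall>m\<ge>k. dst z (x m) w \<le> (real m - real n) * dst u p w + \<delta>" by blast
      qed
    qed
    then show "z \<in> W n" using z by (simp add: W_def)
  qed
  have "W n \<subseteq> G" for n by (auto simp: W_def)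
  moreover have "W n \<noteq> {}" for n using xW by auto
  ultimately obtain z where z: "\<And>n. z \<in> W n" using ccompact_decreasing[OF G, of W] cW dec by blast
  have zc: "z \<in> carrier E" using z[of 0] closed_convex_carrier[OF cc] by (auto simp: W_def)
  have "AE w in M. \<forall>n. P n z w" unfolding AE_all_countable using z by (simp add: W_def)
  moreover have "AE w in M. \<forall>m. dst (x m) p w \<le> dst (x m) z w + dst z p w"
    unfolding AE_all_countable using zc xc pc by (intro allI AE_dst_triangle)
  moreover have "AE w in M. \<forall>m. dst (x m) z w = dst z (x m) w"
    unfolding AE_all_countable using zc xc by (intro allI AE_dst_commute)
  moreover have "AE w in M. \<forall>m. dst (x m) p w = (real m + 1) * dst u p w"
    unfolding AE_all_countable x_def
  proof
    fix m :: nat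
    show "AE w in M. dst (cmb (\<lambda>_. real m + 1) u p) p w = (real m + 1) * dst u p w"
      using AE_dst_ray_const[OF uc pc, of "real m + 1" 0] cmb_0[OF uc pc] by simp
  qed
  ultimately have "AE w in M. dst u p w = 0"
    using v0
  proof eventually_elim
    case (elim w)
    have "(real n + 1) * dst u p w \<le> 1 + dst z p w" for n
    proof -
      obtain k where k: "\<forall>m\<ge>k. dst z (x m) w \<le> (real m - real n) * dst u p w + 1"
        using elim(1) unfolding P_def by (meson zero_less_one)
      have "(real k + 1) * dst u p w \<le> (real k - real n) * dst u p w + 1 + dst z p w"
        using k[rule_format, of k] elim(2)[rule_format, of k] elim(3)[rule_format, of k] elim(4)[rule_format, of k]
        by linarith
      then show ?thesis by (simp add: algebra_simps)
    qed
    then have b: "real n * dst u p w \<le> 1 + dst z p w" for n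
      using elim(5) by (smt (verit) mult_right_mono)
    show ?case
    proof (rule ccontr)
      assume "dst u p w \<noteq> 0"
      then have "dst u p w > 0" using elim(5) by simp
      then obtain n :: nat where "1 + dst z p w < real n * dst u p w"
        using reals_Archimedean3 by blast
      then show False using b[of n] by simp
    qed
  qed
  then show ?thesis by (rule eq_if_AE_dst_zero[OF uc pc])
qed

lemma closed_convex_homothety:
  assumes cc: "closed_convex G" and q: "q \<in> carrier E" and l: "l > 0"
  shows "closed_convex ((\<lambda>y. cmb (\<lambda>_. l) y q) ` G)"
proof (rule ccsetI)
  show "(\<lambda>y. cmb (\<lambda>_. l) y q) ` G \<subseteq> carrier E"
    using closed_convex_carrier[OF cc] q by (auto intro: cmb_closed)
next
  fix s z assume s: "\<And>k. s k \<in> (\<lambda>y. cmb (\<lambda>_. l) y q) ` G" and z: "z \<in> carrier E"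
    and lim: "AE w in M. (\<lambda>k. dst (s k) z w) \<longlonglongrightarrow> 0"
  have "\<forall>k. \<exists>y. y \<in> G \<and> s k = cmb (\<lambda>_. l) y q" using s by blast
  then obtain y where y: "\<And>k. y k \<in> G" "\<And>k. s k = cmb (\<lambda>_. l) (y k) q" by metis
  have yc: "y k \<in> carrier E" for k using y closed_convex_carrier[OF cc] by auto
  have sc: "s k \<in> carrier E" for k using yc q y(2) by (auto intro: cmb_closed)
  \<comment> \<open>closedness: the homothety is inverted by the weight 1 / l\<close>
  define y' where "y' = cmb (\<lambda>_. 1 / l) z q"
  have yc': "y' \<in> carrier E" unfolding y'_def using z q by (intro cmb_closed) auto
  have yk: "y k = cmb (\<lambda>_. 1 / l) (s k) q" for k
    unfolding y(2) using l yc q cmb_ray_cmb[of "y k" q "\<lambda>_. 1 / l" "\<lambda>_. l"] cmb_1[of "y k" q] by simp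
  have "AE w in M. \<forall>k. dst (y k) y' w = \<bar>1 / l\<bar> * dst (s k) z w"
    unfolding AE_all_countable y'_def by (subst yk) (intro allI AE_dst_cmb_same sc z q borel_measurable_const)
  then have "AE w in M. (\<lambda>k. dst (y k) y' w) \<longlonglongrightarrow> 0"
    using lim
  proof eventually_elim
    case (elim w)
    then show ?case using tendsto_mult_right_zero[OF elim(2), of "\<bar>1 / l\<bar>"] by simp
  qed
  then have "y' \<in> G" by (rule closed_convex_limit[OF cc y(1) yc'])
  moreover have "z = cmb (\<lambda>_. l) y' q"
    unfolding y'_def using l z q cmb_ray_cmb[of z q "\<lambda>_. l" "\<lambda>_. 1 / l"] cmb_1[of z q] by simp
  ultimately show "z \<in> (\<lambda>y. cmb (\<lambda>_. l) y q) ` G" by blast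
next
  fix a b and f :: "'w \<Rightarrow> real"
  assume "a \<in> (\<lambda>y. cmb (\<lambda>_. l) y q) ` G" "b \<in> (\<lambda>y. cmb (\<lambda>_. l) y q) ` G"
    and f: "f \<in> borel_measurable M" "\<And>w. 0 \<le> f w" "\<And>w. f w \<le> 1"
  then obtain x y where xy: "x \<in> G" "y \<in> G" "a = cmb (\<lambda>_. l) x q" "b = cmb (\<lambda>_. l) y q" by blast
  have c: "x \<in> carrier E" "y \<in> carrier E" using xy closed_convex_carrier[OF cc] by auto
  have "cmb f a b = cmb (\<lambda>_. l) (cmb f x y) q"
    unfolding xy using cmb_interchange[OF c(1) q c(2) q, of "\<lambda>_. l" f] cmb_refl[OF q, of f] f by simp
  moreover have "cmb f x y \<in> G" using xy f by (intro closed_convex_cmb[OF cc])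
  ultimately show "cmb f a b \<in> (\<lambda>y. cmb (\<lambda>_. l) y q) ` G" by blast
qed

text \<open>By \<open>cmb_half_exchange\<close> the hypothesis places a point of \<open>\<epsilon> G + (1 - \<epsilon>) p\<close>, for \<open>\<epsilon> = 1 / (i + 1)\<close>, within distance
\<open>2 N\<close> of the reflection \<open>r\<close> of \<open>x\<close> in \<open>p\<close>. These sets decrease to the union of all rays from \<open>p\<close> in \<open>G\<close>,
which is \<open>{p}\<close>; hence \<open>p\<close> itself is that close to \<open>r\<close>.\<close>

lemma reflection_bound:
  assumes G: "ccompact G" and p: "p \<in> G" and x: "x \<in> G"
    and ex: "\<And>i::nat. \<exists>y\<in>G. AE w in M. w \<in> B \<longrightarrow> dst (cmb (\<lambda>_. 1 / (real i + 2)) y x) p w \<le> N w"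
  shows "AE w in M. w \<in> B \<longrightarrow> dst x p w \<le> 2 * N w"
proof -
  note cc = ccompact_closed_convex[OF G]
  have pc: "p \<in> carrier E" and xc: "x \<in> carrier E" using p x closed_convex_carrier[OF cc] by auto
  define r where "r = cmb (\<lambda>_. 2) p x"
  have rc: "r \<in> carrier E" unfolding r_def using pc xc by (intro cmb_closed) auto
  have pr: "cmb (\<lambda>_. 1/2) r x = p"
    unfolding r_def using cmb_ray_cmb[OF pc xc, of "\<lambda>_. 1/2" "\<lambda>_. 2"] cmb_1[OF pc xc] by simp
  define V where "V j = {z \<in> (\<lambda>y. cmb (\<lambda>_. 1 / (real j + 1)) y p) ` G.
    AE w in M. w \<in> B \<longrightarrow> dst z r w \<le> 2 * N w}" for j :: nat
  have "V j \<subseteq> G" for j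
    unfolding V_def using closed_convex_cmb_const[OF cc _ p, of _ "1 / (real j + 1)"] by auto
  moreover have "closed_convex (V j)" for j
    unfolding V_def using cc pc rc by (intro closed_convex_ball closed_convex_homothety) auto
  moreover have "V (Suc j) \<subseteq> V j" for j
  proof -
    have "cmb (\<lambda>_. 1 / (real (Suc j) + 1)) y p \<in> (\<lambda>y. cmb (\<lambda>_. 1 / (real j + 1)) y p) ` G" if y: "y \<in> G" for y
    proof -
      have yc: "y \<in> carrier E" using y closed_convex_carrier[OF cc] by auto
      let ?y = "cmb (\<lambda>_. (real j + 1) / (real j + 2)) y p"
      have "?y \<in> G" using y p by (intro closed_convex_cmb_const[OF cc]) auto
      moreover have "cmb (\<lambda>_. 1 / (real (Suc j) + 1)) y p = cmb (\<lambda>_. 1 / (real j + 1)) ?y p"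
        by (subst cmb_ray_cmb[OF yc pc]) (auto simp: field_simps)
      ultimately show ?thesis by blast
    qed
    then show ?thesis by (auto simp: V_def)
  qed
  moreover have "V j \<noteq> {}" for j
  proof -
    obtain y where y: "y \<in> G" and yN: "AE w in M. w \<in> B \<longrightarrow> dst (cmb (\<lambda>_. 1 / (real j + 2)) y x) p w \<le> N w"
      using ex by blast
    have yc: "y \<in> carrier E" using y closed_convex_carrier[OF cc] by auto
    let ?c = "cmb (\<lambda>_. 1 / (real j + 2)) y x" and ?u = "cmb (\<lambda>_. 1 / (real j + 1)) y p"
    define t where "t = (real j + 2) / (2 * (real j + 1))"
    have t: "0 \<le> t" "t \<le> 1" by (auto simp: t_def field_simps)
    have cC: "?c \<in> carrier E" and uC: "?u \<in> carrier E" using yc xc pc by (auto intro: cmb_closed)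
    have "cmb (\<lambda>_. 1/2) ?u x = cmb (\<lambda>_. t) ?c p"
      using cmb_half_exchange[OF xc yc pc, of "1 / (real j + 2)"]
      by (simp add: t_def field_simps)
    then have "AE w in M. dst (cmb (\<lambda>_. t) ?c p) p w = \<bar>1/2\<bar> * dst ?u r w"
      using AE_dst_cmb_same[of "\<lambda>_. 1/2" ?u x r] uC xc rc pr by simp
    moreover have "AE w in M. dst (cmb (\<lambda>_. t) ?c p) p w = \<bar>t\<bar> * dst ?c p w"
      using AE_dst_ray_const[OF cC pc, of t 0] cmb_0[OF cC pc] by simp
    moreover have "AE w in M. 0 \<le> dst ?c p w" using cC pc by (rule AE_dst_nonneg)
    ultimately have "AE w in M. w \<in> B \<longrightarrow> dst ?u r w \<le> 2 * N w"
      using yN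
    proof eventually_elim
      case (elim w)
      have "t * dst ?c p w \<le> 1 * dst ?c p w" using t elim(3) by (intro mult_right_mono)
      then show ?case using elim t by auto
    qed
    then have "?u \<in> V j" using y by (auto simp: V_def)
    then show ?thesis by blast
  qed
  ultimately obtain u where u: "\<And>j. u \<in> V j" using ccompact_decreasing[OF G, of V] by blast
  have uG: "u \<in> G" using u[of 0] \<open>V 0 \<subseteq> G\<close> by blast
  have "u = p"
  proof (rule recession_trivial[OF G p uG])
    fix m :: nat
    obtain y where y: "y \<in> G" "u = cmb (\<lambda>_. 1 / (real m + 1)) y p" using u[of m] by (auto simp: V_def)
    have yc: "y \<in> carrier E" using y closed_convex_carrier[OF cc] by auto
    have "cmb (\<lambda>_. real m + 1) u p = y"
      unfolding y(2) using cmb_ray_cmb[OF yc pc, of "\<lambda>_. real m + 1" "\<lambda>_. 1 / (real m + 1)"]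
        cmb_1[OF yc pc] by simp
    then show "cmb (\<lambda>_. real m + 1) u p \<in> G" using y by simp
  qed
  then have "AE w in M. w \<in> B \<longrightarrow> dst p r w \<le> 2 * N w" using u[of 0] by (auto simp: V_def)
  moreover have "AE w in M. dst p r w = dst p x w"
    using AE_dst_ray_const[OF pc xc, of 1 2] cmb_1[OF pc xc] by (simp add: r_def)
  moreover have "AE w in M. dst p x w = dst x p w" using pc xc by (rule AE_dst_commute)
  ultimately show ?thesis by eventually_elim simp
qed

text \<open>If no \<open>x\<close> and \<open>m\<close> work, then for each \<open>m\<close> some point of the contracted set stays below \<open>n\<close> on more than half of
\<open>A\<close>. The point \<open>x\<close> is taken far away on all of \<open>A\<close>, compared with the bound \<open>N\<close> that follows from \<open>n\<close>, and then
\<open>reflection_bound\<close> is violated on a nonnull event.\<close>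

lemma escaping_step:
  assumes G: "ccompact G" and p: "p \<in> G" and q: "q \<in> G" and l: "0 < l" "l \<le> 1"
    and A[measurable]: "A \<in> sets M" "prob A > 0"
    and unb: "\<And>N. N \<in> borel_measurable M \<Longrightarrow> \<exists>x\<in>G. AE w in M. w \<in> A \<longrightarrow> N w < dst x p w"
  shows "\<exists>x\<in>G. \<exists>m. 0 < m \<and> m < 1 \<and>
    (\<forall>y\<in>G. prob (A \<inter> {w \<in> space M. n < dst (cmb (\<lambda>_. l) (cmb (\<lambda>_. m) y x) q) p w}) \<ge> prob A / 2)"
proof (rule ccontr)
  assume neg: "\<not> ?thesis"
  note cc = ccompact_closed_convex[OF G]
  have pc: "p \<in> carrier E" and qc: "q \<in> carrier E" using p q closed_convex_carrier[OF cc] by auto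
  note [measurable] = dst_measurable[OF pc qc]
  define N where "N w = (n + dst p q w) / l" for w
  have "(\<lambda>w. 2 * N w) \<in> borel_measurable M" unfolding N_def by measurable
  then obtain x where x: "x \<in> G" and far: "AE w in M. w \<in> A \<longrightarrow> 2 * N w < dst x p w" using unb by blast
  have xc: "x \<in> carrier E" using x closed_convex_carrier[OF cc] by auto
  have near: "AE w in M. dst (cmb (\<lambda>_. l) c q) p w \<le> n \<longrightarrow> dst c p w \<le> N w" if c: "c \<in> carrier E" for c
  proof -
    let ?c = "cmb (\<lambda>_. l) c q" and ?p = "cmb (\<lambda>_. l) p q"
    have C: "?c \<in> carrier E" "?p \<in> carrier E" using c pc qc by (auto intro: cmb_closed)
    have "AE w in M. dst ?c ?p w = \<bar>l\<bar> * dst c p w" using c pc qc by (intro AE_dst_cmb_same) auto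
    moreover have "AE w in M. dst ?c ?p w \<le> dst ?c p w + dst p ?p w" using C pc by (intro AE_dst_triangle)
    moreover have "AE w in M. dst p ?p w = \<bar>1 - l\<bar> * dst p q w"
      using AE_dst_ray_const[OF pc qc, of 1 l] cmb_1[OF pc qc] by simp
    moreover have "AE w in M. 0 \<le> dst p q w" using pc qc by (rule AE_dst_nonneg)
    ultimately show ?thesis
    proof eventually_elim
      case (elim w)
      have "(1 - l) * dst p q w \<le> 1 * dst p q w" using l elim(4) by (intro mult_right_mono) auto
      then have "dst ?c p w \<le> n \<Longrightarrow> l * dst c p w \<le> n + dst p q w" using elim l by simp
      then show ?case using l by (simp add: N_def pos_le_divide_eq mult.commute)
    qed
  qed
  define m where "m i = 1 / (real i + 2)" for i :: nat
  have m: "0 < m i" "m i < 1" for i by (auto simp: m_def field_simps)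
  define Bad where "Bad i y = A \<inter> {w \<in> space M. n < dst (cmb (\<lambda>_. l) (cmb (\<lambda>_. m i) y x) q) p w}" for i y
  have "\<exists>y\<in>G. prob (Bad i y) < prob A / 2" for i
    using neg x m[of i] unfolding Bad_def not_le[symmetric] by blast
  then obtain y where y: "\<And>i. y i \<in> G" "\<And>i. prob (Bad i (y i)) < prob A / 2" by metis
  have yc: "y i \<in> carrier E" for i using y closed_convex_carrier[OF cc] by auto
  have cyc: "cmb (\<lambda>_. m i) (y i) x \<in> carrier E" for i using yc xc by (auto intro: cmb_closed)
  have ccyc: "cmb (\<lambda>_. l) (cmb (\<lambda>_. m i) (y i) x) q \<in> carrier E" for i using cyc qc by (auto intro: cmb_closed)
  note [measurable] = dst_measurable[OF ccyc pc]
  define C where "C i = A - Bad i (y i)" for i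
  have Bad_sets[measurable]: "Bad i (y i) \<in> sets M" for i unfolding Bad_def by measurable
  have C_sets[measurable]: "C i \<in> sets M" for i unfolding C_def by measurable
  have C_good: "AE w in M. w \<in> C i \<longrightarrow> dst (cmb (\<lambda>_. m i) (y i) x) p w \<le> N w" for i
    using near[OF cyc[of i]] AE_space by eventually_elim (auto simp: C_def Bad_def not_less)
  have C_prob: "prob (C i) \<ge> prob A / 2" for i
  proof -
    have "prob (C i) = prob A - prob (Bad i (y i))"
      unfolding C_def by (intro finite_measure_Diff) (auto simp: Bad_def)
    then show ?thesis using y(2)[of i] by linarith
  qed
  \<comment> \<open>the good events vary with i; each point of their upper limit B lies in good events of arbitrarily large index, and the sets {m i y + (1 - m i) x} shrink as i grows, so that gluing serves every index on all of B\<close>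
  define U where "U i = (\<Union>j\<in>{i..}. C j)" for i :: nat
  have U_sets[measurable]: "U i \<in> sets M" for i unfolding U_def by measurable
  define B where "B = (\<Inter>i. U i)"
  have "decseq U" unfolding decseq_def U_def by (intro allI impI UN_mono) auto
  then have "(\<lambda>i. prob (U i)) \<longlonglongrightarrow> prob B"
    unfolding B_def by (intro finite_Lim_measure_decseq) auto
  moreover have "prob (U i) \<ge> prob A / 2" for i
  proof -
    have "prob (C i) \<le> prob (U i)" by (intro finite_measure_mono) (auto simp: U_def)
    then show ?thesis using C_prob[of i] by linarith
  qed
  ultimately have "prob B \<ge> prob A / 2" by (intro LIMSEQ_le_const) auto
  have BA: "B \<subseteq> A" by (auto simp: B_def U_def C_def)
  have "AE w in M. w \<in> B \<longrightarrow> dst x p w \<le> 2 * N w"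
  proof (rule reflection_bound[OF G p x])
    fix i :: nat
    define s where "s k = cmb (\<lambda>_. m (i + k) / m i) (y (i + k)) x" for k
    have sG: "s k \<in> G" for k
      unfolding s_def using y x by (intro closed_convex_cmb_const[OF cc]) (auto simp: m_def field_simps)
    have sc: "s k \<in> carrier E" for k using sG closed_convex_carrier[OF cc] by auto
    have s_eq: "cmb (\<lambda>_. m i) (s k) x = cmb (\<lambda>_. m (i + k)) (y (i + k)) x" for k
      unfolding s_def using m(1)[of i] by (subst cmb_ray_cmb[OF yc xc]) auto
    obtain z where z: "z \<in> G" and zs:
      "AE w in M. w \<in> (\<Union>k. C (i + k)) \<longrightarrow> (\<exists>k. w \<in> C (i + k) \<and> dst z (s k) w \<le> 0)"
      using ccompact_select[of G s "\<lambda>k. C (i + k)", OF G sG C_sets] by blast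
    have zc: "z \<in> carrier E" using z closed_convex_carrier[OF cc] by auto
    have czc: "cmb (\<lambda>_. m i) z x \<in> carrier E" using zc xc by (auto intro: cmb_closed)
    have "AE w in M. \<forall>k. dst (cmb (\<lambda>_. m i) z x) (cmb (\<lambda>_. m (i + k)) (y (i + k)) x) w = \<bar>m i\<bar> * dst z (s k) w"
      unfolding AE_all_countable s_eq[symmetric] using zc sc xc by (intro allI AE_dst_cmb_same) auto
    moreover have "AE w in M. \<forall>k. dst (cmb (\<lambda>_. m i) z x) p w \<le>
        dst (cmb (\<lambda>_. m i) z x) (cmb (\<lambda>_. m (i + k)) (y (i + k)) x) w + dst (cmb (\<lambda>_. m (i + k)) (y (i + k)) x) p w"
      unfolding AE_all_countable using czc cyc pc by (intro allI AE_dst_triangle)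
    moreover have "AE w in M. \<forall>k. w \<in> C (i + k) \<longrightarrow> dst (cmb (\<lambda>_. m (i + k)) (y (i + k)) x) p w \<le> N w"
      unfolding AE_all_countable using C_good by blast
    ultimately have "AE w in M. w \<in> B \<longrightarrow> dst (cmb (\<lambda>_. m i) z x) p w \<le> N w"
      using zs
    proof eventually_elim
      case (elim w)
      have "dst (cmb (\<lambda>_. m i) z x) p w \<le> N w" if "w \<in> B"
      proof -
        have "w \<in> U i" using that by (auto simp: B_def)
        then obtain j where "j \<ge> i" "w \<in> C j" by (auto simp: U_def)
        then have "w \<in> (\<Union>k. C (i + k))" by (metis UN_I UNIV_I le_add_diff_inverse)
        then obtain k where k: "w \<in> C (i + k)" "dst z (s k) w \<le> 0" using elim(4) by blast
        then have "dst (cmb (\<lambda>_. m (i + k)) (y (i + k)) x) p w \<le> N w" using elim(3) by blast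
        moreover have "\<bar>m i\<bar> * dst z (s k) w \<le> 0"
          using k by (intro mult_nonneg_nonpos) auto
        ultimately show ?thesis using elim(1)[rule_format, of k] elim(2)[rule_format, of k] by linarith
      qed
      then show ?case by blast
    qed
    then show "\<exists>y\<in>G. AE w in M. w \<in> B \<longrightarrow> dst (cmb (\<lambda>_. 1 / (real i + 2)) y x) p w \<le> N w"
      using z by (auto simp: m_def)
  qed
  then have "AE w in M. w \<notin> B" using far by eventually_elim (use BA in auto)
  moreover have "B \<in> sets M" unfolding B_def by measurable
  ultimately have "prob B = 0" by (simp add: prob_eq_0)
  then show False using \<open>prob B \<ge> prob A / 2\<close> A(2) by simp
qed

text \<open>If the essential supremum of the distances is infinite on an event \<open>A\<close> of positive probability, then
\<open>escaping_step\<close> can be iterated. This gives a decreasing sequence of homothetic images of \<open>G\<close> such that the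
points of the \<open>n\<close>-th image have distance above \<open>n\<close> from \<open>p\<close> with probability at least \<open>prob A / 2\<close>; a common point is impossible.\<close>

lemma ccompact_bounded:
  assumes G: "ccompact G" and p: "p \<in> G"
  obtains u :: "'w \<Rightarrow> real" where "u \<in> borel_measurable M" "\<And>x. x \<in> G \<Longrightarrow> AE w in M. dst x p w \<le> u w"
proof -
  note cc = ccompact_closed_convex[OF G]
  have pc: "p \<in> carrier E" using p closed_convex_carrier[OF cc] by auto
  have dm: "(\<lambda>w. ereal (dst x p w)) \<in> borel_measurable M" if "x \<in> G" for x
    using that closed_convex_carrier[OF cc] pc by (intro borel_measurable_ereal dst_measurable) auto
  obtain x where xG: "\<And>k::nat. x k \<in> G"
    and xsup: "\<And>y. y \<in> G \<Longrightarrow> AE w in M. ereal (dst y p w) \<le> (SUP k. ereal (dst (x k) p w))"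
    using ess_sup_sequence[of G "\<lambda>x w. ereal (dst x p w)", OF dm p] by blast
  have xc: "x k \<in> carrier E" for k using xG closed_convex_carrier[OF cc] by auto
  note [measurable] = dm[OF xG] dst_measurable[OF xc pc]
  define U where "U w = (SUP k. ereal (dst (x k) p w))" for w
  have U[measurable]: "U \<in> borel_measurable M" unfolding U_def by measurable
  have dU: "AE w in M. ereal (dst y p w) \<le> U w" if "y \<in> G" for y
    using xsup[OF that] by (simp add: U_def)
  define A where "A = {w \<in> space M. U w = \<infinity>}"
  have A[measurable]: "A \<in> sets M" unfolding A_def by measurable
  have "prob A = 0"
  proof (rule ccontr)
    assume "prob A \<noteq> 0"
    then have pA: "prob A > 0" by (simp add: zero_less_measure_iff)
    have unb: "\<exists>z\<in>G. AE w in M. w \<in> A \<longrightarrow> N w < dst z p w" if N[measurable]: "N \<in> borel_measurable M" for N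
    proof -
      define C where "C k = {w \<in> space M. N w < dst (x k) p w}" for k
      have C[measurable]: "C k \<in> sets M" for k unfolding C_def by measurable
      obtain z where z: "z \<in> G" and zx: "AE w in M. w \<in> (\<Union>k. C k) \<longrightarrow> (\<exists>k. w \<in> C k \<and> dst z (x k) w \<le> 0)"
        using ccompact_select[of G x C, OF G xG C] by blast
      have zc: "z \<in> carrier E" using z closed_convex_carrier[OF cc] by auto
      have "AE w in M. \<forall>k. dst (x k) p w \<le> dst (x k) z w + dst z p w"
        unfolding AE_all_countable using xc zc pc by (intro allI AE_dst_triangle)
      moreover have "AE w in M. \<forall>k. dst (x k) z w = dst z (x k) w"
        unfolding AE_all_countable using xc zc by (intro allI AE_dst_commute)
      ultimately have "AE w in M. w \<in> A \<longrightarrow> N w < dst z p w"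
        using zx
      proof eventually_elim
        case (elim w)
        have "N w < dst z p w" if w: "w \<in> A"
        proof -
          have "ereal (N w) < U w" using w by (simp add: A_def)
          then obtain k where "N w < dst (x k) p w" unfolding U_def by (auto simp: less_SUP_iff)
          then have "w \<in> (\<Union>k. C k)" using w by (auto simp: C_def A_def)
          then obtain k where k: "w \<in> C k" "dst z (x k) w \<le> 0" using elim(3) by blast
          then have "N w < dst (x k) p w" by (simp add: C_def)
          then show ?thesis using elim(1)[rule_format, of k] elim(2)[rule_format, of k] k(2) by linarith
        qed
        then show ?case by blast
      qed
      then show ?thesis using z by blast
    qed
    define S where "S l q = (\<lambda>y. cmb (\<lambda>_. l) y q) ` G" for l :: real and q
    define P where "P = (\<lambda>(n::nat) (l::real, q). 0 < l \<and> l \<le> 1 \<and> q \<in> G)"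
    define Q where "Q = (\<lambda>(n::nat) (l, q) (l', q'). S l' q' \<subseteq> S l q \<and>
      (\<forall>y\<in>G. prob (A \<inter> {w \<in> space M. real n + 1 < dst (cmb (\<lambda>_. l') y q') p w}) \<ge> prob A / 2))"
    have step: "\<exists>s'. P (Suc n) s' \<and> Q n s s'" if Ps: "P n s" for n s
    proof -
      obtain l q where s: "s = (l, q)" by fastforce
      have lq: "0 < l" "l \<le> 1" "q \<in> G" using Ps by (auto simp: P_def s)
      obtain z m where z: "z \<in> G" and m: "0 < m" "m < 1" and esc:
        "\<forall>y\<in>G. prob (A \<inter> {w \<in> space M. real n + 1 < dst (cmb (\<lambda>_. l) (cmb (\<lambda>_. m) y z) q) p w}) \<ge> prob A / 2"
        using escaping_step[OF G p lq(3,1,2) A pA unb, of "real n + 1"] by blast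
      have qc: "q \<in> carrier E" and zc: "z \<in> carrier E" using lq z closed_convex_carrier[OF cc] by auto
      define t where "t = l * (1 - m) / (1 - l * m)"
      have lm: "l * m < 1" using lq m mult_le_less_imp_less[of l 1 m 1] by simp
      then have t: "0 \<le> t" "t \<le> 1" using lq m by (auto simp: t_def field_simps)
      define q' where "q' = cmb (\<lambda>_. t) z q"
      have q': "q' \<in> G" unfolding q'_def using z lq t by (intro closed_convex_cmb_const[OF cc])
      have eq: "cmb (\<lambda>_. l) (cmb (\<lambda>_. m) y z) q = cmb (\<lambda>_. l * m) y q'" if "y \<in> G" for y
        unfolding q'_def t_def using that closed_convex_carrier[OF cc] zc qc lm by (intro cmb_rebracket) auto
      have "P (Suc n) (l * m, q')" using lq m q' lm by (auto simp: P_def)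
      moreover have "S (l * m) q' \<subseteq> S l q"
      proof -
        have "cmb (\<lambda>_. l * m) y q' \<in> S l q" if y: "y \<in> G" for y
          unfolding eq[OF y, symmetric] S_def using y z m by (intro imageI closed_convex_cmb_const[OF cc]) auto
        then show ?thesis by (auto simp: S_def)
      qed
      then have "Q n s (l * m, q')" using esc eq by (simp add: Q_def s)
      ultimately show ?thesis by blast
    qed
    have "P 0 (1, p)" using p by (simp add: P_def)
    then obtain f where f: "\<And>n. P n (f n)" "\<And>n. Q n (f n) (f (Suc n))"
      using dependent_nat_choice[of P Q] step by blast
    define V where "V n = S (fst (f n)) (snd (f n))" for n
    have Pf: "0 < fst (f n)" "fst (f n) \<le> 1" "snd (f n) \<in> G" for n
      using f(1)[of n] by (auto simp: P_def split: prod.splits)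
    have Qf: "V (Suc n) \<subseteq> V n"
      "y \<in> V (Suc n) \<Longrightarrow> prob (A \<inter> {w \<in> space M. real n + 1 < dst y p w}) \<ge> prob A / 2" for n y
      using f(2)[of n] by (auto simp: Q_def V_def S_def split: prod.splits)
    have "V n \<subseteq> G" for n
      unfolding V_def S_def using Pf[of n] closed_convex_cmb_const[OF cc _ Pf(3)[of n], of _ "fst (f n)"] by auto
    moreover have "closed_convex (V n)" for n
      unfolding V_def S_def using Pf[of n] closed_convex_carrier[OF cc] by (intro closed_convex_homothety cc) auto
    moreover have "V n \<noteq> {}" for n using p by (auto simp: V_def S_def)
    ultimately obtain v where v: "\<And>n. v \<in> V n" using ccompact_decreasing[OF G, of V] Qf(1) by blast
    have vc: "v \<in> carrier E" using v[of 0] \<open>V 0 \<subseteq> G\<close> closed_convex_carrier[OF cc] by blast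
    note [measurable] = dst_measurable[OF vc pc]
    have "AE w in M. (\<lambda>k. dst v p w / (real k + 1)) \<longlonglongrightarrow> 0"
      using tendsto_mult_right_zero[OF LIMSEQ_inverse_real_of_nat]
      by (intro AE_I2) (simp add: divide_inverse add.commute)
    then obtain k where k: "prob {w \<in> space M. dst v p w / (real k + 1) < 1} > 1 - prob A / 2"
      using AE_tendsto_imp_prob[of "\<lambda>k w. dst v p w / (real k + 1)" 1 "prob A / 2"] pA by auto
    let ?X = "{w \<in> space M. dst v p w / (real k + 1) < 1}" and ?Y = "A \<inter> {w \<in> space M. real k + 1 < dst v p w}"
    have "prob ?X + prob ?Y = prob (?X \<union> ?Y)"
      by (intro finite_measure_Union[symmetric]) (auto simp: field_simps)
    moreover have "prob (?X \<union> ?Y) \<le> 1" by (rule prob_le_1)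
    moreover have "prob ?Y \<ge> prob A / 2" using Qf(2)[OF v] .
    ultimately show False using k by linarith
  qed
  then have "AE w in M. w \<notin> A" by (simp add: prob_eq_0)
  then have fin: "AE w in M. U w \<noteq> \<infinity>" using AE_space by eventually_elim (auto simp: A_def)
  show ?thesis
  proof (rule that[of "\<lambda>w. real_of_ereal (U w)"])
    show "(\<lambda>w. real_of_ereal (U w)) \<in> borel_measurable M" by measurable
    fix y assume "y \<in> G"
    from dU[OF this] fin show "AE w in M. dst y p w \<le> real_of_ereal (U w)"
    proof eventually_elim
      case (elim w)
      then show ?case by (cases "U w") auto
    qed
  qed
qed

end

section \<open>The asymptotic radius of a minimal invariant set\<close>

inductive_set composites :: "('e \<Rightarrow> 'e) set \<Rightarrow> ('e \<Rightarrow> 'e) set" for \<T> where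
  composites_id: "id \<in> composites \<T>"
| composites_step: "T \<in> \<T> \<Longrightarrow> s \<in> composites \<T> \<Longrightarrow> T \<circ> s \<in> composites \<T>"

lemma composites_comp: "s \<in> composites \<T> \<Longrightarrow> t \<in> composites \<T> \<Longrightarrow> s \<circ> t \<in> composites \<T>"
  by (induction rule: composites.induct) (auto simp: comp_assoc intro: composites_step)

lemma composites_maps:
  assumes "\<And>T. T \<in> \<T> \<Longrightarrow> T \<in> K \<rightarrow> K" "s \<in> composites \<T>" "x \<in> K"
  shows "s x \<in> K"
  using assms(2,3) by (induction rule: composites.induct) (use assms(1) in auto)

lemma composites_commute1:
  assumes "\<And>T. T \<in> \<T> \<Longrightarrow> T \<in> K \<rightarrow> K" "commutative_family_on K \<T>" "s \<in> composites \<T>" "T \<in> \<T>" "x \<in> K"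
  shows "s (T x) = T (s x)"
  using assms(3)
proof (induction rule: composites.induct)
  case (composites_step S s)
  then show ?case
    using assms composites_maps[OF assms(1) composites_step.hyps(2) assms(5)] by (auto simp: commutative_family_on_def)
qed simp

lemma composites_commute:
  assumes "\<And>T. T \<in> \<T> \<Longrightarrow> T \<in> K \<rightarrow> K" "commutative_family_on K \<T>" "s \<in> composites \<T>" "t \<in> composites \<T>" "x \<in> K"
  shows "s (t x) = t (s x)"
  using assms(4)
proof (induction rule: composites.induct)
  case (composites_step T t)
  then show ?case
    using composites_commute1[OF assms(1,2,3) composites_step.hyps(1), of "t x"]
      composites_maps[OF assms(1) composites_step.hyps(2) assms(5)] by auto
qed simp

lemma (in prob_space) prob_Int_gt:
  assumes "A \<in> sets M" "B \<in> sets M" "prob A > 1 - a" "prob B > 1 - b"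
  shows "prob (A \<inter> B) > 1 - (a + b)"
proof -
  have "prob (A \<union> B) = prob A + prob B - prob (A \<inter> B)"
    using assms by (intro measure_Un3) (auto simp: fmeasurable_eq_sets)
  then show ?thesis using assms prob_le_1[of "A \<union> B"] by linarith
qed

context rn_module
begin

definition nonexp :: "'e set \<Rightarrow> ('e \<Rightarrow> 'e) \<Rightarrow> bool" where
  "nonexp K T \<longleftrightarrow> T \<in> K \<rightarrow> K \<and> (\<forall>x\<in>K. \<forall>y\<in>K. AE w in M. dst (T x) (T y) w \<le> dst x y w)"

lemma nonexp_iff: "nonexpansive_on M E K T \<longleftrightarrow> nonexp K T"
  by (simp add: nonexpansive_on_def nonexp_def L0_le_def dst_def nrm_def)

lemma minimal_invariant:
  assumes G: "ccompact G" and T: "\<And>T. T \<in> \<T> \<Longrightarrow> T \<in> G \<rightarrow> G"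
  obtains K where "ccompact K" "K \<subseteq> G" "\<And>T. T \<in> \<T> \<Longrightarrow> T \<in> K \<rightarrow> K"
    "\<And>V. V \<subseteq> K \<Longrightarrow> V \<noteq> {} \<Longrightarrow> closed_convex V \<Longrightarrow> (\<And>T. T \<in> \<T> \<Longrightarrow> T \<in> V \<rightarrow> V) \<Longrightarrow> V = K"
proof -
  define A where "A = {V. V \<subseteq> G \<and> V \<noteq> {} \<and> closed_convex V \<and> (\<forall>T\<in>\<T>. T \<in> V \<rightarrow> V)}"
  have GA: "G \<in> A" using G T by (auto simp: A_def ccompact_closed_convex ccompact_nonempty)
  have "\<exists>K\<in>A. \<forall>V\<in>A. V \<subseteq> K \<longrightarrow> V = K"
  proof (rule predicate_Zorn)
    show "partial_order_on A (relation_of (\<lambda>U V. V \<subseteq> U) A)"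
      by (auto simp: partial_order_on_def preorder_on_def refl_on_def trans_def antisym_def relation_of_def)
    fix \<C> assume C: "\<C> \<in> Chains (relation_of (\<lambda>U V. V \<subseteq> U) A)"
    then have CA: "\<C> \<subseteq> A" by (auto simp: Chains_def relation_of_def)
    show "\<exists>u\<in>A. \<forall>a\<in>\<C>. u \<subseteq> a"
    proof (cases "\<C> = {}")
      case True
      then show ?thesis using GA by auto
    next
      case False
      have "\<Inter>\<C> \<noteq> {}"
      proof (rule ccompact_chain[OF G False])
        show "V \<subseteq> G \<and> closed_convex V \<and> V \<noteq> {}" if "V \<in> \<C>" for V using CA that by (auto simp: A_def)
        have "\<forall>U\<in>\<C>. \<forall>V\<in>\<C>. V \<subseteq> U \<or> U \<subseteq> V"
          using C unfolding Chains_def relation_of_def by auto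
        then show "U \<subseteq> V \<or> V \<subseteq> U" if "U \<in> \<C>" "V \<in> \<C>" for U V using that by blast
      qed
      moreover have "closed_convex (\<Inter>\<C>)" using CA False by (intro closed_convex_Inter) (auto simp: A_def)
      moreover have "\<Inter>\<C> \<subseteq> G" using CA False unfolding A_def by blast
      moreover have "\<forall>T\<in>\<T>. T \<in> \<Inter>\<C> \<rightarrow> \<Inter>\<C>"
      proof (intro ballI funcsetI InterI)
        fix T x V assume "T \<in> \<T>" "x \<in> \<Inter>\<C>" "V \<in> \<C>"
        then have "T \<in> V \<rightarrow> V" "x \<in> V" using CA by (auto simp: A_def)
        then show "T x \<in> V" by auto
      qed
      ultimately have "\<Inter>\<C> \<in> A" by (simp add: A_def)
      then show ?thesis by blast
    qed
  qed
  then obtain K where K: "K \<in> A" "\<And>V. V \<in> A \<Longrightarrow> V \<subseteq> K \<Longrightarrow> V = K" by blast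
  show ?thesis
  proof (rule that)
    show "K \<subseteq> G" using K(1) by (simp add: A_def)
    show "ccompact K" using K(1) by (intro ccompact_subset[OF G]) (auto simp: A_def)
    show "T \<in> K \<rightarrow> K" if "T \<in> \<T>" for T using K(1) that by (simp add: A_def)
    show "V = K" if "V \<subseteq> K" "V \<noteq> {}" "closed_convex V" "\<And>T. T \<in> \<T> \<Longrightarrow> T \<in> V \<rightarrow> V" for V
    proof (rule K(2))
      show "V \<in> A" using that \<open>K \<subseteq> G\<close> by (simp add: A_def)
    qed fact
  qed
qed

text \<open>This says that \<open>inf\<^sub>s sup\<^sub>z \<parallel>s z - y\<parallel> \<le> c\<close>. Stating it in probability lets a single composition \<open>s\<close> serve on
almost the whole space, instead of a countable partition with a different composition on each piece; the sets
\<open>s K\<close> are directed downwards because compositions commute.\<close>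

definition asymp_bound :: "'e set \<Rightarrow> ('e \<Rightarrow> 'e) set \<Rightarrow> ('w \<Rightarrow> real) \<Rightarrow> 'e \<Rightarrow> bool" where
  "asymp_bound K \<T> c y \<longleftrightarrow> (\<forall>\<epsilon>>0. \<exists>s\<in>composites \<T>. \<exists>A\<in>sets M. prob A > 1 - \<epsilon> \<and>
    (\<forall>z\<in>K. AE w in M. w \<in> A \<longrightarrow> dst (s z) y w \<le> c w + \<epsilon>))"

context
  fixes K :: "'e set" and \<T> :: "('e \<Rightarrow> 'e) set"
  assumes K: "ccompact K" and nonexp: "\<And>T. T \<in> \<T> \<Longrightarrow> nonexp K T"
    and comm: "commutative_family_on K \<T>"
begin

lemma maps: "T \<in> \<T> \<Longrightarrow> T \<in> K \<rightarrow> K"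
  using nonexp by (simp add: nonexp_def)

lemma K_carrier: "x \<in> K \<Longrightarrow> x \<in> carrier E"
  using closed_convex_carrier[OF ccompact_closed_convex[OF K]] .

lemma composites_nonexp: "s \<in> composites \<T> \<Longrightarrow> nonexp K s"
proof (induction rule: composites.induct)
  case composites_id
  then show ?case by (simp add: nonexp_def)
next
  case (composites_step T s)
  have "AE w in M. dst (T (s x)) (T (s y)) w \<le> dst x y w" if "x \<in> K" "y \<in> K" for x y
  proof -
    have "s x \<in> K" "s y \<in> K" using composites_step.IH that by (auto simp: nonexp_def)
    then have "AE w in M. dst (T (s x)) (T (s y)) w \<le> dst (s x) (s y) w"
      using nonexp[OF composites_step.hyps(1)] by (auto simp: nonexp_def)
    moreover have "AE w in M. dst (s x) (s y) w \<le> dst x y w"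
      using composites_step.IH that by (auto simp: nonexp_def)
    ultimately show ?thesis by eventually_elim simp
  qed
  then show ?case using composites_step.IH maps[OF composites_step.hyps(1)] by (auto simp: nonexp_def)
qed

lemma composites_in_K: "s \<in> composites \<T> \<Longrightarrow> z \<in> K \<Longrightarrow> s z \<in> K"
  using composites_nonexp by (auto simp: nonexp_def)

lemma composites_swap:
  assumes "s \<in> composites \<T>" "t \<in> composites \<T>" "z \<in> K"
  shows "s (t z) = t (s z)"
  by (rule composites_commute[OF _ comm assms]) (rule maps)

lemma asymp_bound_if_bounded:
  assumes s: "s \<in> composites \<T>" and le: "\<And>z. z \<in> K \<Longrightarrow> AE w in M. dst (s z) y w \<le> c w"
  shows "asymp_bound K \<T> c y"
  unfolding asymp_bound_def
proof (intro allI impI, goal_cases)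
  case e: (1 \<epsilon>)
  have "AE w in M. w \<in> space M \<longrightarrow> dst (s z) y w \<le> c w + \<epsilon>" if "z \<in> K" for z
    using le[OF that] by eventually_elim (use e in auto)
  then show ?case
    using e s by (intro bexI[of _ s] bexI[of _ "space M"]) (auto simp: prob_space)
qed

text \<open>If \<open>s\<close> serves for \<open>y\<close> then \<open>T \<circ> s\<close> serves for \<open>T y\<close>.\<close>

lemma asymp_bound_invariant:
  assumes y: "y \<in> K" "asymp_bound K \<T> c y" and T: "T \<in> \<T>"
  shows "asymp_bound K \<T> c (T y)"
  unfolding asymp_bound_def
proof (intro allI impI, goal_cases)
  case e: (1 \<epsilon>)
  then obtain s A where sA: "s \<in> composites \<T>" "A \<in> sets M" "prob A > 1 - \<epsilon>"
    "\<And>z. z \<in> K \<Longrightarrow> AE w in M. w \<in> A \<longrightarrow> dst (s z) y w \<le> c w + \<epsilon>"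
    using y(2) unfolding asymp_bound_def by meson
  have "AE w in M. w \<in> A \<longrightarrow> dst ((T \<circ> s) z) (T y) w \<le> c w + \<epsilon>" if z: "z \<in> K" for z
  proof -
    have "AE w in M. dst (T (s z)) (T y) w \<le> dst (s z) y w"
      using nonexp[OF T] y(1) composites_in_K[OF sA(1) z] by (simp add: nonexp_def)
    then show ?thesis using sA(4)[OF z] by eventually_elim auto
  qed
  then show ?case
    using sA(2,3) composites_step[OF T sA(1)] by blast
qed

text \<open>If \<open>s\<close> serves for one index and \<open>t\<close> for another, then \<open>s \<circ> t = t \<circ> s\<close> serves for both.\<close>

lemma asymp_bound_common:
  assumes I: "finite I" "\<And>i. i \<in> I \<Longrightarrow> asymp_bound K \<T> (c i) (y i)" and e: "\<epsilon> > 0"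
  shows "\<exists>s\<in>composites \<T>. \<exists>A\<in>sets M. prob A > 1 - \<epsilon> \<and>
    (\<forall>i\<in>I. \<forall>z\<in>K. AE w in M. w \<in> A \<longrightarrow> dst (s z) (y i) w \<le> c i w + \<epsilon>)"
  using I e
proof (induction I arbitrary: \<epsilon> rule: finite_induct)
  case empty
  then show ?case using composites_id by (intro bexI[of _ id] bexI[of _ "space M"]) (auto simp: prob_space)
next
  case (insert j I)
  have e2: "\<epsilon> / 2 > 0" using insert.prems by simp
  obtain s A where sA: "s \<in> composites \<T>" "A \<in> sets M" "prob A > 1 - \<epsilon> / 2"
    "\<forall>i\<in>I. \<forall>z\<in>K. AE w in M. w \<in> A \<longrightarrow> dst (s z) (y i) w \<le> c i w + \<epsilon> / 2"
    using insert.IH[OF _ e2] insert.prems(1) by (meson insertI2)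
  obtain t B where tB: "t \<in> composites \<T>" "B \<in> sets M" "prob B > 1 - \<epsilon> / 2"
    "\<forall>z\<in>K. AE w in M. w \<in> B \<longrightarrow> dst (t z) (y j) w \<le> c j w + \<epsilon> / 2"
    using insert.prems(1)[of j] e2 unfolding asymp_bound_def by (meson insertI1)
  have "AE w in M. w \<in> A \<inter> B \<longrightarrow> dst ((s \<circ> t) z) (y i) w \<le> c i w + \<epsilon>"
    if i: "i \<in> insert j I" and z: "z \<in> K" for i z
  proof (cases "i \<in> I")
    case True
    have "AE w in M. w \<in> A \<longrightarrow> dst (s (t z)) (y i) w \<le> c i w + \<epsilon> / 2"
      using sA(4) True composites_in_K[OF tB(1) z] by blast
    then show ?thesis by eventually_elim (use e2 in auto)
  next
    case False
    then have "i = j" using i by simp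
    have "AE w in M. w \<in> B \<longrightarrow> dst (t (s z)) (y j) w \<le> c j w + \<epsilon> / 2"
      using tB(4) composites_in_K[OF sA(1) z] by blast
    then have "AE w in M. w \<in> B \<longrightarrow> dst (s (t z)) (y j) w \<le> c j w + \<epsilon> / 2"
      by (simp only: composites_swap[OF sA(1) tB(1) z])
    then show ?thesis
      unfolding \<open>i = j\<close> comp_def by eventually_elim (use e2 in auto)
  qed
  moreover have "prob (A \<inter> B) > 1 - \<epsilon>" using prob_Int_gt[OF sA(2) tB(2) sA(3) tB(3)] by simp
  ultimately show ?case using composites_comp[OF sA(1) tB(1)] sA(2) tB(2)
    by (intro bexI[of _ "s \<circ> t"] bexI[of _ "A \<inter> B"]) auto
qed

lemma asymp_bound_pair:
  assumes "asymp_bound K \<T> c y" "asymp_bound K \<T> c' y'" "\<epsilon> > 0"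
  obtains s A where "s \<in> composites \<T>" "A \<in> sets M" "prob A > 1 - \<epsilon>"
    "\<And>z. z \<in> K \<Longrightarrow> AE w in M. w \<in> A \<longrightarrow> dst (s z) y w \<le> c w + \<epsilon> \<and> dst (s z) y' w \<le> c' w + \<epsilon>"
proof -
  let ?c = "\<lambda>i. if i then c else c'" and ?y = "\<lambda>i. if i then y else y'"
  have "asymp_bound K \<T> (?c i) (?y i)" for i using assms by simp
  then obtain s A where s: "s \<in> composites \<T>" and A: "A \<in> sets M" "prob A > 1 - \<epsilon>" and sA:
    "\<forall>i\<in>UNIV. \<forall>z\<in>K. AE w in M. w \<in> A \<longrightarrow> dst (s z) (?y i) w \<le> ?c i w + \<epsilon>"
    using asymp_bound_common[of "UNIV :: bool set" ?c ?y \<epsilon>] \<open>\<epsilon> > 0\<close> by auto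
  show ?thesis
  proof (rule that[OF s A])
    fix z assume z: "z \<in> K"
    have "AE w in M. w \<in> A \<longrightarrow> dst (s z) y w \<le> c w + \<epsilon>" using sA[rule_format, of True z] z by simp
    moreover have "AE w in M. w \<in> A \<longrightarrow> dst (s z) y' w \<le> c' w + \<epsilon>" using sA[rule_format, of False z] z by simp
    ultimately show "AE w in M. w \<in> A \<longrightarrow> dst (s z) y w \<le> c w + \<epsilon> \<and> dst (s z) y' w \<le> c' w + \<epsilon>"
      by eventually_elim auto
  qed
qed

text \<open>The asymptotic radius is a convex and continuous function of the center.\<close>

lemma closed_convex_asymp_bound: "closed_convex {y \<in> K. asymp_bound K \<T> c y}"
proof (rule ccsetI)
  show "{y \<in> K. asymp_bound K \<T> c y} \<subseteq> carrier E" using K_carrier by auto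
next
  fix u y assume u: "\<And>k. u k \<in> {y \<in> K. asymp_bound K \<T> c y}" and y: "y \<in> carrier E"
    and lim: "AE w in M. (\<lambda>k. dst (u k) y w) \<longlonglongrightarrow> 0"
  have ub: "asymp_bound K \<T> c (u k)" for k using u by simp
  have uK: "u k \<in> K" and uc: "u k \<in> carrier E" for k using u K_carrier by auto
  have yK: "y \<in> K" by (rule closed_convex_limit[OF ccompact_closed_convex[OF K] uK y lim])
  have "asymp_bound K \<T> c y"
    unfolding asymp_bound_def
  proof (intro allI impI, goal_cases)
    case e: (1 \<epsilon>)
    then have e2: "\<epsilon> / 2 > 0" by simp
    note [measurable] = dst_measurable[OF uc y]
    obtain k where k: "prob {w \<in> space M. dst (u k) y w < \<epsilon> / 2} > 1 - \<epsilon> / 2"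
      using AE_tendsto_imp_prob[OF _ lim e2 e2] by auto
    let ?B = "{w \<in> space M. dst (u k) y w < \<epsilon> / 2}"
    obtain s A where sA: "s \<in> composites \<T>" "A \<in> sets M" "prob A > 1 - \<epsilon> / 2"
      "\<forall>z\<in>K. AE w in M. w \<in> A \<longrightarrow> dst (s z) (u k) w \<le> c w + \<epsilon> / 2"
      using ub[of k] e2 unfolding asymp_bound_def by meson
    have "AE w in M. w \<in> A \<inter> ?B \<longrightarrow> dst (s z) y w \<le> c w + \<epsilon>" if z: "z \<in> K" for z
    proof -
      have "AE w in M. dst (s z) y w \<le> dst (s z) (u k) w + dst (u k) y w"
        using composites_in_K[OF sA(1) z] K_carrier uc y by (intro AE_dst_triangle) auto
      moreover have "AE w in M. w \<in> A \<longrightarrow> dst (s z) (u k) w \<le> c w + \<epsilon> / 2" using sA(4) z by blast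
      ultimately show ?thesis by eventually_elim auto
    qed
    moreover have "prob (A \<inter> ?B) > 1 - \<epsilon>" using prob_Int_gt[OF sA(2) _ sA(3) k] by simp
    moreover have "A \<inter> ?B \<in> sets M" using sA(2) by auto
    ultimately show ?case using sA(1) by blast
  qed
  then show "y \<in> {y \<in> K. asymp_bound K \<T> c y}" using yK by simp
next
  fix x y and f :: "'w \<Rightarrow> real" assume x: "x \<in> {y \<in> K. asymp_bound K \<T> c y}"
    and y: "y \<in> {y \<in> K. asymp_bound K \<T> c y}"
    and f: "f \<in> borel_measurable M" "\<And>w. 0 \<le> f w" "\<And>w. f w \<le> 1"
  have cK: "cmb f x y \<in> K" using x y f by (intro closed_convex_cmb[OF ccompact_closed_convex[OF K]]) auto
  have "asymp_bound K \<T> c (cmb f x y)"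
    unfolding asymp_bound_def
  proof (intro allI impI, goal_cases)
    case e: (1 \<epsilon>)
    obtain s A where sA: "s \<in> composites \<T>" "A \<in> sets M" "prob A > 1 - \<epsilon>"
      "\<And>z. z \<in> K \<Longrightarrow> AE w in M. w \<in> A \<longrightarrow> dst (s z) x w \<le> c w + \<epsilon> \<and> dst (s z) y w \<le> c w + \<epsilon>"
      using asymp_bound_pair[of c x c y \<epsilon>] x y e by blast
    have "AE w in M. w \<in> A \<longrightarrow> dst (s z) (cmb f x y) w \<le> c w + \<epsilon>" if z: "z \<in> K" for z
    proof -
      have C: "s z \<in> carrier E" "x \<in> carrier E" "y \<in> carrier E" "cmb f x y \<in> carrier E"
        using composites_in_K[OF sA(1) z] K_carrier x y cK by auto
      have "AE w in M. dst (cmb f x y) (s z) w \<le> f w * dst x (s z) w + (1 - f w) * dst y (s z) w"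
        using f C by (intro AE_dst_cmb_point)
      then show ?thesis
        using sA(4)[OF z] AE_dst_commute[OF C(1,2)] AE_dst_commute[OF C(1,3)] AE_dst_commute[OF C(1,4)]
      proof eventually_elim
        case (elim w)
        have "dst (s z) (cmb f x y) w \<le> c w + \<epsilon>" if "w \<in> A"
        proof -
          have "f w * dst x (s z) w \<le> f w * (c w + \<epsilon>)" "(1 - f w) * dst y (s z) w \<le> (1 - f w) * (c w + \<epsilon>)"
            using elim that f by (auto intro!: mult_left_mono)
          then show ?thesis using elim(1,5) by (simp add: algebra_simps)
        qed
        then show ?case by blast
      qed
    qed
    then show ?case using sA(1-3) by blast
  qed
  then show "cmb f x y \<in> {y \<in> K. asymp_bound K \<T> c y}" using cK by simp
qed

lemma asymp_bound_min:
  assumes "asymp_bound K \<T> c y" "asymp_bound K \<T> c' y"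
  shows "asymp_bound K \<T> (\<lambda>w. min (c w) (c' w)) y"
  unfolding asymp_bound_def
proof (intro allI impI, goal_cases)
  case e: (1 \<epsilon>)
  obtain s A where sA: "s \<in> composites \<T>" "A \<in> sets M" "prob A > 1 - \<epsilon>"
    "\<And>z. z \<in> K \<Longrightarrow> AE w in M. w \<in> A \<longrightarrow> dst (s z) y w \<le> c w + \<epsilon> \<and> dst (s z) y w \<le> c' w + \<epsilon>"
    using asymp_bound_pair[OF assms e] by blast
  have "AE w in M. w \<in> A \<longrightarrow> dst (s z) y w \<le> min (c w) (c' w) + \<epsilon>" if "z \<in> K" for z
    using sA(4)[OF that] by eventually_elim auto
  then show ?case using sA(1-3) by blast
qed

lemma asymp_bound_limit:
  assumes b: "\<And>k. asymp_bound K \<T> (m k) y" and [measurable]: "\<And>k. m k \<in> borel_measurable M" "c \<in> borel_measurable M"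
    and lim: "AE w in M. (\<lambda>k. m k w - c w) \<longlonglongrightarrow> 0"
  shows "asymp_bound K \<T> c y"
  unfolding asymp_bound_def
proof (intro allI impI, goal_cases)
  case e: (1 \<epsilon>)
  then have e2: "\<epsilon> / 2 > 0" by simp
  obtain k where k: "prob {w \<in> space M. m k w - c w < \<epsilon> / 2} > 1 - \<epsilon> / 2"
    using AE_tendsto_imp_prob[OF _ lim e2 e2] by auto
  let ?B = "{w \<in> space M. m k w - c w < \<epsilon> / 2}"
  obtain s A where sA: "s \<in> composites \<T>" "A \<in> sets M" "prob A > 1 - \<epsilon> / 2"
    "\<forall>z\<in>K. AE w in M. w \<in> A \<longrightarrow> dst (s z) y w \<le> m k w + \<epsilon> / 2"
    using b[of k] e2 unfolding asymp_bound_def by meson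
  have "AE w in M. w \<in> A \<inter> ?B \<longrightarrow> dst (s z) y w \<le> c w + \<epsilon>" if z: "z \<in> K" for z
  proof -
    have "AE w in M. w \<in> A \<longrightarrow> dst (s z) y w \<le> m k w + \<epsilon> / 2" using sA(4) z by blast
    then show ?thesis by eventually_elim auto
  qed
  moreover have "prob (A \<inter> ?B) > 1 - \<epsilon>" using prob_Int_gt[OF sA(2) _ sA(3) k] by simp
  moreover have "A \<inter> ?B \<in> sets M" using sA(2) by auto
  ultimately show ?case using sA(1) by blast
qed

lemma asymp_bound_nonneg:
  assumes y: "y \<in> K" and b: "asymp_bound K \<T> c y" and [measurable]: "c \<in> borel_measurable M"
  shows "AE w in M. 0 \<le> c w"
proof -
  have pos: "prob {w \<in> space M. - ((1/2)^k) \<le> c w} > 1 - (1/2)^k" for k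
  proof -
    have "(0::real) < (1/2)^k" by simp
    then obtain s A where sA: "s \<in> composites \<T>" "A \<in> sets M" "prob A > 1 - (1/2)^k"
      "\<forall>z\<in>K. AE w in M. w \<in> A \<longrightarrow> dst (s z) y w \<le> c w + (1/2)^k"
      using b unfolding asymp_bound_def by meson
    have "AE w in M. w \<in> A \<longrightarrow> dst (s y) y w \<le> c w + (1/2)^k" using sA(4) y by blast
    moreover have "AE w in M. 0 \<le> dst (s y) y w"
      using composites_in_K[OF sA(1) y] y K_carrier by (intro AE_dst_nonneg) auto
    ultimately have "AE w in M. w \<in> A \<longrightarrow> w \<in> {w \<in> space M. - ((1/2)^k) \<le> c w}"
      using AE_space by eventually_elim auto
    then have "prob A \<le> prob {w \<in> space M. - ((1/2)^k) \<le> c w}" by (rule finite_measure_mono_AE) measurable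
    then show ?thesis using sA(3) by linarith
  qed
  have "AE w in M. (\<lambda>k::nat. max 0 (- c w)) \<longlonglongrightarrow> 0"
  proof (rule AE_tendsto_if_prob_fast)
    fix k
    have "{w \<in> space M. - ((1/2)^Suc k) \<le> c w} \<subseteq> {w \<in> space M. max 0 (- c w) < (1/2)^k}"
    proof safe
      fix w assume "- ((1/2)^Suc k) \<le> c w"
      moreover have "(1/2::real)^Suc k < (1/2)^k" by simp
      moreover have "0 < (1/2::real)^k" by simp
      ultimately show "max 0 (- c w) < (1/2)^k" unfolding max_less_iff_conj by linarith
    qed
    then have "prob {w \<in> space M. - ((1/2)^Suc k) \<le> c w} \<le> prob {w \<in> space M. max 0 (- c w) < (1/2)^k}"
      by (intro finite_measure_mono) measurable
    moreover have "(1/2::real)^Suc k < (1/2)^k" by simp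
    ultimately show "prob {w \<in> space M. max 0 (- c w) < (1/2)^k} > 1 - (1/2)^k" using pos[of "Suc k"] by linarith
  qed auto
  then show ?thesis
  proof eventually_elim
    case (elim w)
    then have "max 0 (- c w) = 0" by (rule LIMSEQ_unique[OF tendsto_const])
    then show ?case by linarith
  qed
qed

text \<open>Asymptotic bounds are closed under minima and under almost everywhere limits, so their essential infimum is one of them.\<close>

lemma least_asymp_bound:
  assumes p: "p \<in> K"
  obtains \<rho> where "\<rho> \<in> borel_measurable M" "AE w in M. 0 \<le> \<rho> w" "asymp_bound K \<T> \<rho> p"
    "\<And>c. c \<in> borel_measurable M \<Longrightarrow> asymp_bound K \<T> c p \<Longrightarrow> AE w in M. \<rho> w \<le> c w"
proof -
  define Cs where "Cs = {c \<in> borel_measurable M. asymp_bound K \<T> c p}"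
  obtain u where u: "u \<in> borel_measurable M" "\<And>x. x \<in> K \<Longrightarrow> AE w in M. dst x p w \<le> u w"
    using ccompact_bounded[OF K p] by blast
  have "asymp_bound K \<T> u p"
    using u(2) by (intro asymp_bound_if_bounded[OF composites_id]) simp
  then have uC: "u \<in> Cs" using u by (simp add: Cs_def)
  have cm: "(\<lambda>w. ereal (- c w)) \<in> borel_measurable M" if "c \<in> Cs" for c
    using that by (auto simp: Cs_def)
  obtain c where cC: "\<And>k::nat. c k \<in> Cs"
    and csup: "\<And>d. d \<in> Cs \<Longrightarrow> AE w in M. ereal (- d w) \<le> (SUP k. ereal (- c k w))"
    using ess_sup_sequence[of Cs "\<lambda>c w. ereal (- c w)", OF cm uC] by blast
  have [measurable]: "c k \<in> borel_measurable M" for k using cC by (auto simp: Cs_def)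
  have c_nonneg: "AE w in M. \<forall>k. 0 \<le> c k w"
    unfolding AE_all_countable using cC by (auto simp: Cs_def intro!: asymp_bound_nonneg[OF p])
  define m where "m k w = (MIN i\<in>{..k}. c i w)" for k w
  have m_Suc: "m (Suc k) = (\<lambda>w. min (m k w) (c (Suc k) w))" for k
    by (rule ext) (simp add: m_def atMost_Suc min.commute)
  have m_bound: "asymp_bound K \<T> (m k) p \<and> m k \<in> borel_measurable M" for k
  proof (induction k)
    case 0
    have "m 0 = c 0" by (rule ext) (simp add: m_def)
    then show ?case using cC[of 0] by (simp add: Cs_def)
  next
    case (Suc k)
    then show ?case using asymp_bound_min cC[of "Suc k"] by (auto simp: m_Suc Cs_def)
  qed
  define \<rho> where "\<rho> w = real_of_ereal (INF k. ereal (c k w))" for w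
  have \<rho>m[measurable]: "\<rho> \<in> borel_measurable M" unfolding \<rho>_def by measurable
  have key: "AE w in M. (INF k. ereal (c k w)) = ereal (\<rho> w) \<and> 0 \<le> \<rho> w"
    using c_nonneg
  proof eventually_elim
    case (elim w)
    let ?I = "INF k. ereal (c k w)"
    have "0 \<le> ?I" using elim by (intro INF_greatest) auto
    moreover have "?I \<le> ereal (c 0 w)" by (rule INF_lower) simp
    ultimately show ?case unfolding \<rho>_def by (cases ?I) auto
  qed
  have lim: "AE w in M. (\<lambda>k. m k w - \<rho> w) \<longlonglongrightarrow> 0"
    using key
  proof eventually_elim
    case (elim w)
    have low: "\<rho> w \<le> c k w" for k
    proof -
      have "(INF k. ereal (c k w)) \<le> ereal (c k w)" by (rule INF_lower) simp
      then show ?thesis using elim by simp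
    qed
    show ?case
    proof (rule LIMSEQ_I)
      fix r :: real assume "r > 0"
      then have "(INF k. ereal (c k w)) < ereal (\<rho> w + r)" using elim by simp
      then obtain i where i: "c i w < \<rho> w + r" by (auto simp: INF_less_iff)
      have "norm (m k w - \<rho> w - 0) < r" if "k \<ge> i" for k
      proof -
        have "m k w \<le> c i w" unfolding m_def using that by (intro Min_le) auto
        moreover have "\<rho> w \<le> m k w" unfolding m_def using low by (intro Min.boundedI) auto
        ultimately show ?thesis using i by simp
      qed
      then show "\<exists>no. \<forall>k\<ge>no. norm (m k w - \<rho> w - 0) < r" by blast
    qed
  qed
  show ?thesis
  proof (rule that[OF \<rho>m])
    show "AE w in M. 0 \<le> \<rho> w" using key by eventually_elim simp
    show "asymp_bound K \<T> \<rho> p" by (rule asymp_bound_limit[OF _ _ \<rho>m lim]) (simp_all add: m_bound)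
    fix d assume d: "d \<in> borel_measurable M" "asymp_bound K \<T> d p"
    then have "AE w in M. ereal (- d w) \<le> (SUP k. ereal (- c k w))" by (intro csup) (simp add: Cs_def)
    then show "AE w in M. \<rho> w \<le> d w"
      using key
    proof eventually_elim
      case (elim w)
      have "(SUP k. ereal (- c k w)) \<le> ereal (- \<rho> w)"
      proof (rule SUP_least)
        fix k
        have "(INF k. ereal (c k w)) \<le> ereal (c k w)" by (rule INF_lower) simp
        then show "ereal (- c k w) \<le> ereal (- \<rho> w)" using elim by simp
      qed
      then have "ereal (- d w) \<le> ereal (- \<rho> w)" using elim(1) by (rule order_trans[rotated])
      then show ?case by simp
    qed
  qed
qed

context
  fixes \<rho> :: "'w \<Rightarrow> real"
  assumes \<rho>m: "\<rho> \<in> borel_measurable M" and \<rho>_bound: "\<And>y. y \<in> K \<Longrightarrow> asymp_bound K \<T> \<rho> y"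
    and \<rho>_least: "\<And>c y. c \<in> borel_measurable M \<Longrightarrow> y \<in> K \<Longrightarrow> asymp_bound K \<T> c y \<Longrightarrow> AE w in M. \<rho> w \<le> c w"
begin

text \<open>The supremum of \<open>\<parallel>s z - y\<parallel>\<close> over \<open>z\<close> is itself an asymptotic bound, hence at least \<open>\<rho>\<close>. Gluing countably many
nearly optimal \<open>z\<close> is possible as \<open>s\<close>, being nonexpansive, respects the pieces.\<close>

lemma far_image:
  assumes y: "y \<in> K" and s: "s \<in> composites \<T>" and f[measurable]: "f \<in> borel_measurable M"
  shows "\<exists>z\<in>K. AE w in M. f w < \<rho> w \<longrightarrow> f w \<le> dst (s z) y w"
proof -
  have yc: "y \<in> carrier E" using y K_carrier by auto
  obtain u where u: "u \<in> borel_measurable M" "\<And>x. x \<in> K \<Longrightarrow> AE w in M. dst x y w \<le> u w"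
    using ccompact_bounded[OF K y] by blast
  have dm: "(\<lambda>w. ereal (dst (s z) y w)) \<in> borel_measurable M" if "z \<in> K" for z
    using composites_in_K[OF s that] K_carrier yc by (intro borel_measurable_ereal dst_measurable) auto
  obtain x where xK: "\<And>k::nat. x k \<in> K"
    and xsup: "\<And>z. z \<in> K \<Longrightarrow> AE w in M. ereal (dst (s z) y w) \<le> (SUP k. ereal (dst (s (x k)) y w))"
    using ess_sup_sequence[of K "\<lambda>z w. ereal (dst (s z) y w)", OF dm y] by blast
  have sxK: "s (x k) \<in> K" and sxc: "s (x k) \<in> carrier E" for k
    using composites_in_K[OF s xK] K_carrier by auto
  note [measurable] = dst_measurable[OF sxc yc]
  define g where "g w = real_of_ereal (SUP k. ereal (dst (s (x k)) y w))" for w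
  have g[measurable]: "g \<in> borel_measurable M" unfolding g_def by measurable
  have "AE w in M. \<forall>k. dst (s (x k)) y w \<le> u w"
    unfolding AE_all_countable using u(2) sxK by blast
  then have gS: "AE w in M. (SUP k. ereal (dst (s (x k)) y w)) = ereal (g w)"
  proof eventually_elim
    case (elim w)
    let ?S = "SUP k. ereal (dst (s (x k)) y w)"
    have "?S \<le> ereal (u w)" using elim by (intro SUP_least) auto
    moreover have "ereal (dst (s (x 0)) y w) \<le> ?S" by (rule SUP_upper) simp
    ultimately show ?case unfolding g_def by (cases ?S) auto
  qed
  have dg: "AE w in M. dst (s z) y w \<le> g w" if "z \<in> K" for z
    using xsup[OF that] gS by eventually_elim simp
  have "asymp_bound K \<T> g y" using dg by (rule asymp_bound_if_bounded[OF s])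
  then have \<rho>g: "AE w in M. \<rho> w \<le> g w" by (rule \<rho>_least[OF g y])
  define C where "C k = {w \<in> space M. f w < dst (s (x k)) y w}" for k
  have C: "C k \<in> sets M" for k unfolding C_def by measurable
  obtain z where z: "z \<in> K" and zx: "AE w in M. w \<in> (\<Union>k. C k) \<longrightarrow> (\<exists>k. w \<in> C k \<and> dst z (x k) w \<le> 0)"
    using ccompact_select[of K x C, OF K xK C] by blast
  have szc: "s z \<in> carrier E" using composites_in_K[OF s z] K_carrier by auto
  have "AE w in M. \<forall>k. dst (s z) (s (x k)) w \<le> dst z (x k) w"
    unfolding AE_all_countable using composites_nonexp[OF s] z xK by (simp add: nonexp_def)
  moreover have "AE w in M. \<forall>k. dst (s (x k)) y w \<le> dst (s (x k)) (s z) w + dst (s z) y w"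
    unfolding AE_all_countable using szc sxc yc by (intro allI AE_dst_triangle)
  moreover have "AE w in M. \<forall>k. dst (s (x k)) (s z) w = dst (s z) (s (x k)) w"
    unfolding AE_all_countable using szc sxc by (intro allI AE_dst_commute)
  ultimately have "AE w in M. f w < \<rho> w \<longrightarrow> f w \<le> dst (s z) y w"
    using zx \<rho>g gS AE_space
  proof eventually_elim
    case (elim w)
    have "f w \<le> dst (s z) y w" if "f w < \<rho> w"
    proof -
      have "ereal (f w) < (SUP k. ereal (dst (s (x k)) y w))" using elim that by simp
      then obtain k where "f w < dst (s (x k)) y w" by (auto simp: less_SUP_iff)
      then have "w \<in> (\<Union>k. C k)" using elim(7) by (auto simp: C_def)
      then obtain k where k: "w \<in> C k" "dst z (x k) w \<le> 0" using elim(4) by blast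
      then have "f w < dst (s (x k)) y w" by (simp add: C_def)
      then show ?thesis
        using k(2) elim(1)[rule_format, of k] elim(2)[rule_format, of k] elim(3)[rule_format, of k] by linarith
    qed
    then show ?case by blast
  qed
  then show ?thesis using z by blast
qed

text \<open>The upper estimates hold for all points of \<open>s K\<close> outside a small event once \<open>s\<close> is far enough in the directed family,
and \<open>far_image\<close> supplies a point of \<open>s K\<close> that also satisfies the lower one. A sequence of such points for errors
\<open>(1/2)^n\<close> is glued: almost every \<open>w\<close> with \<open>\<rho> w > 0\<close> lies in some event where the error is below \<open>e \<rho>\<close>.\<close>

lemma equidistant_point:
  assumes F: "finite F" "F \<subseteq> K" and b: "b \<in> K" and e: "e > 0"
  shows "\<exists>x\<in>K. AE w in M. \<rho> w > 0 \<longrightarrow>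
    (\<forall>y\<in>F. dst x y w \<le> (1 + e) * \<rho> w) \<and> (1 - e) * \<rho> w \<le> dst x b w"
proof -
  note [measurable] = \<rho>m
  define P where "P n s A \<longleftrightarrow> s \<in> composites \<T> \<and> A \<in> sets M \<and> prob A > 1 - (1/2)^n \<and>
    (\<forall>y\<in>F. \<forall>z\<in>K. AE w in M. w \<in> A \<longrightarrow> dst (s z) y w \<le> \<rho> w + (1/2)^n)" for n :: nat and s A
  have "\<exists>s A. P n s A" for n :: nat
    using asymp_bound_common[of F "\<lambda>_. \<rho>" "\<lambda>y. y" "(1/2)^n"] F \<rho>_bound unfolding P_def by fastforce
  then obtain s A where "\<And>n. P n (s n) (A n)" by metis
  then have s: "\<And>n. s n \<in> composites \<T>" and A: "\<And>n. A n \<in> sets M" "\<And>n. prob (A n) > 1 - (1/2)^n"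
    and sA: "\<And>n y z. y \<in> F \<Longrightarrow> z \<in> K \<Longrightarrow> AE w in M. w \<in> A n \<longrightarrow> dst (s n z) y w \<le> \<rho> w + (1/2)^n"
    unfolding P_def by simp_all
  note [measurable] = A(1)
  have "\<exists>z\<in>K. AE w in M. (1 - e) * \<rho> w < \<rho> w \<longrightarrow> (1 - e) * \<rho> w \<le> dst (s n z) b w" for n
    by (rule far_image[OF b s]) measurable
  then have "\<forall>n. \<exists>z. z \<in> K \<and> (AE w in M. (1 - e) * \<rho> w < \<rho> w \<longrightarrow> (1 - e) * \<rho> w \<le> dst (s n z) b w)" by blast
  from choice[OF this] obtain z where z: "\<And>n. z n \<in> K"
    "\<And>n. AE w in M. (1 - e) * \<rho> w < \<rho> w \<longrightarrow> (1 - e) * \<rho> w \<le> dst (s n (z n)) b w" by blast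
  define x where "x n = s n (z n)" for n
  have xK: "x n \<in> K" for n unfolding x_def using composites_in_K[OF s z(1)] .
  have xc: "x n \<in> carrier E" for n using xK K_carrier by auto
  define C where "C n = {w \<in> A n. (1/2)^n \<le> e * \<rho> w}" for n
  have C: "C n \<in> sets M" for n
  proof -
    have "C n = A n \<inter> {w \<in> space M. (1/2)^n \<le> e * \<rho> w}"
      using sets.sets_into_space[OF A(1)] by (auto simp: C_def)
    then show ?thesis by simp
  qed
  have "AE w in M. eventually (\<lambda>n. w \<in> space M - (space M - A n)) sequentially"
  proof (rule borel_cantelli_AE1)
    have "prob (space M - A n) \<le> (1/2)^n" for n using A(2)[of n] by (simp add: prob_compl)
    then show "summable (\<lambda>n. prob (space M - A n))"
      by (intro summable_comparison_test[OF _ summable_geometric[of "1/2::real"]]) auto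
  qed (auto simp: emeasure_eq_measure)
  then have cover: "AE w in M. \<rho> w > 0 \<longrightarrow> w \<in> (\<Union>n. C n)"
  proof eventually_elim
    case (elim w)
    have "w \<in> (\<Union>n. C n)" if "\<rho> w > 0"
    proof -
      have "\<forall>\<^sub>F n in sequentially. (1/2::real)^n < e * \<rho> w"
        using e that by (intro order_tendstoD[OF LIMSEQ_realpow_zero[of "1/2"]]) auto
      with elim have "\<forall>\<^sub>F n in sequentially. w \<in> C n" by eventually_elim (auto simp: C_def)
      then show ?thesis by (auto simp: eventually_sequentially)
    qed
    then show ?case by blast
  qed
  obtain v where v: "v \<in> K" and vx: "AE w in M. w \<in> (\<Union>n. C n) \<longrightarrow> (\<exists>n. w \<in> C n \<and> dst v (x n) w \<le> 0)"
    using ccompact_select[of K x C, OF K xK C] by blast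
  have vc: "v \<in> carrier E" and bc: "b \<in> carrier E" using v b K_carrier by auto
  have Fc: "y \<in> carrier E" if "y \<in> F" for y using that F K_carrier by auto
  have "AE w in M. \<forall>y\<in>F. \<forall>n. w \<in> A n \<longrightarrow> dst (x n) y w \<le> \<rho> w + (1/2)^n"
    using F sA z(1) by (subst AE_ball_countable) (auto simp: countable_finite AE_all_countable x_def)
  moreover have "AE w in M. \<forall>y\<in>F. \<forall>n. dst v y w \<le> dst v (x n) w + dst (x n) y w"
    using F vc xc Fc by (subst AE_ball_countable) (auto simp: countable_finite AE_all_countable intro!: AE_dst_triangle)
  moreover have "AE w in M. \<forall>n. dst (x n) b w \<le> dst (x n) v w + dst v b w"
    unfolding AE_all_countable using xc vc bc by (intro allI AE_dst_triangle)
  moreover have "AE w in M. \<forall>n. dst (x n) v w = dst v (x n) w"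
    unfolding AE_all_countable using xc vc by (intro allI AE_dst_commute)
  moreover have "AE w in M. \<forall>n. (1 - e) * \<rho> w < \<rho> w \<longrightarrow> (1 - e) * \<rho> w \<le> dst (x n) b w"
    unfolding AE_all_countable x_def using z(2) by blast
  ultimately have "AE w in M. \<rho> w > 0 \<longrightarrow>
    (\<forall>y\<in>F. dst v y w \<le> (1 + e) * \<rho> w) \<and> (1 - e) * \<rho> w \<le> dst v b w"
    using cover vx
  proof eventually_elim
    case (elim w)
    have "(\<forall>y\<in>F. dst v y w \<le> (1 + e) * \<rho> w) \<and> (1 - e) * \<rho> w \<le> dst v b w" if pos: "\<rho> w > 0"
    proof -
      obtain n where n: "w \<in> C n" "dst v (x n) w \<le> 0" using elim(6,7) pos by blast
      then have n': "w \<in> A n" "(1/2)^n \<le> e * \<rho> w" by (auto simp: C_def)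
      have "dst v y w \<le> (1 + e) * \<rho> w" if "y \<in> F" for y
      proof -
        have "dst (x n) y w \<le> \<rho> w + (1/2)^n" "dst v y w \<le> dst v (x n) w + dst (x n) y w"
          using elim(1,2) that n'(1) by blast+
        moreover have "(1 + e) * \<rho> w = \<rho> w + e * \<rho> w" by (simp add: algebra_simps)
        ultimately show ?thesis using n(2) n'(2) by linarith
      qed
      moreover have "(1 - e) * \<rho> w < \<rho> w" using pos e by (simp add: algebra_simps)
      then have "(1 - e) * \<rho> w \<le> dst (x n) b w" using elim(5) by blast
      then have "(1 - e) * \<rho> w \<le> dst v b w"
        using n(2) elim(3)[rule_format, of n] elim(4)[rule_format, of n] by linarith
      ultimately show ?thesis by blast
    qed
    then show ?case by blast
  qed
  then show ?thesis using v by blast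
qed

end
end
end

section \<open>A diametral set\<close>

lemma rebracket_weight_bounds:
  fixes k :: real
  assumes "0 < k" "k \<le> 1"
  shows "0 \<le> 1/2 * (1 - k) / (1 - 1/2 * k)" "1/2 * (1 - k) / (1 - 1/2 * k) \<le> 1"
  using assms by (auto simp: divide_simps)

lemma split_weight_bounds:
  fixes k :: real
  assumes "0 < k" "k \<le> 1/2"
  shows "0 \<le> (1/2 - k) / (1 - k)" "(1/2 - k) / (1 - k) \<le> 1"
  using assms by (auto simp: divide_simps)

context rn_module
begin

definition AE_closure :: "'e set \<Rightarrow> 'e set" where
  "AE_closure U = {y \<in> carrier E. \<exists>u. (\<forall>k::nat. u k \<in> U) \<and> (AE w in M. (\<lambda>k. dst (u k) y w) \<longlonglongrightarrow> 0)}"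

lemma AE_closure_superset: "U \<subseteq> carrier E \<Longrightarrow> U \<subseteq> AE_closure U"
proof
  fix x assume U: "U \<subseteq> carrier E" and x: "x \<in> U"
  then have "AE w in M. dst x x w = 0" by (intro AE_dst_self) auto
  then have "AE w in M. (\<lambda>k::nat. dst x x w) \<longlonglongrightarrow> 0" by eventually_elim simp
  then show "x \<in> AE_closure U" using x U by (auto simp: AE_closure_def intro!: exI[of _ "\<lambda>_. x"])
qed

lemma AE_closure_least: "closed_convex V \<Longrightarrow> U \<subseteq> V \<Longrightarrow> AE_closure U \<subseteq> V"
proof
  fix y assume V: "closed_convex V" "U \<subseteq> V" and "y \<in> AE_closure U"
  then obtain u where "\<And>k::nat. u k \<in> U" "y \<in> carrier E" "AE w in M. (\<lambda>k. dst (u k) y w) \<longlonglongrightarrow> 0"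
    by (auto simp: AE_closure_def)
  then show "y \<in> V" using V(2) by (metis closed_convex_limit[OF V(1), of u y] subsetD)
qed

text \<open>By a diagonal argument.\<close>

lemma closed_convex_AE_closure:
  assumes U: "U \<subseteq> carrier E"
    and conv: "\<And>x y f. x \<in> U \<Longrightarrow> y \<in> U \<Longrightarrow> f \<in> borel_measurable M \<Longrightarrow> (\<And>w. 0 \<le> f w) \<Longrightarrow> (\<And>w. f w \<le> 1) \<Longrightarrow> cmb f x y \<in> U"
  shows "closed_convex (AE_closure U)"
proof (rule ccsetI)
  show "AE_closure U \<subseteq> carrier E" by (auto simp: AE_closure_def)
next
  fix s y assume s: "\<And>k::nat. s k \<in> AE_closure U" and y: "y \<in> carrier E" and lim: "AE w in M. (\<lambda>k. dst (s k) y w) \<longlonglongrightarrow> 0"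
  have sc: "s k \<in> carrier E" for k using s by (auto simp: AE_closure_def)
  have "\<exists>v. v \<in> U \<and> prob {w \<in> space M. dst v (s k) w < (1/2)^k} > 1 - (1/2)^k" for k
  proof -
    obtain u where u: "\<And>j::nat. u j \<in> U" "AE w in M. (\<lambda>j. dst (u j) (s k) w) \<longlonglongrightarrow> 0"
      using s[of k] by (auto simp: AE_closure_def)
    have "u j \<in> carrier E" for j using u(1) U by auto
    then have "\<exists>j. prob {w \<in> space M. dst (u j) (s k) w < (1/2)^k} > 1 - (1/2)^k"
      using sc by (intro AE_tendsto_imp_prob[OF _ u(2)]) auto
    then show ?thesis using u(1) by blast
  qed
  then obtain v where v: "\<And>k. v k \<in> U" "\<And>k. prob {w \<in> space M. dst (v k) (s k) w < (1/2)^k} > 1 - (1/2)^k"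
    by metis
  have vc: "v k \<in> carrier E" for k using v(1) U by auto
  have "AE w in M. (\<lambda>k. dst (v k) (s k) w) \<longlonglongrightarrow> 0"
    using vc sc v(2) by (intro AE_tendsto_if_prob_fast AE_dst_nonneg dst_measurable)
  moreover have "AE w in M. \<forall>k. dst (v k) y w \<le> dst (v k) (s k) w + dst (s k) y w"
    unfolding AE_all_countable using vc sc y by (intro allI AE_dst_triangle)
  moreover have "AE w in M. \<forall>k. 0 \<le> dst (v k) y w"
    unfolding AE_all_countable using vc y by (intro allI AE_dst_nonneg)
  ultimately have "AE w in M. (\<lambda>k. dst (v k) y w) \<longlonglongrightarrow> 0"
    using lim
  proof eventually_elim
    case (elim w)
    have L: "(\<lambda>k. dst (v k) (s k) w + dst (s k) y w) \<longlonglongrightarrow> 0"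
      using tendsto_add[OF elim(1,4)] by simp
    show ?case
      by (rule tendsto_sandwich[OF _ _ tendsto_const L]) (use elim(2,3) in simp_all)
  qed
  then show "y \<in> AE_closure U" using v(1) y by (auto simp: AE_closure_def)
next
  fix x y and f :: "'w \<Rightarrow> real" assume x: "x \<in> AE_closure U" and y: "y \<in> AE_closure U"
    and f: "f \<in> borel_measurable M" "\<And>w. 0 \<le> f w" "\<And>w. f w \<le> 1"
  obtain u where u: "\<And>k::nat. u k \<in> U" "AE w in M. (\<lambda>k. dst (u k) x w) \<longlonglongrightarrow> 0"
    using x by (auto simp: AE_closure_def)
  obtain v where v: "\<And>k::nat. v k \<in> U" "AE w in M. (\<lambda>k. dst (v k) y w) \<longlonglongrightarrow> 0"
    using y by (auto simp: AE_closure_def)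
  have c: "x \<in> carrier E" "y \<in> carrier E" "u k \<in> carrier E" "v k \<in> carrier E" for k
    using x y u v U by (auto simp: AE_closure_def)
  have cc: "cmb f x y \<in> carrier E" "cmb f (u k) (v k) \<in> carrier E" for k
    using c f by (auto intro: cmb_closed)
  have "AE w in M. \<forall>k. dst (cmb f (u k) (v k)) (cmb f x y) w \<le> \<bar>f w\<bar> * dst (u k) x w + \<bar>1 - f w\<bar> * dst (v k) y w"
    unfolding AE_all_countable using f c by (intro allI AE_dst_cmb)
  moreover have "AE w in M. \<forall>k. 0 \<le> dst (cmb f (u k) (v k)) (cmb f x y) w"
    unfolding AE_all_countable using cc by (intro allI AE_dst_nonneg)
  ultimately have "AE w in M. (\<lambda>k. dst (cmb f (u k) (v k)) (cmb f x y) w) \<longlonglongrightarrow> 0"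
    using u(2) v(2)
  proof eventually_elim
    case (elim w)
    have "(\<lambda>k. \<bar>f w\<bar> * dst (u k) x w + \<bar>1 - f w\<bar> * dst (v k) y w) \<longlonglongrightarrow> \<bar>f w\<bar> * 0 + \<bar>1 - f w\<bar> * 0"
      using elim(3,4) by (intro tendsto_intros)
    then have L: "(\<lambda>k. \<bar>f w\<bar> * dst (u k) x w + \<bar>1 - f w\<bar> * dst (v k) y w) \<longlonglongrightarrow> 0" by simp
    show ?case
      by (rule tendsto_sandwich[OF _ _ tendsto_const L]) (use elim(1,2) in simp_all)
  qed
  moreover have "cmb f (u k) (v k) \<in> U" for k using conv u(1) v(1) f by blast
  ultimately show "cmb f x y \<in> AE_closure U" using cc by (auto simp: AE_closure_def intro!: exI[of _ "\<lambda>k. cmb f (u k) (v k)"])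
qed

context
  fixes K :: "'e set" and \<rho> :: "'w \<Rightarrow> real" and p :: 'e
  assumes K: "ccompact K" and p: "p \<in> K" and \<rho>m: "\<rho> \<in> borel_measurable M"
    and equidist: "\<And>F b e. finite F \<Longrightarrow> F \<subseteq> K \<Longrightarrow> b \<in> K \<Longrightarrow> e > 0 \<Longrightarrow>
      \<exists>x\<in>K. AE w in M. \<rho> w > 0 \<longrightarrow> (\<forall>y\<in>F. dst x y w \<le> (1 + e) * \<rho> w) \<and> (1 - e) * \<rho> w \<le> dst x b w"
begin

text \<open>A margin to the sphere of radius \<open>\<rho>\<close> around \<open>p\<close>. It is the room needed to turn the approximate upper bound
\<open>(1 + \<epsilon>) \<rho>\<close> for later points into the exact bound \<open>\<rho>\<close>.\<close>

definition inside :: "'e \<Rightarrow> bool" where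
  "inside y \<longleftrightarrow> (\<exists>\<tau>>0. AE w in M. \<rho> w > 0 \<longrightarrow> dst y p w \<le> (1 - \<tau>) * \<rho> w)"

lemma Kc: "x \<in> K \<Longrightarrow> x \<in> carrier E"
  using closed_convex_carrier[OF ccompact_closed_convex[OF K]] .

lemma inside_finite:
  assumes "finite F" "\<And>y. y \<in> F \<Longrightarrow> inside y"
  shows "\<exists>\<tau>>0. \<tau> \<le> 1 \<and> (AE w in M. \<rho> w > 0 \<longrightarrow> (\<forall>y\<in>F. dst y p w \<le> (1 - \<tau>) * \<rho> w))"
  using assms
proof (induction F rule: finite_induct)
  case empty
  then show ?case by (intro exI[of _ 1]) auto
next
  case (insert y F)
  obtain \<tau> where t: "\<tau> > 0" "\<tau> \<le> 1" "AE w in M. \<rho> w > 0 \<longrightarrow> (\<forall>y\<in>F. dst y p w \<le> (1 - \<tau>) * \<rho> w)"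
    using insert by auto
  obtain \<tau>' where t': "\<tau>' > 0" "AE w in M. \<rho> w > 0 \<longrightarrow> dst y p w \<le> (1 - \<tau>') * \<rho> w"
    using insert.prems[of y] by (auto simp: inside_def)
  have "AE w in M. \<rho> w > 0 \<longrightarrow> (\<forall>y\<in>insert y F. dst y p w \<le> (1 - min \<tau> \<tau>') * \<rho> w)"
    using t(3) t'(2)
  proof eventually_elim
    case (elim w)
    have "(1 - \<tau>) * \<rho> w \<le> (1 - min \<tau> \<tau>') * \<rho> w" "(1 - \<tau>') * \<rho> w \<le> (1 - min \<tau> \<tau>') * \<rho> w" if "\<rho> w > 0"
      using that by (auto intro!: mult_right_mono)
    then show ?case using elim by (auto intro: order_trans)
  qed
  then show ?case using t t' by (intro exI[of _ "min \<tau> \<tau>'"]) auto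
qed

text \<open>Move the point \<open>x\<close> of the hypothesis \<open>equidist\<close> towards \<open>p\<close> by a small fraction \<open>l\<close>. Since \<open>p\<close> is closer than \<open>(1 - \<tau>) \<rho>\<close>
to the points of \<open>F\<close>, this lowers the distances to \<open>F\<close> by about \<open>l \<tau> \<rho>\<close>, enough to absorb the error \<open>\<epsilon> \<rho>\<close>; the new
point is again well inside, with margin \<open>l / 2\<close>, and the lower bound suffers by at most \<open>3 l \<rho>\<close>.\<close>

lemma shrunk_point:
  assumes F: "finite F" "F \<subseteq> K" "\<And>y. y \<in> F \<Longrightarrow> inside y" and b: "b \<in> K" and e: "\<eta> > 0"
  shows "\<exists>z\<in>K. inside z \<and> (AE w in M. \<rho> w > 0 \<longrightarrow> (\<forall>y\<in>F. dst z y w \<le> \<rho> w) \<and> (1 - \<eta>) * \<rho> w \<le> dst z b w)"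
proof -
  obtain \<tau> where t: "\<tau> > 0" "\<tau> \<le> 1" "AE w in M. \<rho> w > 0 \<longrightarrow> (\<forall>y\<in>F. dst y p w \<le> (1 - \<tau>) * \<rho> w)"
    using inside_finite[OF F(1,3)] by blast
  define l where "l = min (\<eta> / 3) (1/2)"
  have l: "0 < l" "l \<le> 1/2" "3 * l \<le> \<eta>" using e by (auto simp: l_def)
  define \<epsilon> where "\<epsilon> = l * \<tau> / 2"
  have eps: "\<epsilon> > 0" "\<epsilon> \<le> l / 2" using l t mult_left_mono[of \<tau> 1 l] by (auto simp: \<epsilon>_def)
  obtain x where x: "x \<in> K" "AE w in M. \<rho> w > 0 \<longrightarrow>
      (\<forall>y\<in>insert p F. dst x y w \<le> (1 + \<epsilon>) * \<rho> w) \<and> (1 - \<epsilon>) * \<rho> w \<le> dst x b w"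
    using equidist[of "insert p F" b \<epsilon>] F p b eps by auto
  define z where "z = cmb (\<lambda>_. l) p x"
  have zK: "z \<in> K" unfolding z_def using l p x by (intro closed_convex_cmb_const[OF ccompact_closed_convex[OF K]]) auto
  have c: "p \<in> carrier E" "x \<in> carrier E" "z \<in> carrier E" "b \<in> carrier E" using p x zK b Kc by auto
  have zle: "AE w in M. dst z y w \<le> l * dst p y w + (1 - l) * dst x y w" if "y \<in> carrier E" for y
    unfolding z_def using l c that by (intro AE_dst_cmb_point) auto
  have Fz: "AE w in M. \<forall>y\<in>F. dst z y w \<le> l * dst p y w + (1 - l) * dst x y w"
    using F zle Kc by (subst AE_ball_countable) (auto simp: countable_finite)
  have Fs: "AE w in M. \<forall>y\<in>F. dst p y w = dst y p w"
    using F c Kc by (subst AE_ball_countable) (auto simp: countable_finite intro!: AE_dst_commute)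
  have "AE w in M. \<rho> w > 0 \<longrightarrow> dst z p w \<le> (1 - l / 2) * \<rho> w"
    using zle[OF c(1)] AE_dst_self[OF c(1)] x(2)
  proof eventually_elim
    case (elim w)
    have "dst z p w \<le> (1 - l / 2) * \<rho> w" if pos: "\<rho> w > 0"
    proof -
      have "(1 - l) * dst x p w \<le> (1 - l) * ((1 + \<epsilon>) * \<rho> w)" using elim(3) pos l by (intro mult_left_mono) auto
      also have "\<dots> = ((1 - l) * (1 + \<epsilon>)) * \<rho> w" by simp
      also have "\<dots> \<le> (1 - l / 2) * \<rho> w"
      proof (rule mult_right_mono)
        have "0 \<le> l * \<epsilon>" using l eps by simp
        moreover have "(1 - l) * (1 + \<epsilon>) = 1 - l + \<epsilon> - l * \<epsilon>" by (simp add: algebra_simps)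
        ultimately show "(1 - l) * (1 + \<epsilon>) \<le> 1 - l / 2" using eps by linarith
      qed (use pos in simp)
      finally show ?thesis using elim(1,2) by simp
    qed
    then show ?case by blast
  qed
  then have inside_z: "inside z" unfolding inside_def using l by (intro exI[of _ "l / 2"]) auto
  have "AE w in M. \<rho> w > 0 \<longrightarrow> (\<forall>y\<in>F. dst z y w \<le> \<rho> w) \<and> (1 - \<eta>) * \<rho> w \<le> dst z b w"
    using Fz Fs t(3) x(2) zle[OF c(2)] AE_dst_self[OF c(2)] AE_dst_commute[OF c(1,2)]
      AE_dst_commute[OF c(2,3)] AE_dst_triangle[OF c(2,3,4)]
  proof eventually_elim
    case (elim w)
    have "(\<forall>y\<in>F. dst z y w \<le> \<rho> w) \<and> (1 - \<eta>) * \<rho> w \<le> dst z b w" if pos: "\<rho> w > 0"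
    proof
      show "\<forall>y\<in>F. dst z y w \<le> \<rho> w"
      proof
        fix y assume y: "y \<in> F"
        have "dst z y w \<le> l * ((1 - \<tau>) * \<rho> w) + (1 - l) * ((1 + \<epsilon>) * \<rho> w)"
        proof -
          have "l * dst p y w \<le> l * ((1 - \<tau>) * \<rho> w)" using elim(2,3) y pos l by (intro mult_left_mono) auto
          moreover have "(1 - l) * dst x y w \<le> (1 - l) * ((1 + \<epsilon>) * \<rho> w)"
            using elim(4) y pos l by (intro mult_left_mono) auto
          ultimately show ?thesis using elim(1) y by fastforce
        qed
        also have "\<dots> = (l * (1 - \<tau>) + (1 - l) * (1 + \<epsilon>)) * \<rho> w" by (simp add: algebra_simps)
        also have "\<dots> \<le> 1 * \<rho> w"
        proof (rule mult_right_mono)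
          have "0 \<le> l * \<epsilon>" "0 \<le> l * \<tau>" using l eps t by auto
          then show "l * (1 - \<tau>) + (1 - l) * (1 + \<epsilon>) \<le> 1" by (simp add: algebra_simps \<epsilon>_def)
        qed (use pos in simp)
        finally show "dst z y w \<le> \<rho> w" by simp
      qed
      have "dst z x w \<le> l * dst x p w" using elim(5,6,7) by simp
      also have "\<dots> \<le> l * ((1 + \<epsilon>) * \<rho> w)" using elim(4) pos l by (intro mult_left_mono) auto
      finally have "dst x z w \<le> l * ((1 + \<epsilon>) * \<rho> w)" using elim(8) by simp
      then have "(1 - \<epsilon>) * \<rho> w - l * ((1 + \<epsilon>) * \<rho> w) \<le> dst z b w" using elim(4,9) pos by fastforce
      moreover have "(1 - \<eta>) * \<rho> w \<le> ((1 - \<epsilon>) - l * (1 + \<epsilon>)) * \<rho> w"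
      proof (rule mult_right_mono)
        have "l * \<epsilon> \<le> l * 1" using l eps by (intro mult_left_mono) auto
        moreover have "(1 - \<epsilon>) - l * (1 + \<epsilon>) = 1 - \<epsilon> - l - l * \<epsilon>" by (simp add: algebra_simps)
        ultimately show "1 - \<eta> \<le> (1 - \<epsilon>) - l * (1 + \<epsilon>)" using eps l by linarith
      qed (use pos in simp)
      ultimately show "(1 - \<eta>) * \<rho> w \<le> dst z b w" by (simp add: algebra_simps)
    qed
    then show ?case by blast
  qed
  then show ?thesis using zK inside_z by blast
qed

text \<open>The point \<open>b n\<close> is a dyadic barycenter of \<open>F n\<close>, each point of \<open>F n\<close> having weight at least \<open>(1/2)^n\<close> in it. The error
\<open>(1/4)^(Suc n)\<close> is small even after division by this weight.\<close>

lemma diametral_sequence: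
  obtains F :: "nat \<Rightarrow> 'e set" and b z :: "nat \<Rightarrow> 'e"
  where "F 0 = {p}" "b 0 = p" "\<And>n. F (Suc n) = insert (z n) (F n)" "\<And>n. b (Suc n) = cmb (\<lambda>_. 1/2) (b n) (z n)"
    "\<And>n. F n \<subseteq> K" "\<And>n. b n \<in> K" "\<And>n. z n \<in> K"
    "\<And>n. AE w in M. \<rho> w > 0 \<longrightarrow> (\<forall>y\<in>F n. dst (z n) y w \<le> \<rho> w) \<and> (1 - (1/4)^(Suc n)) * \<rho> w \<le> dst (z n) (b n) w"
proof -
  define R where "R n F b z \<longleftrightarrow> z \<in> K \<and> inside z \<and>
    (AE w in M. \<rho> w > 0 \<longrightarrow> (\<forall>y\<in>F. dst z y w \<le> \<rho> w) \<and> (1 - (1/4)^(Suc n)) * \<rho> w \<le> dst z b w)" for n F b z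
  define P where "P = (\<lambda>(n::nat) (F, b). finite F \<and> F \<subseteq> K \<and> (\<forall>y\<in>F. inside y) \<and> b \<in> K \<and> (n = 0 \<longrightarrow> F = {p} \<and> b = p))"
  define Q where "Q = (\<lambda>n (F, b) (F', b'). \<exists>z. R n F b z \<and> F' = insert z F \<and> b' = cmb (\<lambda>_. 1/2) b z)"
  have "AE w in M. \<rho> w > 0 \<longrightarrow> dst p p w \<le> (1 - 1) * \<rho> w"
    using AE_dst_self[of p] p Kc by auto
  then have ip: "inside p" unfolding inside_def by (intro exI[of _ 1]) auto
  have 0: "P 0 ({p}, p)" using p ip by (simp add: P_def)
  have step: "\<exists>s'. P (Suc n) s' \<and> Q n s s'" if Ps: "P n s" for n s
  proof -
    obtain F b where s: "s = (F, b)" by fastforce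
    have F: "finite F" "F \<subseteq> K" "\<And>y. y \<in> F \<Longrightarrow> inside y" "b \<in> K" using Ps by (auto simp: P_def s)
    obtain z where z: "R n F b z" using shrunk_point[OF F, of "(1/4)^(Suc n)"] unfolding R_def by auto
    have zK: "z \<in> K" "inside z" using z by (auto simp: R_def)
    have "cmb (\<lambda>_. 1/2) b z \<in> K" using F zK by (intro closed_convex_cmb_const[OF ccompact_closed_convex[OF K]]) auto
    then have "P (Suc n) (insert z F, cmb (\<lambda>_. 1/2) b z)" using F zK by (auto simp: P_def)
    moreover have "Q n s (insert z F, cmb (\<lambda>_. 1/2) b z)" using z by (auto simp: Q_def s)
    ultimately show ?thesis by blast
  qed
  have "\<exists>f. \<forall>n. P n (f n) \<and> Q n (f n) (f (Suc n))"
    by (rule dependent_nat_choice) (use 0 step in blast)+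
  then obtain f where f: "\<And>n. P n (f n)" "\<And>n. Q n (f n) (f (Suc n))" by blast
  define F where "F n = fst (f n)" for n
  define b where "b n = snd (f n)" for n
  have fe: "f n = (F n, b n)" for n by (simp add: F_def b_def)
  have "\<exists>z. R n (F n) (b n) z \<and> F (Suc n) = insert z (F n) \<and> b (Suc n) = cmb (\<lambda>_. 1/2) (b n) z" for n
    using f(2)[of n] by (simp add: Q_def fe)
  then obtain z where z: "\<And>n. R n (F n) (b n) (z n)" "\<And>n. F (Suc n) = insert (z n) (F n)"
    "\<And>n. b (Suc n) = cmb (\<lambda>_. 1/2) (b n) (z n)" by metis
  show ?thesis
  proof (rule that[of F b z])
    show "F 0 = {p}" "b 0 = p" using f(1)[of 0] by (auto simp: P_def fe)
    show "F n \<subseteq> K" "b n \<in> K" for n using f(1)[of n] by (auto simp: P_def fe)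
    show "z n \<in> K" for n using z(1)[of n] by (simp add: R_def)
    show "AE w in M. \<rho> w > 0 \<longrightarrow> (\<forall>y\<in>F n. dst (z n) y w \<le> \<rho> w) \<and> (1 - (1/4)^(Suc n)) * \<rho> w \<le> dst (z n) (b n) w" for n
      using z(1)[of n] unfolding R_def by blast
  qed (use z in auto)
qed

text \<open>Let \<open>N\<close> be a closed convex set of diameter at most \<open>\<rho>\<close> containing the sequence. If \<open>b n = k y + (1 - k) y'\<close> with \<open>y, y'\<close> in
\<open>N\<close> and \<open>k = (1/2)^n\<close>, then \<open>\<parallel>z n - b n\<parallel> \<ge> (1 - k\<^sup>2) \<rho>\<close> and \<open>\<parallel>z n - y'\<parallel> \<le> \<rho>\<close> imply \<open>\<parallel>z n - y\<parallel> \<ge> (1 - k) \<rho>\<close>. The set \<open>S n\<close> of all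
such \<open>y\<close> is convex and grows with \<open>n\<close>, and it contains \<open>z i\<close> for \<open>i < n\<close>. Thus every point of the closure of the
union of these sets has radius \<open>\<rho>\<close>.\<close>

lemma diametral_set:
  obtains H and z :: "nat \<Rightarrow> 'e" where "H \<subseteq> K" "closed_convex H" "\<And>n. z n \<in> H"
    "\<And>x y. x \<in> H \<Longrightarrow> y \<in> H \<Longrightarrow> AE w in M. \<rho> w > 0 \<longrightarrow> dst x y w \<le> \<rho> w"
    "\<And>y. y \<in> H \<Longrightarrow> AE w in M. \<rho> w > 0 \<longrightarrow> (\<forall>\<delta>>0. \<exists>n. \<rho> w - \<delta> < dst (z n) y w)"
proof -
  note ccK = ccompact_closed_convex[OF K]
  obtain F b z where F0: "F 0 = {p}" and b0: "b 0 = p" and F_Suc: "\<And>n. F (Suc n) = insert (z n) (F n)"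
    and b_Suc: "\<And>n. b (Suc n) = cmb (\<lambda>_. 1/2) (b n) (z n)"
    and FK: "\<And>n::nat. F n \<subseteq> K" and bK: "\<And>n. b n \<in> K" and zK: "\<And>n. z n \<in> K"
    and far: "\<And>n. AE w in M. \<rho> w > 0 \<longrightarrow> (\<forall>y\<in>F n. dst (z n) y w \<le> \<rho> w) \<and>
      (1 - (1/4)^(Suc n)) * \<rho> w \<le> dst (z n) (b n) w"
    using diametral_sequence by blast
  have diamF: "AE w in M. \<rho> w > 0 \<longrightarrow> dst x y w \<le> \<rho> w" if "x \<in> F n" "y \<in> F n" for n x y
    using that
  proof (induction n arbitrary: x y)
    case 0
    then have "x = p" "y = p" using F0 by auto
    then show ?case using AE_dst_self[of p] Kc[OF p] by auto
  next
    case (Suc n)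
    have zy: "AE w in M. \<rho> w > 0 \<longrightarrow> dst (z n) v w \<le> \<rho> w" if "v \<in> F n" for v
      using far[of n] by eventually_elim (use that in auto)
    have yz: "AE w in M. \<rho> w > 0 \<longrightarrow> dst v (z n) w \<le> \<rho> w" if "v \<in> F n" for v
      using zy[OF that] AE_dst_commute[of v "z n"] that FK zK Kc by fastforce
    have zz: "AE w in M. \<rho> w > 0 \<longrightarrow> dst (z n) (z n) w \<le> \<rho> w"
      using AE_dst_self[OF Kc[OF zK[of n]]] by eventually_elim auto
    show ?case using Suc zy yz zz unfolding F_Suc by blast
  qed
  define X where "X = (\<Union>n. F n)"
  have Fmono: "F m \<subseteq> F n" if "m \<le> n" for m n
    by (rule lift_Suc_mono_le[of F, OF _ that]) (auto simp: F_Suc)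
  have XK: "X \<subseteq> K" using FK by (auto simp: X_def)
  have diamX: "AE w in M. \<rho> w > 0 \<longrightarrow> dst x y w \<le> \<rho> w" if xy: "x \<in> X" "y \<in> X" for x y
  proof -
    obtain m n where "x \<in> F m" "y \<in> F n" using xy by (auto simp: X_def)
    then have "x \<in> F (max m n)" "y \<in> F (max m n)" using Fmono[of m "max m n"] Fmono[of n "max m n"] by auto
    then show ?thesis by (rule diamF)
  qed
  let ?B = "{w. \<rho> w > 0}"
  define ball where "ball q = {y \<in> K. AE w in M. w \<in> ?B \<longrightarrow> dst y q w \<le> \<rho> w}" for q
  have cball: "closed_convex (ball q)" if "q \<in> K" for q
    unfolding ball_def using ccK Kc[OF that] by (rule closed_convex_ball)
  \<comment> \<open>points within distance rho of the sequence may be up to 2 rho apart; intersecting once more with the balls around all of them leaves a set of diameter at most rho that still contains the sequence\<close>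
  define N0 where "N0 = (\<Inter>x\<in>X. ball x)"
  have Xne: "p \<in> X" using F0 by (auto simp: X_def)
  have N0K: "N0 \<subseteq> K" using Xne by (auto simp: N0_def ball_def)
  have XN0: "X \<subseteq> N0" using XK diamX by (auto simp: N0_def ball_def)
  define N where "N = N0 \<inter> (\<Inter>x\<in>N0. ball x)"
  have "closed_convex N0" unfolding N0_def using Xne XK cball by (intro closed_convex_Inter) auto
  moreover have "closed_convex (\<Inter>x\<in>N0. ball x)" using XN0 Xne N0K cball by (intro closed_convex_Inter) auto
  ultimately have ccN: "closed_convex N" using closed_convex_Inter[of "{N0, \<Inter>x\<in>N0. ball x}"] by (auto simp: N_def)
  have NK: "N \<subseteq> K" using N0K by (auto simp: N_def)
  have Nc: "x \<in> N \<Longrightarrow> x \<in> carrier E" for x using NK Kc by auto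
  have XN: "X \<subseteq> N"
  proof
    fix x assume x: "x \<in> X"
    have "x \<in> ball y" if y: "y \<in> N0" for y
    proof -
      have "AE w in M. \<rho> w > 0 \<longrightarrow> dst y x w \<le> \<rho> w" using y x by (auto simp: N0_def ball_def)
      moreover have "AE w in M. dst x y w = dst y x w"
        using x y XK N0K Kc by (intro AE_dst_commute) auto
      ultimately have "AE w in M. \<rho> w > 0 \<longrightarrow> dst x y w \<le> \<rho> w" by eventually_elim auto
      then show ?thesis using x XK by (auto simp: ball_def)
    qed
    then show "x \<in> N" using x XN0 by (auto simp: N_def)
  qed
  have diamN: "AE w in M. \<rho> w > 0 \<longrightarrow> dst x y w \<le> \<rho> w" if "x \<in> N" "y \<in> N" for x y
    using that by (auto simp: N_def ball_def)
  have zX: "z n \<in> X" for n using F_Suc[of n] by (auto simp: X_def)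
  have bN: "b n \<in> N" for n
  proof (induction n)
    case 0
    then show ?case using b0 Xne XN by auto
  next
    case (Suc n)
    then show ?case unfolding b_Suc using zX XN by (intro closed_convex_cmb_const[OF ccN]) auto
  qed
  define S where "S n = {y \<in> N. \<exists>y'\<in>N. b n = cmb (\<lambda>_. (1/2)^n) y y'}" for n :: nat
  have S_mono: "S n \<subseteq> S (Suc n)" for n
  proof
    fix y assume "y \<in> S n"
    then obtain y' where y: "y \<in> N" "y' \<in> N" "b n = cmb (\<lambda>_. (1/2)^n) y y'" by (auto simp: S_def)
    let ?k = "(1/2)^n :: real"
    let ?t = "1/2 * (1 - ?k) / (1 - 1/2 * ?k)"
    have k: "0 < ?k" "?k \<le> 1" by (auto intro: power_le_one)
    have t: "0 \<le> ?t" "?t \<le> 1" using rebracket_weight_bounds(1,2)[OF k] .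
    have zN: "z n \<in> N" using zX XN by auto
    have ne: "1/2 * ?k \<noteq> 1" using k by linarith
    have "b (Suc n) = cmb (\<lambda>_. 1/2 * ?k) y (cmb (\<lambda>_. ?t) y' (z n))"
      unfolding b_Suc y(3) using y zN Nc ne by (intro cmb_rebracket) auto
    moreover have "cmb (\<lambda>_. ?t) y' (z n) \<in> N" using y zN t by (intro closed_convex_cmb_const[OF ccN])
    ultimately show "y \<in> S (Suc n)" using y by (auto simp: S_def)
  qed
  have S_mono': "S m \<subseteq> S n" if "m \<le> n" for m n
    by (rule lift_Suc_mono_le[of S, OF S_mono that])
  have zS: "z n \<in> S (Suc n)" for n
  proof -
    let ?k = "(1/2)^(Suc n) :: real"
    let ?t = "(1/2 - ?k) / (1 - ?k)"
    have k: "0 < ?k" "?k \<le> 1/2" using power_le_one[of "1/2::real" n] by auto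
    have t: "0 \<le> ?t" "?t \<le> 1" using split_weight_bounds[OF k] .
    have zN: "z n \<in> N" using zX XN by auto
    have "b (Suc n) = cmb (\<lambda>_. 1/2) (z n) (b n)"
      unfolding b_Suc using cmb_swap[of "b n" "z n" "\<lambda>_. 1/2"] Nc[OF bN] Nc[OF zN] Kc[OF p] by simp
    also have "\<dots> = cmb (\<lambda>_. ?k) (z n) (cmb (\<lambda>_. ?t) (z n) (b n))"
      using Nc[OF bN] Nc[OF zN] Kc[OF p] k by (intro cmb_split[of _ _]) auto
    finally have "b (Suc n) = cmb (\<lambda>_. ?k) (z n) (cmb (\<lambda>_. ?t) (z n) (b n))" .
    moreover have "cmb (\<lambda>_. ?t) (z n) (b n) \<in> N" using zN bN t by (intro closed_convex_cmb_const[OF ccN])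
    ultimately show ?thesis using zN by (auto simp: S_def)
  qed
  have S_conv: "cmb f x y \<in> S n"
    if xy: "x \<in> S n" "y \<in> S n" and f: "f \<in> borel_measurable M" "\<And>w. 0 \<le> f w" "\<And>w. f w \<le> 1" for f x y n
  proof -
    obtain x' y' where x: "x \<in> N" "x' \<in> N" "b n = cmb (\<lambda>_. (1/2)^n) x x'"
      and y: "y \<in> N" "y' \<in> N" "b n = cmb (\<lambda>_. (1/2)^n) y y'" using xy by (auto simp: S_def)
    have "b n = cmb f (b n) (b n)" using cmb_refl[of "b n" f] Nc[OF bN] Kc[OF p] f by simp
    also have "\<dots> = cmb f (cmb (\<lambda>_. (1/2)^n) x x') (cmb (\<lambda>_. (1/2)^n) y y')"
      unfolding x(3)[symmetric] y(3)[symmetric] ..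
    also have "\<dots> = cmb (\<lambda>_. (1/2)^n) (cmb f x y) (cmb f x' y')"
      using x y f Nc by (intro cmb_interchange) auto
    finally show ?thesis using x y f closed_convex_cmb[OF ccN] unfolding S_def by blast
  qed
  define U where "U = (\<Union>n. S n)"
  have UN: "U \<subseteq> N" by (auto simp: U_def S_def)
  have Uc: "U \<subseteq> carrier E" using UN Nc by auto
  have ccH: "closed_convex (AE_closure U)"
  proof (rule closed_convex_AE_closure[OF Uc])
    fix x y and f :: "'w \<Rightarrow> real"
    assume "x \<in> U" "y \<in> U" and f: "f \<in> borel_measurable M" "\<And>w. 0 \<le> f w" "\<And>w. f w \<le> 1"
    then obtain m n where "x \<in> S m" "y \<in> S n" by (auto simp: U_def)
    then have "x \<in> S (max m n)" "y \<in> S (max m n)" using S_mono'[of m "max m n"] S_mono'[of n "max m n"] by auto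
    then show "cmb f x y \<in> U" unfolding U_def using S_conv f by blast
  qed
  have HN: "AE_closure U \<subseteq> N" using ccN UN by (rule AE_closure_least)
  have farS: "AE w in M. \<rho> w > 0 \<longrightarrow> (1 - (1/2)^n) * \<rho> w \<le> dst (z n) y w" if y: "y \<in> S n" for y n
  proof -
    obtain y' where y: "y \<in> N" "y' \<in> N" "b n = cmb (\<lambda>_. (1/2)^n) y y'" using y by (auto simp: S_def)
    let ?k = "(1/2)^n :: real"
    have k: "0 < ?k" "?k \<le> 1" by (auto intro: power_le_one)
    have c: "y \<in> carrier E" "y' \<in> carrier E" "z n \<in> carrier E" "b n \<in> carrier E"
      using Nc[OF y(1)] Nc[OF y(2)] Nc[OF bN] Kc[OF zK] by auto
    have "AE w in M. dst (b n) (z n) w \<le> ?k * dst y (z n) w + (1 - ?k) * dst y' (z n) w"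
      unfolding y(3) using c k by (intro AE_dst_cmb_point) auto
    moreover have "AE w in M. \<rho> w > 0 \<longrightarrow> dst y' (z n) w \<le> \<rho> w"
      using y zX XN by (intro diamN) auto
    ultimately show ?thesis
      using far[of n] AE_dst_commute[OF c(3,4)] AE_dst_commute[OF c(3,1)]
    proof eventually_elim
      case (elim w)
      have "(1 - (1/2)^n) * \<rho> w \<le> dst (z n) y w" if pos: "\<rho> w > 0"
      proof -
        have "(1 - ?k) * dst y' (z n) w \<le> (1 - ?k) * \<rho> w" using elim(2) pos k by (intro mult_left_mono) auto
        then have "(1 - (1/4)^(Suc n)) * \<rho> w \<le> ?k * dst (z n) y w + (1 - ?k) * \<rho> w"
          using elim pos by auto
        moreover have "(1/4)^(Suc n) * \<rho> w \<le> ?k * ?k * \<rho> w"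
        proof (rule mult_right_mono)
          have "(1/4::real)^(Suc n) = (1/4) * (?k * ?k)" by (simp add: power_mult_distrib[symmetric])
          then show "(1/4)^(Suc n) \<le> ?k * ?k" using k by simp
        qed (use pos in simp)
        ultimately have "?k * ((1 - ?k) * \<rho> w) \<le> ?k * dst (z n) y w" by (simp add: algebra_simps)
        then show ?thesis using k(1) by (simp only: mult_le_cancel_left_pos)
      qed
      then show ?case by blast
    qed
  qed
  have farU: "AE w in M. \<rho> w > 0 \<longrightarrow> (\<forall>\<delta>>0. \<exists>n. \<rho> w - \<delta> < dst (z n) y w)" if "y \<in> U" for y
  proof -
    obtain m where m: "y \<in> S m" using \<open>y \<in> U\<close> by (auto simp: U_def)
    have "AE w in M. \<forall>n. n \<ge> m \<longrightarrow> \<rho> w > 0 \<longrightarrow> (1 - (1/2)^n) * \<rho> w \<le> dst (z n) y w"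
      unfolding AE_all_countable
    proof
      fix n
      show "AE w in M. n \<ge> m \<longrightarrow> \<rho> w > 0 \<longrightarrow> (1 - (1/2)^n) * \<rho> w \<le> dst (z n) y w"
      proof (cases "n \<ge> m")
        case True
        then have "y \<in> S n" using S_mono'[OF True] m by auto
        from farS[OF this] show ?thesis by eventually_elim auto
      qed simp
    qed
    then show ?thesis
    proof eventually_elim
      case (elim w)
      have "\<exists>n. \<rho> w - \<delta> < dst (z n) y w" if "\<rho> w > 0" "\<delta> > 0" for \<delta>
      proof -
        have "(\<lambda>n. (1/2)^n * \<rho> w) \<longlonglongrightarrow> 0 * \<rho> w"
          by (intro tendsto_mult_right LIMSEQ_realpow_zero) auto
        then have "\<forall>\<^sub>F n in sequentially. (1/2)^n * \<rho> w < \<delta>" using that by (intro order_tendstoD) auto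
        then obtain j where j: "\<And>n. n \<ge> j \<Longrightarrow> (1/2)^n * \<rho> w < \<delta>" by (auto simp: eventually_sequentially)
        have "(1 - (1/2)^(max m j)) * \<rho> w \<le> dst (z (max m j)) y w" using elim that by simp
        then have "\<rho> w - \<delta> < dst (z (max m j)) y w" using j[of "max m j"] by (simp add: algebra_simps)
        then show ?thesis by blast
      qed
      then show ?case by blast
    qed
  qed
  show ?thesis
  proof (rule that[of "AE_closure U" z])
    show "AE_closure U \<subseteq> K" using HN NK by blast
    show "closed_convex (AE_closure U)" by fact
    show "z n \<in> AE_closure U" for n using zS[of n] AE_closure_superset[OF Uc] by (auto simp: U_def)
    show "AE w in M. \<rho> w > 0 \<longrightarrow> dst x y w \<le> \<rho> w" if "x \<in> AE_closure U" "y \<in> AE_closure U" for x y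
      using that HN by (intro diamN) auto
    fix y assume y: "y \<in> AE_closure U"
    then obtain u where u: "\<And>k::nat. u k \<in> U" "AE w in M. (\<lambda>k. dst (u k) y w) \<longlonglongrightarrow> 0"
      by (auto simp: AE_closure_def)
    have c: "u k \<in> carrier E" "z n \<in> carrier E" "y \<in> carrier E" for k n
      using u(1) Uc y Kc[OF zK] by (auto simp: AE_closure_def)
    have "AE w in M. \<forall>k. \<rho> w > 0 \<longrightarrow> (\<forall>\<delta>>0. \<exists>n. \<rho> w - \<delta> < dst (z n) (u k) w)"
      unfolding AE_all_countable using farU u(1) by blast
    moreover have "AE w in M. \<forall>k n. dst (z n) (u k) w \<le> dst (z n) y w + dst y (u k) w"
      unfolding AE_all_countable using c by (intro allI AE_dst_triangle)
    moreover have "AE w in M. \<forall>k. dst y (u k) w = dst (u k) y w"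
      unfolding AE_all_countable using c by (intro allI AE_dst_commute)
    ultimately show "AE w in M. \<rho> w > 0 \<longrightarrow> (\<forall>\<delta>>0. \<exists>n. \<rho> w - \<delta> < dst (z n) y w)"
      using u(2)
    proof eventually_elim
      case (elim w)
      have "\<exists>n. \<rho> w - \<delta> < dst (z n) y w" if "\<rho> w > 0" "\<delta> > 0" for \<delta>
      proof -
        have "\<forall>\<^sub>F k in sequentially. dst (u k) y w < \<delta> / 2" using that by (intro order_tendstoD[OF elim(4)]) auto
        then obtain k where k: "dst (u k) y w < \<delta> / 2" by (auto simp: eventually_sequentially)
        have "\<delta> / 2 > 0" using that by simp
        then obtain n where n: "\<rho> w - \<delta> / 2 < dst (z n) (u k) w" using elim(1)[rule_format, OF \<open>\<rho> w > 0\<close>, of "\<delta> / 2" k] by blast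
        have "\<rho> w - \<delta> < dst (z n) y w"
          using k n elim(2)[rule_format, of n k] elim(3)[rule_format, of k] by linarith
        then show ?thesis by blast
      qed
      then show ?case by blast
    qed
  qed
qed

end
end

section \<open>Normal structure and the common fixed point\<close>

context rn_module
begin

lemma rnorm_bar_rep:
  assumes "x \<in> carrier E"
  shows "rnorm_bar M E x \<in> L0 M" "AE w in M. L0_rep (rnorm_bar M E x) w = ereal (nrm x w)"
proof -
  have m: "(\<lambda>w. ereal (L0_rep (rnorm E x) w)) \<in> borel_measurable M"
    using nrm_measurable[OF assms] by (simp add: nrm_def)
  show "rnorm_bar M E x \<in> L0 M" unfolding rnorm_bar_def L0_map_def using m by (rule L0_class_in_L0)
  show "AE w in M. L0_rep (rnorm_bar M E x) w = ereal (nrm x w)"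
    unfolding rnorm_bar_def L0_map_def nrm_def using m by (rule L0_rep_class)
qed

lemma as_bounded_if_AE_bounded:
  assumes H: "H \<noteq> {}" "H \<subseteq> carrier E" and u: "u \<in> borel_measurable M" "\<And>x. x \<in> H \<Longrightarrow> AE w in M. nrm x w \<le> u w"
  shows "as_bounded M E H"
proof -
  define \<sigma> where "\<sigma> = \<Squnion>\<^bsub>L0_bar M\<^esub> (rnorm_bar M E ` H)"
  have sub: "rnorm_bar M E ` H \<subseteq> L0 M" using H rnorm_bar_rep(1) by auto
  note sup = L0_bar_sup[OF sub, folded \<sigma>_def]
  have [measurable]: "L0_rep \<sigma> \<in> borel_measurable M" using sup(1) by (rule L0_rep_measurable)
  obtain x where x: "x \<in> H" using H by auto
  then have xc: "x \<in> carrier E" using H by auto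
  have "AE w in M. L0_rep (rnorm_bar M E x) w \<le> L0_rep \<sigma> w" using x by (intro sup(2)) auto
  then have low: "AE w in M. 0 \<le> L0_rep \<sigma> w"
    using rnorm_bar_rep(2)[OF xc] AE_nrm_nonneg[OF xc]
  proof eventually_elim
    case (elim w)
    then have "ereal 0 \<le> ereal (nrm x w)" "ereal (nrm x w) \<le> L0_rep \<sigma> w" by simp_all
    then show ?case by (metis order_trans zero_ereal_def)
  qed
  have up: "AE w in M. L0_rep \<sigma> w \<le> ereal (u w)"
  proof (rule sup(3))
    show "(\<lambda>w. ereal (u w)) \<in> borel_measurable M" using u by simp
    fix \<xi> assume "\<xi> \<in> rnorm_bar M E ` H"
    then obtain y where y: "y \<in> H" "\<xi> = rnorm_bar M E y" by auto
    then have "y \<in> carrier E" using H by auto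
    from rnorm_bar_rep(2)[OF this] u(2)[OF y(1)] show "AE w in M. L0_rep \<xi> w \<le> ereal (u w)"
      unfolding y(2) by eventually_elim simp
  qed
  define r where "r w = real_of_ereal (L0_rep \<sigma> w)" for w
  have r[measurable]: "r \<in> borel_measurable M" unfolding r_def by measurable
  have rs: "AE w in M. ereal (r w) = L0_rep \<sigma> w \<and> 0 \<le> r w"
    using low up
  proof eventually_elim
    case (elim w)
    then show ?case unfolding r_def by (cases "L0_rep \<sigma> w") auto
  qed
  have rr: "AE w in M. L0_rep (L0_class M r) w = r w" using r by (rule L0_rep_class)
  have c0: "AE w in M. L0_rep (L0_const M (0::real)) w = 0" unfolding L0_const_def by (rule L0_rep_class) simp
  have "L0_class M r \<in> L0_plus M"
  proof -
    have "AE w in M. L0_rep (L0_const M 0) w \<le> L0_rep (L0_class M r) w"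
      using rs rr c0 by eventually_elim simp
    then show ?thesis by (simp add: L0_plus_def L0_le_def L0_class_in_L0)
  qed
  moreover have "L0_map M ereal (L0_class M r) = \<sigma>"
  proof -
    have "AE w in M. ereal (L0_rep (L0_class M r) w) = L0_rep \<sigma> w"
      using rs rr by eventually_elim simp
    then have "L0_map M ereal (L0_class M r) = L0_class M (L0_rep \<sigma>)"
      unfolding L0_map_def by (rule L0_class_cong)
    then show ?thesis using L0_class_rep[OF sup(1)] by simp
  qed
  ultimately show ?thesis unfolding as_bounded_def \<sigma>_def[symmetric] by (metis imageI)
qed

lemma nrm_eq_dst_zero: "x \<in> carrier E \<Longrightarrow> nrm x = dst x \<zero>\<^bsub>E\<^esub>"
proof -
  assume x: "x \<in> carrier E"
  have "x \<ominus>\<^bsub>E\<^esub> \<zero>\<^bsub>E\<^esub> = x \<oplus>\<^bsub>E\<^esub> scale (\<lambda>_. - 1) (scale (\<lambda>_. 0) x)"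
    using x by (simp add: minus_eq_scale scale_0)
  also have "\<dots> = x" using x by (subst scale_scale) (auto simp: scale_0)
  finally show "nrm x = dst x \<zero>\<^bsub>E\<^esub>" by (simp add: dst_def)
qed

lemma ccompact_as_bounded:
  assumes K: "ccompact K" and H: "H \<subseteq> K" "H \<noteq> {}"
  shows "as_bounded M E H"
proof -
  note c = closed_convex_carrier[OF ccompact_closed_convex[OF K]]
  obtain p where p: "p \<in> K" using H by auto
  obtain u where u: "u \<in> borel_measurable M" "\<And>x. x \<in> K \<Longrightarrow> AE w in M. dst x p w \<le> u w"
    using ccompact_bounded[OF K p] by blast
  have z: "\<zero>\<^bsub>E\<^esub> \<in> carrier E" by simp
  show ?thesis
  proof (rule as_bounded_if_AE_bounded[OF H(2)])
    show "H \<subseteq> carrier E" using H c by auto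
    have "nrm p \<in> borel_measurable M" using c[OF p] by (rule nrm_measurable)
    with u(1) show "(\<lambda>w. u w + nrm p w) \<in> borel_measurable M" by measurable
    fix x assume "x \<in> H"
    then have x: "x \<in> K" using H by auto
    have "AE w in M. dst x \<zero>\<^bsub>E\<^esub> w \<le> dst x p w + dst p \<zero>\<^bsub>E\<^esub> w" using c[OF x] c[OF p] z by (rule AE_dst_triangle)
    then show "AE w in M. nrm x w \<le> u w + nrm p w"
      unfolding nrm_eq_dst_zero[OF c[OF x]] nrm_eq_dst_zero[OF c[OF p]]
      using u(2)[OF x] by eventually_elim simp
  qed
qed

lemma rand_radius_upper:
  assumes "H \<subseteq> carrier E" "x \<in> carrier E" "y \<in> H"
  shows "AE w in M. ereal (dst x y w) \<le> L0_rep (rand_radius M E H x) w"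
proof -
  let ?\<Phi> = "{rnorm_bar M E (x \<ominus>\<^bsub>E\<^esub> y) | y. y \<in> H}"
  have c: "x \<ominus>\<^bsub>E\<^esub> y \<in> carrier E" if "y \<in> H" for y using assms that by auto
  have "?\<Phi> \<subseteq> L0 M" using rnorm_bar_rep(1) c by auto
  then have "AE w in M. L0_rep (rnorm_bar M E (x \<ominus>\<^bsub>E\<^esub> y)) w \<le> L0_rep (rand_radius M E H x) w"
    unfolding rand_radius_def using assms by (intro L0_bar_sup(2)) auto
  then show ?thesis using rnorm_bar_rep(2)[OF c[OF assms(3)]] by eventually_elim (simp add: dst_def)
qed

lemma rand_diam_bounds:
  assumes H: "H \<subseteq> carrier E"
  shows "x \<in> H \<Longrightarrow> y \<in> H \<Longrightarrow> AE w in M. ereal (dst x y w) \<le> L0_rep (rand_diam M E H) w"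
    and "h \<in> borel_measurable M \<Longrightarrow> (\<And>x y. x \<in> H \<Longrightarrow> y \<in> H \<Longrightarrow> AE w in M. ereal (dst x y w) \<le> h w) \<Longrightarrow>
      AE w in M. L0_rep (rand_diam M E H) w \<le> h w"
proof -
  let ?\<Phi> = "{rnorm_bar M E (x \<ominus>\<^bsub>E\<^esub> y) | x y. x \<in> H \<and> y \<in> H}"
  have c: "x \<ominus>\<^bsub>E\<^esub> y \<in> carrier E" if "x \<in> H" "y \<in> H" for x y using H that by auto
  have sub: "?\<Phi> \<subseteq> L0 M" using rnorm_bar_rep(1) c by auto
  {
    assume xy: "x \<in> H" "y \<in> H"
    have "AE w in M. L0_rep (rnorm_bar M E (x \<ominus>\<^bsub>E\<^esub> y)) w \<le> L0_rep (rand_diam M E H) w"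
      unfolding rand_diam_def using xy by (intro L0_bar_sup(2)[OF sub]) auto
    then show "AE w in M. ereal (dst x y w) \<le> L0_rep (rand_diam M E H) w"
      using rnorm_bar_rep(2)[OF c[OF xy]] by eventually_elim (simp add: dst_def)
  }
  assume h: "h \<in> borel_measurable M" "\<And>x y. x \<in> H \<Longrightarrow> y \<in> H \<Longrightarrow> AE w in M. ereal (dst x y w) \<le> h w"
  show "AE w in M. L0_rep (rand_diam M E H) w \<le> h w"
    unfolding rand_diam_def
  proof (rule L0_bar_sup(3)[OF sub h(1)])
    fix \<xi> assume "\<xi> \<in> ?\<Phi>"
    then obtain x y where xy: "x \<in> H" "y \<in> H" "\<xi> = rnorm_bar M E (x \<ominus>\<^bsub>E\<^esub> y)" by auto
    show "AE w in M. L0_rep \<xi> w \<le> h w"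
      unfolding xy(3) using h(2)[OF xy(1,2)] rnorm_bar_rep(2)[OF c[OF xy(1,2)]]
      by eventually_elim (simp add: dst_def)
  qed
qed

text \<open>On the event \<open>\<rho> > 0\<close> the diameter of \<open>H\<close> and the radius of \<open>H\<close> at each of its points both equal \<open>\<rho>\<close>.\<close>

lemma no_diametral_set:
  assumes ns: "random_normal_structure M E G" and H: "H \<subseteq> G" "closed_convex H" "as_bounded M E H"
    and z: "\<And>n::nat. z n \<in> H" and [measurable]: "\<rho> \<in> borel_measurable M"
    and diam: "\<And>x y. x \<in> H \<Longrightarrow> y \<in> H \<Longrightarrow> AE w in M. \<rho> w > 0 \<longrightarrow> dst x y w \<le> \<rho> w"
    and far: "\<And>y. y \<in> H \<Longrightarrow> AE w in M. \<rho> w > 0 \<longrightarrow> (\<forall>\<delta>>0. \<exists>n. \<rho> w - \<delta> < dst (z n) y w)"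
  shows "AE w in M. \<rho> w \<le> 0"
proof (rule ccontr)
  assume neg: "\<not> (AE w in M. \<rho> w \<le> 0)"
  have Hc: "H \<subseteq> carrier E" using closed_convex_carrier[OF H(2)] by auto
  let ?D = "rand_diam M E H"
  have c0: "AE w in M. L0_rep (L0_const M (0::ereal)) w = 0" unfolding L0_const_def by (rule L0_rep_class) simp
  have D_far: "AE w in M. \<forall>n. ereal (dst (z n) (z 0) w) \<le> L0_rep ?D w"
    unfolding AE_all_countable using z rand_diam_bounds(1)[OF Hc] by blast
  have D_pos: "AE w in M. \<rho> w > 0 \<longrightarrow> L0_rep ?D w > 0"
    using D_far far[OF z[of 0]]
  proof eventually_elim
    case (elim w)
    have "L0_rep ?D w > 0" if pos: "\<rho> w > 0"
    proof -
      obtain n where "\<rho> w - \<rho> w / 2 < dst (z n) (z 0) w" using elim(2) pos half_gt_zero by blast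
      then have "(0::ereal) < ereal (dst (z n) (z 0) w)" using pos by simp
      then show ?thesis using elim(1)[rule_format, of n] by (rule less_le_trans)
    qed
    then show ?case by blast
  qed
  have D_le: "AE w in M. \<rho> w > 0 \<longrightarrow> L0_rep ?D w \<le> ereal (\<rho> w)"
  proof -
    \<comment> \<open>nothing is known about the diameter where rho vanishes\<close>
    let ?h = "\<lambda>w. if \<rho> w > 0 then ereal (\<rho> w) else \<infinity>"
    have "AE w in M. L0_rep ?D w \<le> ?h w"
    proof (rule rand_diam_bounds(2)[OF Hc])
      show "?h \<in> borel_measurable M" by measurable
      fix x y assume "x \<in> H" "y \<in> H"
      from diam[OF this] show "AE w in M. ereal (dst x y w) \<le> ?h w" by eventually_elim auto
    qed
    then show ?thesis by eventually_elim auto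
  qed
  have "L0_gt M ?D (L0_const M 0)"
    unfolding L0_gt_def L0_le_def
  proof
    have "AE w in M. ereal (dst (z 0) (z 0) w) \<le> L0_rep ?D w" using z by (intro rand_diam_bounds(1)[OF Hc])
    moreover have "AE w in M. dst (z 0) (z 0) w = 0" using z Hc by (intro AE_dst_self) auto
    ultimately show "AE w in M. L0_rep (L0_const M 0) w \<le> L0_rep ?D w"
      using c0 by eventually_elim (simp add: zero_ereal_def)
    show "?D \<noteq> L0_const M 0"
    proof
      assume "?D = L0_const M 0"
      then have "AE w in M. L0_rep ?D w = 0" using c0 by simp
      with D_pos have "AE w in M. \<rho> w \<le> 0" by eventually_elim auto
      then show False using neg by simp
    qed
  qed
  then obtain y where y: "y \<in> H"
    and gt: "L0_gt_on M (L0_gt_event M ?D (L0_const M 0)) ?D (rand_radius M E H y)"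
    using ns H z unfolding random_normal_structure_def closed_convex_def by blast
  have yc: "y \<in> carrier E" using y Hc by auto
  have "AE w in M. \<forall>n. ereal (dst y (z n) w) \<le> L0_rep (rand_radius M E H y) w"
    unfolding AE_all_countable using z yc Hc by (intro allI rand_radius_upper)
  moreover have "AE w in M. \<forall>n. dst y (z n) w = dst (z n) y w"
    unfolding AE_all_countable using z yc Hc by (intro allI AE_dst_commute) auto
  moreover have "AE w in M. w \<in> L0_gt_event M ?D (L0_const M 0) \<longrightarrow> L0_rep ?D w > L0_rep (rand_radius M E H y) w"
    using gt by (simp add: L0_gt_on_def)
  ultimately have "AE w in M. \<rho> w \<le> 0"
    using far[OF y] D_pos D_le c0 AE_space
  proof eventually_elim
    case (elim w)
    show "\<rho> w \<le> 0"
    proof (rule ccontr)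
      assume "\<not> \<rho> w \<le> 0"
      then have pos: "\<rho> w > 0" by simp
      let ?R = "L0_rep (rand_radius M E H y) w"
      have "w \<in> L0_gt_event M ?D (L0_const M 0)" using elim pos by (simp add: L0_gt_event_def)
      then have "?R < L0_rep ?D w" using elim(3) by blast
      then have "?R < ereal (\<rho> w)" using elim(6) pos by (meson less_le_trans)
      then obtain q where q: "?R < ereal q" "q < \<rho> w" using ereal_dense2[of ?R "ereal (\<rho> w)"] by auto
      then obtain n where n: "\<rho> w - (\<rho> w - q) < dst (z n) y w" using elim(4) pos by (meson diff_gt_0_iff_gt)
      have "ereal (dst (z n) y w) \<le> ?R" using elim(1)[rule_format, of n] elim(2)[rule_format, of n] by simp
      then have "ereal (dst (z n) y w) < ereal q" using q(1) by (rule le_less_trans)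
      then show False using n by simp
    qed
  qed
  then show False using neg by simp
qed

text \<open>Some \<open>s z\<close> is arbitrarily close to both points.\<close>

lemma asymp_bound_zero_unique:
  assumes K: "ccompact K" and ne: "\<And>T. T \<in> \<T> \<Longrightarrow> nonexp K T" and comm: "commutative_family_on K \<T>"
    and x: "x \<in> K" and y: "y \<in> K" and b: "asymp_bound K \<T> \<rho> x" "asymp_bound K \<T> \<rho> y"
    and \<rho>: "AE w in M. \<rho> w \<le> 0"
  shows "x = y"
proof -
  have c: "x \<in> carrier E" "y \<in> carrier E" using x y closed_convex_carrier[OF ccompact_closed_convex[OF K]] by auto
  note [measurable] = dst_measurable[OF c]
  have nn: "AE w in M. 0 \<le> dst x y w" using c by (rule AE_dst_nonneg)
  have "AE w in M. (\<lambda>k::nat. dst x y w) \<longlonglongrightarrow> 0"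
  proof (rule AE_tendsto_if_prob_fast)
    fix k
    let ?e = "(1/2)^Suc (Suc k) :: real"
    have e: "?e > 0" by simp
    obtain s A where s: "s \<in> composites \<T>" and A: "A \<in> sets M" "prob A > 1 - ?e" and sA:
      "\<And>z. z \<in> K \<Longrightarrow> AE w in M. w \<in> A \<longrightarrow> dst (s z) x w \<le> \<rho> w + ?e \<and> dst (s z) y w \<le> \<rho> w + ?e"
      using asymp_bound_pair[OF K ne comm b e] by blast
    have sc: "s x \<in> carrier E" using composites_in_K[OF K ne comm s x] closed_convex_carrier[OF ccompact_closed_convex[OF K]] by auto
    have "AE w in M. w \<in> A \<longrightarrow> w \<in> {w \<in> space M. dst x y w < (1/2)^k}"
      using sA[OF x] \<rho> AE_dst_triangle[OF c(1) sc c(2)] AE_dst_commute[OF c(1) sc] AE_space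
    proof eventually_elim
      case (elim w)
      have "?e + ?e < (1/2)^k" by simp
      then show ?case using elim by (simp del: power_Suc) linarith
    qed
    then have "prob A \<le> prob {w \<in> space M. dst x y w < (1/2)^k}" by (rule finite_measure_mono_AE) measurable
    moreover have "?e \<le> (1/2)^k" by simp
    ultimately show "prob {w \<in> space M. dst x y w < (1/2)^k} > 1 - (1/2)^k" using A(2) by linarith
  qed (use nn in auto)
  then have "AE w in M. dst x y w = 0"
  proof eventually_elim
    case (elim w)
    then show ?case by (rule LIMSEQ_unique[OF tendsto_const])
  qed
  then show ?thesis by (rule eq_if_AE_dst_zero[OF c])
qed

text \<open>Asymptotic bounds do not depend on the center, as the centers with a given bound form an invariant closed convex subset of the minimal set.\<close>

lemma common_fixed_point:
  assumes G: "ccompact G" and ns: "random_normal_structure M E G"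
    and ne: "\<And>T. T \<in> \<T> \<Longrightarrow> nonexp G T" and comm: "commutative_family_on G \<T>"
  shows "\<exists>x\<in>G. \<forall>T\<in>\<T>. T x = x"
proof -
  have maps: "T \<in> G \<rightarrow> G" if "T \<in> \<T>" for T using ne[OF that] by (simp add: nonexp_def)
  obtain K where K: "ccompact K" "K \<subseteq> G" and KT: "\<And>T. T \<in> \<T> \<Longrightarrow> T \<in> K \<rightarrow> K"
    and min: "\<And>V. V \<subseteq> K \<Longrightarrow> V \<noteq> {} \<Longrightarrow> closed_convex V \<Longrightarrow> (\<And>T. T \<in> \<T> \<Longrightarrow> T \<in> V \<rightarrow> V) \<Longrightarrow> V = K"
    using minimal_invariant[OF G maps, of \<T>] by blast
  have neK: "nonexp K T" if "T \<in> \<T>" for T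
    using ne[OF that] KT[OF that] K(2) unfolding nonexp_def by blast
  have commK: "commutative_family_on K \<T>" using comm K(2) unfolding commutative_family_on_def by blast
  obtain p where p: "p \<in> K" using ccompact_nonempty[OF K(1)] by auto
  have const: "asymp_bound K \<T> c y'" if c: "asymp_bound K \<T> c y" and y: "y \<in> K" and y': "y' \<in> K" for c y y'
  proof -
    let ?V = "{y \<in> K. asymp_bound K \<T> c y}"
    have "?V = K"
    proof (rule min)
      show "?V \<noteq> {}" using c y by blast
      show "closed_convex ?V" by (rule closed_convex_asymp_bound[OF K(1) neK commK])
      show "T \<in> ?V \<rightarrow> ?V" if T: "T \<in> \<T>" for T
        using asymp_bound_invariant[OF K(1) neK commK _ _ T] KT[OF T] by auto
    qed auto
    then show ?thesis using y' by blast
  qed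
  obtain \<rho> where \<rho>: "\<rho> \<in> borel_measurable M" "asymp_bound K \<T> \<rho> p"
    "\<And>c. c \<in> borel_measurable M \<Longrightarrow> asymp_bound K \<T> c p \<Longrightarrow> AE w in M. \<rho> w \<le> c w"
    using least_asymp_bound[OF K(1) neK commK p] by blast
  have bound: "asymp_bound K \<T> \<rho> y" if "y \<in> K" for y using const[OF \<rho>(2) p that] .
  have least: "AE w in M. \<rho> w \<le> c w" if "c \<in> borel_measurable M" "y \<in> K" "asymp_bound K \<T> c y" for c y
    using \<rho>(3)[OF that(1) const[OF that(3,2) p]] .
  have eq: "\<exists>x\<in>K. AE w in M. \<rho> w > 0 \<longrightarrow>
      (\<forall>y\<in>F. dst x y w \<le> (1 + e) * \<rho> w) \<and> (1 - e) * \<rho> w \<le> dst x b w"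
    if "finite F" "F \<subseteq> K" "b \<in> K" "e > 0" for F b e
    by (rule equidistant_point[OF K(1) neK commK \<rho>(1) bound least that])
  obtain H and z :: "nat \<Rightarrow> 'e" where H: "H \<subseteq> K" "closed_convex H" and z: "\<And>n. z n \<in> H"
    and diam: "\<And>x y. x \<in> H \<Longrightarrow> y \<in> H \<Longrightarrow> AE w in M. \<rho> w > 0 \<longrightarrow> dst x y w \<le> \<rho> w"
    and far: "\<And>y. y \<in> H \<Longrightarrow> AE w in M. \<rho> w > 0 \<longrightarrow> (\<forall>\<delta>>0. \<exists>n. \<rho> w - \<delta> < dst (z n) y w)"
    using diametral_set[OF K(1) p \<rho>(1) eq] by blast
  have bH: "as_bounded M E H" using z by (intro ccompact_as_bounded[OF K(1) H(1)]) auto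
  have \<rho>0: "AE w in M. \<rho> w \<le> 0"
    using no_diametral_set[OF ns _ H(2) bH z \<rho>(1) diam far] H(1) K(2) by blast
  have "T p = p" if T: "T \<in> \<T>" for T
  proof -
    have Tp: "T p \<in> K" using KT[OF T] p by auto
    show ?thesis by (rule asymp_bound_zero_unique[OF K(1) neK commK Tp p bound[OF Tp] bound[OF p] \<rho>0])
  qed
  then show ?thesis using p K(2) by blast
qed

end

theorem theorem1p15:
  fixes M :: "'w measure"
    and E :: "('w, 'k::{real_normed_field, second_countable_topology}, 'e) rn_module"
    and G :: "'e set"
    and \<T> :: "('e \<Rightarrow> 'e) set"
  assumes "rn_module M E"
    and "eps_lam_complete M E"
    and "L0_convexly_compact M E G"
    and "random_normal_structure M E G"
    and "\<forall>T\<in>\<T>. nonexpansive_on M E G T"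
    and "commutative_family_on G \<T>"
  shows "\<exists>x\<in>G. \<forall>T\<in>\<T>. T x = x"
proof -
  interpret rn_module M E by fact
  show ?thesis
    using assms(5) by (intro common_fixed_point[OF assms(3,4) _ assms(6)]) (simp add: nonexp_iff)
qed

end
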